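(* Assume (A1), (A2) and the information assumption (I) of the context, and let $x_0\in\mathbb{R}$. Given the leader's strategy $v_2(\cdot)\in\mathcal{U}_{ad}^{l}[0,T]$, let $\bar v_1(\cdot)\in\mathcal{U}_{ad}^{f}[0,T]$ be an optimal control of the follower (i.e. $\bar v_1$ minimizes $J_1(\cdot,v_2(\cdot))$ over $\mathcal{U}_{ad}^{f}[0,T]$) and let $x^{\bar v_1,v_2}(\cdot)$ be the corresponding state trajectory. Then $$R(t)\bar v_1(t)+r(t)+B_1(t)\,\mathbb{E}\big[p(t)\,\big|\,\mathcal{F}_t^{Y_1^{\bar v_1,v_2}}\big]=0,\quad \text{a.e. } t\in[0,T],\ \text{a.s.},$$ where the adjoint process triple $(p(\cdot),k(\cdot),\bar k(\cdot))$ is the $\mathcal{F}_t$-adapted solution of the backward stochastic differential equation $$\begin{cases}-dp(t)=\big[A(t)p(t)+L(t)x^{\bar v_1,v_2}(t)+l(t)\big]dt-k(t)\,dW(t)-\bar k(t)\,d\bar W(t),\quad t\in[0,T],\\ p(T)=Mx^{\bar v_1,v_2}(T)+m.\end{cases}$$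
   Context: Let $T>0$ and let $(\Omega,\mathcal{F},\mathbb{P})$ be a complete probability space carrying two independent one-dimensional standard Brownian motions $W,\bar W$ (null at $0$); $\mathcal{F}_t$ is the filtration generated by $(W,\bar W)$ augmented by the $\mathbb{P}$-null sets. For a process $\Delta$, $\mathcal{F}_t^{\Delta}:=\sigma\{\Delta(r):0\le r\le t\}$. For two filtrations, $\wedge$ denotes intersection. State: for controls $(v_1,v_2)$ (follower, leader), all processes real valued, $$dx^{v_1,v_2}(t)=[A(t)x^{v_1,v_2}(t)+B_1(t)v_1(t)+B_2(t)v_2(t)+\alpha(t)]dt+c(t)dW(t)+\bar c(t)d\bar W(t),\quad x^{v_1,v_2}(0)=x_0.$$ Observation of the follower: $dY_1^{v_1,v_2}(t)=[f_1(t)x^{v_1,v_2}(t)+g(t)]dt+dW(t)$, $Y_1^{v_1,v_2}(0)=0$. Observation of the leader: $dY_2^{v_2}(t)=[f_2(t)+v_2(t)]dt+dW(t)$, $Y_2^{v_2}(0)=0$. Uncontrolled parts: $dx^0(t)=A(t)x^0(t)dt+c(t)dW(t)+\bar c(t)d\bar W(t)$, $x^0(0)=x_0$; $dY_1^0(t)=f_1(t)x^0(t)dt+dW(t)$, $Y_1^0(0)=0$. Admissible controls: $\mathcal{U}_{ad}^{l}[0,T]$ is the set of real-valued $\mathcal{F}_t^{Y_2^{v_2}}$-adapted processes $v_2$ with $\mathbb{E}[\sup_{0\le t\le T}v_2(t)^2]<\infty$. $\mathcal{U}_{ad}^{f0}[0,T]$ is the set of real-valued $\mathcal{F}_t^{Y_1^0}$-adapted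 processes $v_1$ with $\mathbb{E}[\sup_{0\le t\le T}v_1(t)^2]<\infty$. For given $v_2\in\mathcal{U}_{ad}^{l}[0,T]$, $\mathcal{U}_{ad}^{f}[0,T]$ is the set of $v_1\in\mathcal{U}_{ad}^{f0}[0,T]$ that are also $\mathcal{F}_t^{Y_1^{v_1,v_2}}$-adapted. Follower's cost: $$J_1(v_1,v_2)=\tfrac12\mathbb{E}\Big\{\int_0^T\big[L(t)(x^{v_1,v_2}(t))^2+R(t)v_1(t)^2+2l(t)x^{v_1,v_2}(t)+2r(t)v_1(t)\big]dt+M(x^{v_1,v_2}(T))^2+2m\,x^{v_1,v_2}(T)\Big\}.$$ (A1) $A,B_1,B_2,\alpha,c,\bar c,f_1,f_2,g$ are uniformly bounded deterministic functions on $[0,T]$; $x_0$ is a constant. (A2) $L\ge0,\bar L\ge0,R\ge0,\bar R\ge0,l,\bar l,r,\bar r$ are uniformly bounded deterministic functions; $M\ge0,\bar M\ge0$ and $m,\bar m$ are constants. (Barred coefficients belong to the leader's cost.) (I) For all admissible $v_1,v_2$: $\mathcal{F}_t^{Y_2^{v_2}}\subseteq\mathcal{F}_t^{Y_1^{v_1,v_2}}\wedge\mathcal{F}_t^{Y_1^0}$, $t\in[0,T]$. *)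

theory Defs
  imports "HOL-Probability.Probability"
begin

text \<open>
  A process is a function of time and sample point; only its values at times in [0,T] matter.
\<close>

definition generated_filtration ::
  "'a measure \<Rightarrow> (real \<Rightarrow> 'a \<Rightarrow> 'b::topological_space) \<Rightarrow> real \<Rightarrow> 'a measure"
  where "generated_filtration P X t =
    sigma (space P) {X r -` B \<inter> space P |r B. r \<in> {0..t} \<and> B \<in> sets borel}"

definition augmented :: "'a measure \<Rightarrow> (real \<Rightarrow> 'a measure) \<Rightarrow> real \<Rightarrow> 'a measure"
  where "augmented P F t = sigma (space P) (sets (F t) \<union> null_sets P)"

definition measurable_process :: "'a measure \<Rightarrow> real \<Rightarrow> (real \<Rightarrow> 'a \<Rightarrow> real) \<Rightarrow> bool"
  where "measurable_process P T X \<longleftrightarrow>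
    (\<lambda>(t, \<omega>). X t \<omega>) \<in> borel_measurable (restrict_space borel {0..T} \<Otimes>\<^sub>M P)"

definition adapted :: "(real \<Rightarrow> 'a measure) \<Rightarrow> real \<Rightarrow> (real \<Rightarrow> 'a \<Rightarrow> real) \<Rightarrow> bool"
  where "adapted F T X \<longleftrightarrow> (\<forall>t\<in>{0..T}. X t \<in> borel_measurable (F t))"

definition continuous_process :: "'a measure \<Rightarrow> real \<Rightarrow> (real \<Rightarrow> 'a \<Rightarrow> real) \<Rightarrow> bool"
  where "continuous_process P T X \<longleftrightarrow> (AE \<omega> in P. continuous_on {0..T} (\<lambda>t. X t \<omega>))"

text \<open>
  The condition \<open>E[sup\<^sub>t X(t)\<^sup>2] < \<infinity>\<close>. For a measurable process on a complete
  probability space the supremum is measurable.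
\<close>

definition sup_square_integrable :: "'a measure \<Rightarrow> real \<Rightarrow> (real \<Rightarrow> 'a \<Rightarrow> real) \<Rightarrow> bool"
  where "sup_square_integrable P T X \<longleftrightarrow>
    (\<integral>\<^sup>+\<omega>. (SUP t\<in>{0..T}. ennreal ((X t \<omega>)\<^sup>2)) \<partial>P) < \<infinity>"

definition bounded_coeff :: "real \<Rightarrow> (real \<Rightarrow> real) \<Rightarrow> bool"
  where "bounded_coeff T f \<longleftrightarrow>
    set_borel_measurable borel {0..T} f \<and> (\<exists>K. \<forall>t\<in>{0..T}. \<bar>f t\<bar> \<le> K)"

definition brownian_motion :: "'a measure \<Rightarrow> real \<Rightarrow> (real \<Rightarrow> 'a \<Rightarrow> real) \<Rightarrow> bool"
  where "brownian_motion P T W \<longleftrightarrow>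
    (\<forall>t\<in>{0..T}. W t \<in> borel_measurable P) \<and>
    (AE \<omega> in P. W 0 \<omega> = 0) \<and>
    continuous_process P T W \<and>
    (\<forall>s t. 0 \<le> s \<and> s < t \<and> t \<le> T \<longrightarrow>
      distributed P lborel (\<lambda>\<omega>. W t \<omega> - W s \<omega>)
        (\<lambda>y. ennreal (normal_density 0 (sqrt (t - s)) y)) \<and>
      prob_space.indep_set P
        (sets (generated_filtration P W s))
        (sets (vimage_algebra (space P) (\<lambda>\<omega>. W t \<omega> - W s \<omega>) borel)))"

definition independent_processes ::
  "'a measure \<Rightarrow> real \<Rightarrow> (real \<Rightarrow> 'a \<Rightarrow> real) \<Rightarrow> (real \<Rightarrow> 'a \<Rightarrow> real) \<Rightarrow> bool"
  where "independent_processes P T X Y \<longleftrightarrow>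
    prob_space.indep_set P (sets (generated_filtration P X T)) (sets (generated_filtration P Y T))"

definition brownian_filtration ::
  "'a measure \<Rightarrow> (real \<Rightarrow> 'a \<Rightarrow> real) \<Rightarrow> (real \<Rightarrow> 'a \<Rightarrow> real) \<Rightarrow> real \<Rightarrow> 'a measure"
  where "brownian_filtration P W Wb =
    augmented P (generated_filtration P (\<lambda>t \<omega>. (W t \<omega>, Wb t \<omega>)))"

text \<open>
  The Ito integral, by \<open>L\<^sup>2\<close> approximation with simple integrands
  \<open>\<Sum>i<n. \<xi> i 1\<^bsub>(\<tau> i, \<tau> (i+1)]\<^esub>\<close>.
\<close>

definition simple_integrand ::
  "(real \<Rightarrow> 'a measure) \<Rightarrow> real \<Rightarrow> nat \<Rightarrow> (nat \<Rightarrow> real) \<Rightarrow> (nat \<Rightarrow> 'a \<Rightarrow> real) \<Rightarrow> bool"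
  where "simple_integrand F T n \<tau> \<xi> \<longleftrightarrow>
    0 \<le> \<tau> 0 \<and> (\<forall>i<n. \<tau> i \<le> \<tau> (Suc i)) \<and> \<tau> n \<le> T \<and>
    (\<forall>i<n. \<xi> i \<in> borel_measurable (F (\<tau> i)) \<and> (\<exists>K. \<forall>\<omega>\<in>space (F (\<tau> i)). \<bar>\<xi> i \<omega>\<bar> \<le> K))"

definition simple_process ::
  "nat \<Rightarrow> (nat \<Rightarrow> real) \<Rightarrow> (nat \<Rightarrow> 'a \<Rightarrow> real) \<Rightarrow> real \<Rightarrow> 'a \<Rightarrow> real"
  where "simple_process n \<tau> \<xi> t \<omega> = (\<Sum>i<n. \<xi> i \<omega> * indicator {\<tau> i<..\<tau> (Suc i)} t)"

definition simple_integral ::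
  "(real \<Rightarrow> 'a \<Rightarrow> real) \<Rightarrow> nat \<Rightarrow> (nat \<Rightarrow> real) \<Rightarrow> (nat \<Rightarrow> 'a \<Rightarrow> real) \<Rightarrow> real \<Rightarrow> 'a \<Rightarrow> real"
  where "simple_integral W n \<tau> \<xi> t \<omega> =
    (\<Sum>i<n. \<xi> i \<omega> * (W (min t (\<tau> (Suc i))) \<omega> - W (min t (\<tau> i)) \<omega>))"

text \<open>
  \<open>ito_integral P F W T k I\<close>: the process \<open>I\<close> is a continuous version of
  \<open>t \<mapsto> \<integral>\<^sub>0\<^sup>t k dW\<close> on [0,T].
\<close>

definition ito_integral ::
  "'a measure \<Rightarrow> (real \<Rightarrow> 'a measure) \<Rightarrow> (real \<Rightarrow> 'a \<Rightarrow> real) \<Rightarrow> real \<Rightarrow>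
    (real \<Rightarrow> 'a \<Rightarrow> real) \<Rightarrow> (real \<Rightarrow> 'a \<Rightarrow> real) \<Rightarrow> bool"
  where "ito_integral P F W T k I \<longleftrightarrow>
    measurable_process P T k \<and> adapted F T k \<and>
    (\<integral>\<^sup>+\<omega>. (\<integral>\<^sup>+t\<in>{0..T}. ennreal ((k t \<omega>)\<^sup>2) \<partial>lborel) \<partial>P) < \<infinity> \<and>
    measurable_process P T I \<and> adapted F T I \<and> continuous_process P T I \<and>
    (\<exists>N \<tau> \<xi>.
      (\<forall>j. simple_integrand F T (N j) (\<tau> j) (\<xi> j)) \<and>
      (\<lambda>j. \<integral>\<^sup>+\<omega>. (\<integral>\<^sup>+t\<in>{0..T}.
          ennreal ((simple_process (N j) (\<tau> j) (\<xi> j) t \<omega> - k t \<omega>)\<^sup>2) \<partial>lborel) \<partial>P)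
        \<longlonglongrightarrow> 0 \<and>
      (\<forall>t\<in>{0..T}. (\<lambda>j. \<integral>\<^sup>+\<omega>.
          ennreal ((simple_integral W (N j) (\<tau> j) (\<xi> j) t \<omega> - I t \<omega>)\<^sup>2) \<partial>P)
        \<longlonglongrightarrow> 0))"

text \<open>
  \<open>x\<close> solves \<open>dx = (a x + b) dt + c dW + cb dWb\<close>, \<open>x(0) = x0\<close>, where the inhomogeneity
  \<open>b\<close> is a process (it carries the controls).
\<close>

definition solves_linear_sde ::
  "'a measure \<Rightarrow> (real \<Rightarrow> 'a \<Rightarrow> real) \<Rightarrow> (real \<Rightarrow> 'a \<Rightarrow> real) \<Rightarrow> real \<Rightarrow>
    (real \<Rightarrow> real) \<Rightarrow> (real \<Rightarrow> 'a \<Rightarrow> real) \<Rightarrow> (real \<Rightarrow> real) \<Rightarrow> (real \<Rightarrow> real) \<Rightarrow> real \<Rightarrow>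
    (real \<Rightarrow> 'a \<Rightarrow> real) \<Rightarrow> bool"
  where "solves_linear_sde P W Wb T a b c cb x0 x \<longleftrightarrow>
    measurable_process P T x \<and> adapted (brownian_filtration P W Wb) T x \<and>
    continuous_process P T x \<and>
    (\<exists>I Ib.
      ito_integral P (brownian_filtration P W Wb) W T (\<lambda>t \<omega>. c t) I \<and>
      ito_integral P (brownian_filtration P W Wb) Wb T (\<lambda>t \<omega>. cb t) Ib \<and>
      (AE \<omega> in P. \<forall>t\<in>{0..T}.
        x t \<omega> = x0 + (LBINT s:{0..t}. a s * x s \<omega> + b s \<omega>) + I t \<omega> + Ib t \<omega>))"

text \<open>
  \<open>(p, k, kb)\<close> is the adapted solution of
  \<open>-dp = (a p + b) dt - k dW - kb dWb\<close>, \<open>p(T) = \<zeta>\<close>.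
\<close>

definition solves_linear_bsde ::
  "'a measure \<Rightarrow> (real \<Rightarrow> 'a \<Rightarrow> real) \<Rightarrow> (real \<Rightarrow> 'a \<Rightarrow> real) \<Rightarrow> real \<Rightarrow>
    (real \<Rightarrow> real) \<Rightarrow> (real \<Rightarrow> 'a \<Rightarrow> real) \<Rightarrow> ('a \<Rightarrow> real) \<Rightarrow>
    (real \<Rightarrow> 'a \<Rightarrow> real) \<Rightarrow> (real \<Rightarrow> 'a \<Rightarrow> real) \<Rightarrow> (real \<Rightarrow> 'a \<Rightarrow> real) \<Rightarrow> bool"
  where "solves_linear_bsde P W Wb T a b \<zeta> p k kb \<longleftrightarrow>
    measurable_process P T p \<and> adapted (brownian_filtration P W Wb) T p \<and>
    continuous_process P T p \<and> sup_square_integrable P T p \<and>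
    (\<exists>I Ib.
      ito_integral P (brownian_filtration P W Wb) W T k I \<and>
      ito_integral P (brownian_filtration P W Wb) Wb T kb Ib \<and>
      (AE \<omega> in P. \<forall>t\<in>{0..T}.
        p t \<omega> = \<zeta> \<omega> + (LBINT s:{t..T}. a s * p s \<omega> + b s \<omega>)
          - (I T \<omega> - I t \<omega>) - (Ib T \<omega> - Ib t \<omega>)))"

text \<open>The observation process with drift \<open>h\<close>: \<open>dY = h dt + dW\<close>, \<open>Y(0) = 0\<close>.\<close>

definition observation ::
  "(real \<Rightarrow> 'a \<Rightarrow> real) \<Rightarrow> (real \<Rightarrow> 'a \<Rightarrow> real) \<Rightarrow> real \<Rightarrow> 'a \<Rightarrow> real"
  where "observation W h t \<omega> = (LBINT s:{0..t}. h s \<omega>) + W t \<omega>"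

definition Y1 ::
  "(real \<Rightarrow> 'a \<Rightarrow> real) \<Rightarrow> (real \<Rightarrow> real) \<Rightarrow> (real \<Rightarrow> real) \<Rightarrow> (real \<Rightarrow> 'a \<Rightarrow> real) \<Rightarrow>
    real \<Rightarrow> 'a \<Rightarrow> real"
  where "Y1 W f1 g x = observation W (\<lambda>t \<omega>. f1 t * x t \<omega> + g t)"

definition Y1_uncontrolled ::
  "(real \<Rightarrow> 'a \<Rightarrow> real) \<Rightarrow> (real \<Rightarrow> real) \<Rightarrow> (real \<Rightarrow> 'a \<Rightarrow> real) \<Rightarrow> real \<Rightarrow> 'a \<Rightarrow> real"
  where "Y1_uncontrolled W f1 xunc = observation W (\<lambda>t \<omega>. f1 t * xunc t \<omega>)"

definition Y2 ::
  "(real \<Rightarrow> 'a \<Rightarrow> real) \<Rightarrow> (real \<Rightarrow> real) \<Rightarrow> (real \<Rightarrow> 'a \<Rightarrow> real) \<Rightarrow> real \<Rightarrow> 'a \<Rightarrow> real"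
  where "Y2 W f2 v2 = observation W (\<lambda>t \<omega>. f2 t + v2 t \<omega>)"

text \<open>
  The state, hence the follower's observation, is only determined up to a null set. Adaptedness
  to an observation filtration and the inclusion of such filtrations are therefore understood
  modulo null sets, that is, for the augmented filtrations.

  Leader controls are required to be adapted to the Brownian filtration as well: without this,
  a control \<open>b(t, Y2)\<close> could come from a weak solution of \<open>dY2 = (f2 + b(t, Y2)) dt + dW\<close>
  that anticipates the noise, and the information assumption below would exclude it anyway.
\<close>

definition leader_controls ::
  "'a measure \<Rightarrow> (real \<Rightarrow> 'a \<Rightarrow> real) \<Rightarrow> (real \<Rightarrow> 'a \<Rightarrow> real) \<Rightarrow> real \<Rightarrow> (real \<Rightarrow> real) \<Rightarrow>
    (real \<Rightarrow> 'a \<Rightarrow> real) set"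
  where "leader_controls P W Wb T f2 =
    {v2. measurable_process P T v2 \<and> sup_square_integrable P T v2 \<and>
      adapted (brownian_filtration P W Wb) T v2 \<and>
      adapted (augmented P (generated_filtration P (Y2 W f2 v2))) T v2}"

definition follower_controls0 ::
  "'a measure \<Rightarrow> (real \<Rightarrow> 'a \<Rightarrow> real) \<Rightarrow> real \<Rightarrow> (real \<Rightarrow> real) \<Rightarrow> (real \<Rightarrow> 'a \<Rightarrow> real) \<Rightarrow>
    (real \<Rightarrow> 'a \<Rightarrow> real) set"
  where "follower_controls0 P W T f1 xunc =
    {v1. measurable_process P T v1 \<and> sup_square_integrable P T v1 \<and>
      adapted (augmented P (generated_filtration P (Y1_uncontrolled W f1 xunc))) T v1}"

text \<open>In the following, \<open>x v1 v2\<close> is the state process under the controls \<open>v1\<close>, \<open>v2\<close>.\<close>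

definition follower_controls ::
  "'a measure \<Rightarrow> (real \<Rightarrow> 'a \<Rightarrow> real) \<Rightarrow> real \<Rightarrow> (real \<Rightarrow> real) \<Rightarrow> (real \<Rightarrow> real) \<Rightarrow>
    (real \<Rightarrow> 'a \<Rightarrow> real) \<Rightarrow>
    ((real \<Rightarrow> 'a \<Rightarrow> real) \<Rightarrow> (real \<Rightarrow> 'a \<Rightarrow> real) \<Rightarrow> real \<Rightarrow> 'a \<Rightarrow> real) \<Rightarrow>
    (real \<Rightarrow> 'a \<Rightarrow> real) \<Rightarrow> (real \<Rightarrow> 'a \<Rightarrow> real) set"
  where "follower_controls P W T f1 g xunc x v2 =
    {v1 \<in> follower_controls0 P W T f1 xunc.
      adapted (augmented P (generated_filtration P (Y1 W f1 g (x v1 v2)))) T v1}"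

definition information_assumption ::
  "'a measure \<Rightarrow> (real \<Rightarrow> 'a \<Rightarrow> real) \<Rightarrow> (real \<Rightarrow> 'a \<Rightarrow> real) \<Rightarrow> real \<Rightarrow>
    (real \<Rightarrow> real) \<Rightarrow> (real \<Rightarrow> real) \<Rightarrow> (real \<Rightarrow> real) \<Rightarrow> (real \<Rightarrow> 'a \<Rightarrow> real) \<Rightarrow>
    ((real \<Rightarrow> 'a \<Rightarrow> real) \<Rightarrow> (real \<Rightarrow> 'a \<Rightarrow> real) \<Rightarrow> real \<Rightarrow> 'a \<Rightarrow> real) \<Rightarrow> bool"
  where "information_assumption P W Wb T f1 f2 g xunc x \<longleftrightarrow>
    (\<forall>v2 \<in> leader_controls P W Wb T f2. \<forall>v1 \<in> follower_controls P W T f1 g xunc x v2.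
      \<forall>t\<in>{0..T}.
        sets (augmented P (generated_filtration P (Y2 W f2 v2)) t) \<subseteq>
          sets (augmented P (generated_filtration P (Y1 W f1 g (x v1 v2))) t) \<inter>
          sets (augmented P (generated_filtration P (Y1_uncontrolled W f1 xunc)) t))"

definition follower_cost ::
  "'a measure \<Rightarrow> real \<Rightarrow> (real \<Rightarrow> real) \<Rightarrow> (real \<Rightarrow> real) \<Rightarrow> (real \<Rightarrow> real) \<Rightarrow> (real \<Rightarrow> real) \<Rightarrow>
    real \<Rightarrow> real \<Rightarrow>
    ((real \<Rightarrow> 'a \<Rightarrow> real) \<Rightarrow> (real \<Rightarrow> 'a \<Rightarrow> real) \<Rightarrow> real \<Rightarrow> 'a \<Rightarrow> real) \<Rightarrow>
    (real \<Rightarrow> 'a \<Rightarrow> real) \<Rightarrow> (real \<Rightarrow> 'a \<Rightarrow> real) \<Rightarrow> real"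
  where "follower_cost P T L R l r M m x v1 v2 =
    1 / 2 * (LINT \<omega>|P.
      (LBINT t:{0..T}. L t * (x v1 v2 t \<omega>)\<^sup>2 + R t * (v1 t \<omega>)\<^sup>2
        + 2 * l t * x v1 v2 t \<omega> + 2 * r t * v1 t \<omega>)
      + M * (x v1 v2 T \<omega>)\<^sup>2 + 2 * m * x v1 v2 T \<omega>)"

end

theory Submission
  imports Defs
begin

text \<open>
  The optimal control is tested against needles: on a short interval \<open>(a, b]\<close> it is shifted by
  \<open>\<epsilon> 1\<^bsub>C\<^esub>\<close>, where the event \<open>C\<close> has been observed by time \<open>a\<close>. The dynamics being linear,
  the state is then shifted by \<open>\<epsilon> 1\<^bsub>C\<^esub> h\<close> with a deterministic function \<open>h\<close>, and the cost is a
  quadratic polynomial in \<open>\<epsilon>\<close> with minimum at \<open>0\<close>, so that its linear coefficient vanishes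
  (\<open>first_order_condition\<close>).

  A needle has to be an admissible control, and here lies the difficulty: the controls are
  adapted to an observation which itself depends on the control. Up to time \<open>a\<close> the needle changes
  nothing. Afterwards it adds \<open>\<epsilon> 1\<^bsub>C\<^esub>\<close> times a deterministic function to the observation,
  and \<open>C\<close> is already known; the old observation can thus be recovered from the new one, and
  with it the optimal control and the needle (\<open>needle_admissible\<close>). Adaptedness to the uncontrolled
  observation is obtained by recovering the controlled observation from the uncontrolled one
  (\<open>Ybar_history_subset\<close>); this is where the information assumption enters.

  Taking expectations of the adjoint equation on the event \<open>C\<close> removes both stochastic integrals
  from time \<open>a\<close> on. What remains is a deterministic backward equation for
  \<open>E[1\<^bsub>C\<^esub> p(t)]\<close>, dual to the forward equation for \<open>h\<close>. Integration by parts turns the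
  first-order condition into
  \<open>\<integral>\<^sub>a\<^sup>b E[1\<^bsub>C\<^esub> (R v\<^sub>1 + r + B\<^sub>1 p)] dt = 0\<close> (\<open>averaged_stationarity\<close>).
  No Ito formula is involved: stochastic integrals enter through their uniqueness, a bound on
  their second moments and the martingale property. The first two come from the isometry for simple
  integrands, the third from the independence of increments, and all of them pass to the limit in mean square.

  For a fixed event \<open>C\<close> the integrand vanishes for almost every \<open>t\<close>. To obtain a null set of times
  that does not depend on \<open>C\<close>, only countably many events are used, those which restrict the
  observation at finitely many rational times before \<open>t\<close> by rational bounds. The observation being continuous,
  they generate its history up to time \<open>t\<close> modulo null sets
  (\<open>history_generated_by_rational_cylinders\<close>), so that the conditional expectation vanishes.
\<close>

section \<open>Deterministic linear equations with bounded measurable coefficients\<close>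

definition bounded_measurable_on :: "real \<Rightarrow> real \<Rightarrow> (real \<Rightarrow> real) \<Rightarrow> bool"
  where "bounded_measurable_on a b f \<longleftrightarrow>
    set_borel_measurable borel {a..b} f \<and> (\<exists>K. \<forall>t\<in>{a..b}. \<bar>f t\<bar> \<le> K)"

lemma bounded_coeff_iff: "bounded_coeff T f \<longleftrightarrow> bounded_measurable_on 0 T f"
  unfolding bounded_coeff_def bounded_measurable_on_def ..

lemma bounded_measurable_onE:
  assumes "bounded_measurable_on a b f"
  obtains K where "K > 0" "\<And>t. t \<in> {a..b} \<Longrightarrow> \<bar>f t\<bar> \<le> K"
proof -
  obtain K where K: "\<forall>t\<in>{a..b}. \<bar>f t\<bar> \<le> K" using assms unfolding bounded_measurable_on_def by blast
  show ?thesis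
  proof (rule that[of "\<bar>K\<bar> + 1"])
    show "\<bar>f t\<bar> \<le> \<bar>K\<bar> + 1" if "t \<in> {a..b}" for t
      using K that abs_ge_self[of K] by fastforce
  qed simp
qed

lemma bounded_measurable_on_continuous:
  assumes "continuous_on {a..b} f"
  shows "bounded_measurable_on a b f"
proof -
  have "set_borel_measurable borel {a..b} f"
    unfolding set_borel_measurable_def
    using assms by (intro borel_measurable_continuous_on_indicator) auto
  moreover have "bounded (f ` {a..b})"
    using assms by (intro compact_imp_bounded compact_continuous_image) auto
  ultimately show ?thesis by (auto simp: bounded_measurable_on_def bounded_iff)
qed

lemma bounded_measurable_on_const: "bounded_measurable_on a b (\<lambda>_. c)"
  by (intro bounded_measurable_on_continuous) auto

lemma bounded_measurable_on_mult:
  assumes "bounded_measurable_on a b f" "bounded_measurable_on a b g"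
  shows "bounded_measurable_on a b (\<lambda>t. f t * g t)"
proof -
  obtain K where K: "K > 0" "\<And>t. t \<in> {a..b} \<Longrightarrow> \<bar>f t\<bar> \<le> K" using assms(1) by (rule bounded_measurable_onE) blast
  obtain L where L: "L > 0" "\<And>t. t \<in> {a..b} \<Longrightarrow> \<bar>g t\<bar> \<le> L" using assms(2) by (rule bounded_measurable_onE) blast
  have "(\<lambda>x. indicator {a..b} x *\<^sub>R (f x * g x)) = (\<lambda>x. (indicator {a..b} x *\<^sub>R f x) * (indicator {a..b} x *\<^sub>R g x))"
    by (auto simp: indicator_def)
  then have "set_borel_measurable borel {a..b} (\<lambda>t. f t * g t)"
    using assms unfolding bounded_measurable_on_def set_borel_measurable_def
    by (auto intro: borel_measurable_times)
  moreover have "\<forall>t\<in>{a..b}. \<bar>f t * g t\<bar> \<le> K * L"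
    using K L by (auto simp: abs_mult intro!: mult_mono)
  ultimately show ?thesis unfolding bounded_measurable_on_def by blast
qed

lemma bounded_measurable_on_add:
  assumes "bounded_measurable_on a b f" "bounded_measurable_on a b g"
  shows "bounded_measurable_on a b (\<lambda>t. f t + g t)"
proof -
  obtain K where K: "K > 0" "\<And>t. t \<in> {a..b} \<Longrightarrow> \<bar>f t\<bar> \<le> K" using assms(1) by (rule bounded_measurable_onE) blast
  obtain L where L: "L > 0" "\<And>t. t \<in> {a..b} \<Longrightarrow> \<bar>g t\<bar> \<le> L" using assms(2) by (rule bounded_measurable_onE) blast
  have "(\<lambda>x. indicator {a..b} x *\<^sub>R f x) \<in> borel_measurable borel"
    "(\<lambda>x. indicator {a..b} x *\<^sub>R g x) \<in> borel_measurable borel"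
    using assms by (simp_all add: bounded_measurable_on_def set_borel_measurable_def)
  from borel_measurable_add[OF this] have "set_borel_measurable borel {a..b} (\<lambda>t. f t + g t)"
    by (simp add: set_borel_measurable_def distrib_left)
  moreover have "\<forall>t\<in>{a..b}. \<bar>f t + g t\<bar> \<le> K + L"
    using K L by (auto intro!: order_trans[OF abs_triangle_ineq] add_mono)
  ultimately show ?thesis unfolding bounded_measurable_on_def by blast
qed

lemma bounded_measurable_on_diff:
  assumes "bounded_measurable_on a b f" "bounded_measurable_on a b g"
  shows "bounded_measurable_on a b (\<lambda>t. f t - g t)"
  using bounded_measurable_on_add[OF assms(1) bounded_measurable_on_mult[OF bounded_measurable_on_const[of _ _ "-1"] assms(2)]]
  by simp

lemma bounded_measurable_on_indicator: "B \<in> sets borel \<Longrightarrow> bounded_measurable_on a b (indicat_real B)"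
  unfolding bounded_measurable_on_def set_borel_measurable_def by (auto simp: indicator_def intro!: exI[of _ 1])

lemmas bounded_measurable_on_intros = bounded_measurable_on_const bounded_measurable_on_mult
  bounded_measurable_on_add bounded_measurable_on_diff bounded_measurable_on_indicator

lemma bounded_measurable_on_subset:
  assumes "bounded_measurable_on a b f" "{c..d} \<subseteq> {a..b}"
  shows "bounded_measurable_on c d f"
proof -
  have "(\<lambda>x. indicator {c..d} x *\<^sub>R f x) = (\<lambda>x. indicator {c..d} x * (indicator {a..b} x *\<^sub>R f x))"
    using assms(2) by (auto simp: indicator_def fun_eq_iff)
  moreover have "(\<lambda>x. indicator {a..b} x *\<^sub>R f x) \<in> borel_measurable borel"
    using assms(1) unfolding bounded_measurable_on_def set_borel_measurable_def by simp
  then have "(\<lambda>x. indicator {c..d} x * (indicator {a..b} x *\<^sub>R f x)) \<in> borel_measurable borel"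
    by (intro borel_measurable_times) auto
  ultimately have "set_borel_measurable borel {c..d} f"
    unfolding set_borel_measurable_def by simp
  then show ?thesis using assms unfolding bounded_measurable_on_def by blast
qed

lemma bounded_measurable_on_integrable:
  assumes "bounded_measurable_on a b f"
  shows "set_integrable lborel {a..b} f"
proof -
  obtain K where K: "K > 0" "\<And>t. t \<in> {a..b} \<Longrightarrow> \<bar>f t\<bar> \<le> K" using assms by (rule bounded_measurable_onE) blast
  have "set_integrable lborel {a..b} (\<lambda>_. K)"
    unfolding set_integrable_def by (intro integrable_scaleR_left integrable_real_indicator) (auto simp: emeasure_lborel_Icc_eq)
  then show ?thesis
    by (rule set_integrable_bound)
       (use assms K in \<open>auto simp: bounded_measurable_on_def set_borel_measurable_def\<close>)
qed

lemma set_integral_singleton_lborel: "(LBINT r:{a}. f r) = (0::real)" for a :: real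
proof -
  have "(LBINT r:{a}. f r) = (LBINT r:{}. f r)"
    unfolding set_lebesgue_integral_def
    by (rule integral_discrete_difference[of "{a}"]) (auto simp: indicator_def)
  then show ?thesis by (simp add: set_lebesgue_integral_def)
qed

lemma set_integral_Icc_combine:
  fixes f :: "real \<Rightarrow> real"
  assumes "set_integrable lborel {a..b} f" "a \<le> s" "s \<le> t" "t \<le> b"
  shows "(LBINT r:{a..t}. f r) = (LBINT r:{a..s}. f r) + (LBINT r:{s..t}. f r)"
proof -
  have 1: "set_integrable lborel {a..s} f" "set_integrable lborel {s<..t} f"
    by (rule set_integrable_subset[OF assms(1)]; use assms in auto)+
  have "{a..t} = {a..s} \<union> {s<..t}" using assms by auto
  then have "(LBINT r:{a..t}. f r) = (LBINT r:{a..s}. f r) + (LBINT r:{s<..t}. f r)"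
    by (simp add: set_integral_Un[OF _ 1] ivl_disj_int)
  also have "(LBINT r:{s<..t}. f r) = (LBINT r:{s..t}. f r)"
    unfolding set_lebesgue_integral_def
  proof (rule integral_discrete_difference[of "{s}"])
  qed (auto simp: indicator_def)
  finally show ?thesis .
qed

lemma set_integral_Icc_bound:
  fixes f :: "real \<Rightarrow> real"
  assumes "s \<le> t" "\<And>r. r \<in> {s..t} \<Longrightarrow> \<bar>f r\<bar> \<le> K" "0 \<le> K"
  shows "\<bar>LBINT r:{s..t}. f r\<bar> \<le> K * (t - s)"
proof (cases "set_integrable lborel {s..t} f")
  case True
  have "\<bar>LBINT r:{s..t}. f r\<bar> \<le> (LBINT r:{s..t}. \<bar>f r\<bar>)"
    using set_integral_norm_bound[OF True] by simp
  also have "\<dots> \<le> (LBINT r:{s..t}. K)"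
  proof (rule set_integral_mono)
    show "set_integrable lborel {s..t} (\<lambda>r. \<bar>f r\<bar>)" by (rule set_integrable_abs[OF True])
    show "set_integrable lborel {s..t} (\<lambda>_. K)"
      by (rule bounded_measurable_on_integrable[OF bounded_measurable_on_const])
  qed (use assms(2) in auto)
  finally have "\<bar>LBINT r:{s..t}. f r\<bar> \<le> (LBINT r:{s..t}. K)" .
  then show ?thesis using assms by (simp add: set_lebesgue_integral_def mult.commute)
next
  case False
  then have "(LBINT r:{s..t}. f r) = 0"
    by (simp add: set_lebesgue_integral_def set_integrable_def not_integrable_integral_eq)
  then show ?thesis using assms by simp
qed

lemma continuous_on_set_integral_Icc:
  fixes f :: "real \<Rightarrow> real"
  assumes "set_integrable lborel {a..b} f"
  shows "continuous_on {a..b} (\<lambda>t. LBINT r:{a..t}. f r)"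
proof -
  have "f integrable_on {a..b}" using assms by (rule set_borel_integral_eq_integral(1))
  then have "continuous_on {a..b} (\<lambda>t. integral {a..t} f)" by (rule indefinite_integral_continuous_1)
  moreover have "integral {a..t} f = (LBINT r:{a..t}. f r)" if "t \<in> {a..b}" for t
    using set_borel_integral_eq_integral(2)[of "{a..t}" f] set_integrable_subset[OF assms, of "{a..t}"] that
    by auto
  ultimately show ?thesis by (metis (no_types, lifting) continuous_on_cong)
qed

text \<open>
  The error in the increments of a function against those of an indefinite integral being
  quadratic, the difference of the two has derivative zero.
\<close>

lemma eq_indefinite_integral_if_quadratic_error:
  fixes u u' :: "real \<Rightarrow> real"
  assumes "set_integrable lborel {a..b} u'"
    and err: "\<And>s t. a \<le> s \<Longrightarrow> s \<le> t \<Longrightarrow> t \<le> b \<Longrightarrow>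
      \<bar>u t - u s - (LBINT r:{s..t}. u' r)\<bar> \<le> C * (t - s)\<^sup>2"
    and t: "t \<in> {a..b}"
  shows "u t = u a + (LBINT r:{a..t}. u' r)"
proof -
  define F where "F = (\<lambda>t. u t - (LBINT r:{a..t}. u' r))"
  have F: "\<bar>F y - F x\<bar> \<le> \<bar>C\<bar> * (y - x)\<^sup>2" if "x \<in> {a..b}" "y \<in> {a..b}" for x y
  proof -
    have le: "\<bar>F y - F x\<bar> \<le> \<bar>C\<bar> * (y - x)\<^sup>2" if "a \<le> x" "x \<le> y" "y \<le> b" for x y
    proof -
      have "F y - F x = u y - u x - (LBINT r:{x..y}. u' r)"
        unfolding F_def using set_integral_Icc_combine[OF assms(1), of x y] that by simp
      then have "\<bar>F y - F x\<bar> \<le> C * (y - x)\<^sup>2" using err[of x y] that by simp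
      also have "\<dots> \<le> \<bar>C\<bar> * (y - x)\<^sup>2" by (intro mult_right_mono) auto
      finally show ?thesis .
    qed
    show ?thesis
      using le[of x y] le[of y x] that by (cases "x \<le> y") (auto simp: abs_minus_commute power2_commute)
  qed
  have der: "(F has_field_derivative 0) (at x within {a..b})" if x: "x \<in> {a..b}" for x
  proof -
    have "((\<lambda>y. (F y - F x) / (y - x)) \<longlongrightarrow> 0) (at x within {a..b})"
    proof (rule Lim_null_comparison)
      show "\<forall>\<^sub>F y in at x within {a..b}. norm ((F y - F x) / (y - x)) \<le> \<bar>C\<bar> * \<bar>y - x\<bar>"
        unfolding eventually_at_filter
      proof (intro always_eventually allI impI)
        fix y assume "y \<noteq> x" "y \<in> {a..b}"
        then have "\<bar>F y - F x\<bar> \<le> (\<bar>C\<bar> * \<bar>y - x\<bar>) * \<bar>y - x\<bar>"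
          using F[OF x, of y] by (simp add: power2_eq_square mult.assoc)
        then show "norm ((F y - F x) / (y - x)) \<le> \<bar>C\<bar> * \<bar>y - x\<bar>"
          using \<open>y \<noteq> x\<close> by (simp add: pos_divide_le_eq)
      qed
      have "((\<lambda>y. \<bar>C\<bar> * \<bar>y - x\<bar>) \<longlongrightarrow> \<bar>C\<bar> * \<bar>x - x\<bar>) (at x within {a..b})"
        by (intro tendsto_intros)
      then show "((\<lambda>y. \<bar>C\<bar> * \<bar>y - x\<bar>) \<longlongrightarrow> 0) (at x within {a..b})" by simp
    qed
    then show ?thesis by (simp add: has_field_derivative_iff)
  qed
  obtain c where c: "\<And>x. x \<in> {a..b} \<Longrightarrow> F x = c"
    using has_field_derivative_zero_constant[of "{a..b}" F] der by auto
  have "F t = F a" using c t by auto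
  then show ?thesis by (simp add: F_def set_integral_singleton_lborel)
qed

lemma indefinite_integral_increment:
  fixes u u' :: "real \<Rightarrow> real"
  assumes u': "set_integrable lborel {a..b} u'"
    and u: "\<And>t. t \<in> {a..b} \<Longrightarrow> u t = u a + (LBINT r:{a..t}. u' r)"
    and "a \<le> s" "s \<le> t" "t \<le> b"
  shows "u t - u s = (LBINT r:{s..t}. u' r)"
  using u[of t] u[of s] set_integral_Icc_combine[OF u', of s t] assms(3-) by simp

lemma indefinite_integral_product:
  fixes u v u' v' :: "real \<Rightarrow> real"
  assumes u': "bounded_measurable_on a b u'" and v': "bounded_measurable_on a b v'"
    and u: "\<And>t. t \<in> {a..b} \<Longrightarrow> u t = u a + (LBINT r:{a..t}. u' r)"
    and v: "\<And>t. t \<in> {a..b} \<Longrightarrow> v t = v a + (LBINT r:{a..t}. v' r)"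
    and t: "t \<in> {a..b}"
  shows "u t * v t = u a * v a + (LBINT r:{a..t}. u' r * v r + u r * v' r)"
proof -
  note iu = bounded_measurable_on_integrable[OF u'] and iv = bounded_measurable_on_integrable[OF v']
  obtain K where K: "K > 0" "\<And>t. t \<in> {a..b} \<Longrightarrow> \<bar>u' t\<bar> \<le> K" using u' by (rule bounded_measurable_onE) blast
  obtain L where L: "L > 0" "\<And>t. t \<in> {a..b} \<Longrightarrow> \<bar>v' t\<bar> \<le> L" using v' by (rule bounded_measurable_onE) blast
  have cont: "continuous_on {a..b} f"
    if "set_integrable lborel {a..b} f'" "\<And>t. t \<in> {a..b} \<Longrightarrow> f t = f a + (LBINT r:{a..t}. f' r)"
    for f f' :: "real \<Rightarrow> real"
  proof -
    have "continuous_on {a..b} (\<lambda>t. f a + (LBINT r:{a..t}. f' r))"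
      by (intro continuous_intros continuous_on_set_integral_Icc that(1))
    then show ?thesis using that(2) by (subst continuous_on_cong[OF refl]) assumption
  qed
  have bu: "bounded_measurable_on a b u" and bv: "bounded_measurable_on a b v"
    using cont[OF iu u] cont[OF iv v] by (auto intro: bounded_measurable_on_continuous)
  have b1: "bounded_measurable_on a b (\<lambda>r. u' r * v r + u r * v' r)"
    by (intro bounded_measurable_on_intros u' v' bu bv)
  show ?thesis
  proof (rule eq_indefinite_integral_if_quadratic_error[where u="\<lambda>t. u t * v t" and C="3 * K * L" and b=b])
    show "set_integrable lborel {a..b} (\<lambda>r. u' r * v r + u r * v' r)"
      by (rule bounded_measurable_on_integrable[OF b1])
    fix s t assume st: "a \<le> s" "s \<le> t" "t \<le> b"
    have sub: "{s..t} \<subseteq> {a..b}" using st by auto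
    note b = bounded_measurable_on_subset[OF _ sub]
    have du: "u r - u s = (LBINT r:{s..r}. u' r)" if "r \<in> {s..t}" for r
      using indefinite_integral_increment[OF iu u, of s r] that st by auto
    have dv: "v r - v s = (LBINT r:{s..r}. v' r)" if "r \<in> {s..t}" for r
      using indefinite_integral_increment[OF iv v, of s r] that st by auto
    have ub: "\<bar>u r - u s\<bar> \<le> K * (t - s)" if "r \<in> {s..t}" for r
    proof -
      have "\<bar>u r - u s\<bar> \<le> K * (r - s)"
        unfolding du[OF that] using that st K by (intro set_integral_Icc_bound) auto
      also have "\<dots> \<le> K * (t - s)" using that K by (intro mult_left_mono) auto
      finally show ?thesis .
    qed
    have vb: "\<bar>v r - v s\<bar> \<le> L * (t - s)" if "r \<in> {s..t}" for r
    proof -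
      have "\<bar>v r - v s\<bar> \<le> L * (r - s)"
        unfolding dv[OF that] using that st L by (intro set_integral_Icc_bound) auto
      also have "\<dots> \<le> L * (t - s)" using that L by (intro mult_left_mono) auto
      finally show ?thesis .
    qed
    have I: "set_integrable lborel {s..t} u'" "set_integrable lborel {s..t} v'"
      "set_integrable lborel {s..t} (\<lambda>r. u' r * (v r - v s) + (u r - u s) * v' r)"
      by (intro bounded_measurable_on_integrable bounded_measurable_on_add bounded_measurable_on_mult
          bounded_measurable_on_diff bounded_measurable_on_const b u' v' bu bv)+
    have "(LBINT r:{s..t}. u' r * v r + u r * v' r)
      = (LBINT r:{s..t}. u' r * v s + u s * v' r + (u' r * (v r - v s) + (u r - u s) * v' r))"
      by (simp add: algebra_simps)
    also have "\<dots> = (LBINT r:{s..t}. u' r) * v s + u s * (LBINT r:{s..t}. v' r)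
        + (LBINT r:{s..t}. u' r * (v r - v s) + (u r - u s) * v' r)"
      using I by (simp add: set_integral_add)
    finally have eq: "u t * v t - u s * v s - (LBINT r:{s..t}. u' r * v r + u r * v' r)
      = (u t - u s) * (v t - v s) - (LBINT r:{s..t}. u' r * (v r - v s) + (u r - u s) * v' r)"
      using du[of t] dv[of t] st by (simp add: algebra_simps)
    have 1: "\<bar>LBINT r:{s..t}. u' r * (v r - v s) + (u r - u s) * v' r\<bar> \<le> (2 * K * L * (t - s)) * (t - s)"
    proof (rule set_integral_Icc_bound)
      fix r assume r: "r \<in> {s..t}"
      have "\<bar>u' r * (v r - v s)\<bar> \<le> K * (L * (t - s))"
        unfolding abs_mult using K L vb[OF r] r sub by (intro mult_mono) auto
      moreover have "\<bar>(u r - u s) * v' r\<bar> \<le> (K * (t - s)) * L"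
        unfolding abs_mult using K L ub[OF r] r sub st by (intro mult_mono) auto
      ultimately show "\<bar>u' r * (v r - v s) + (u r - u s) * v' r\<bar> \<le> 2 * K * L * (t - s)"
        by (simp add: algebra_simps)
    qed (use st K L in auto)
    have "\<bar>(u t - u s) * (v t - v s)\<bar> \<le> (K * (t - s)) * (L * (t - s))"
      unfolding abs_mult using ub[of t] vb[of t] st K by (intro mult_mono) auto
    then show "\<bar>u t * v t - u s * v s - (LBINT r:{s..t}. u' r * v r + u r * v' r)\<bar> \<le> 3 * K * L * (t - s)\<^sup>2"
      unfolding eq using 1 by (simp add: algebra_simps power2_eq_square)
  qed (use t in auto)
qed


text \<open>
  The Taylor remainder of the exponential is quadratic in the increment of the exponent, which is
  Lipschitz because \<open>A\<close> is bounded. This is the chain rule at the regularity at hand, the exponent being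
  differentiable almost everywhere only.
\<close>

lemma indefinite_integral_exp:
  fixes A :: "real \<Rightarrow> real" and a :: real
  defines "E \<equiv> \<lambda>t. LBINT r:{a..t}. A r"
  assumes A: "bounded_measurable_on a b A" and t: "t \<in> {a..b}"
  shows "exp (c * E t) = 1 + (LBINT r:{a..t}. c * A r * exp (c * E r))"
proof -
  note iA = bounded_measurable_on_integrable[OF A]
  obtain K where K: "K > 0" "\<And>t. t \<in> {a..b} \<Longrightarrow> \<bar>c * A t\<bar> \<le> K"
    using bounded_measurable_on_mult[OF bounded_measurable_on_const A] by (rule bounded_measurable_onE) blast
  have bE: "continuous_on {a..b} E" unfolding E_def by (rule continuous_on_set_integral_Icc[OF iA])
  have bX: "bounded_measurable_on a b (\<lambda>t. exp (c * E t))"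
    by (intro bounded_measurable_on_continuous continuous_intros bE)
  obtain B where B: "B > 0" "\<And>t. t \<in> {a..b} \<Longrightarrow> \<bar>exp (c * E t)\<bar> \<le> B" using bX by (rule bounded_measurable_onE) blast
  have Ea: "E a = 0" by (simp add: E_def set_integral_singleton_lborel)
  have lip: "\<bar>c * E r - c * E s\<bar> \<le> K * (t - s)" if "a \<le> s" "r \<in> {s..t}" "t \<le> b" for r s t
  proof -
    have "c * E r - c * E s = (LBINT q:{s..r}. c * A q)"
      using set_integral_Icc_combine[OF iA, of s r] that unfolding E_def by (simp add: algebra_simps)
    also have "\<bar>\<dots>\<bar> \<le> K * (r - s)" using that K by (intro set_integral_Icc_bound) auto
    also have "\<dots> \<le> K * (t - s)" using that K by (intro mult_left_mono) auto
    finally show ?thesis .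
  qed
  have ediff: "\<bar>exp x - exp y\<bar> \<le> B * \<bar>x - y\<bar>" if "exp x \<le> B" "exp y \<le> B" for x y :: real
  proof -
    have *: "exp x - exp y \<le> exp x * (x - y)" for x y :: real
    proof -
      have "1 + (y - x) \<le> exp (y - x)" by (rule exp_ge_add_one_self)
      then have "exp x * (1 + (y - x)) \<le> exp x * exp (y - x)" by (intro mult_left_mono) auto
      also have "\<dots> = exp y" by (simp flip: exp_add)
      finally show ?thesis by (simp add: algebra_simps)
    qed
    have 1: "exp x * d \<le> B * \<bar>d\<bar>" if "exp x \<le> B" for x d
      using mult_left_mono[OF abs_ge_self[of d] exp_ge_zero[of x]] mult_right_mono[OF that abs_ge_zero[of d]]
      by linarith
    show ?thesis
      using *[of x y] *[of y x] 1[OF that(1), of "x - y"] 1[OF that(2), of "y - x"]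
      by (simp add: abs_minus_commute)
  qed
  have "exp (c * E t) = exp (c * E a) + (LBINT r:{a..t}. c * A r * exp (c * E r))"
  proof (rule eq_indefinite_integral_if_quadratic_error[where C="2 * (B * K * K)" and b=b and u="\<lambda>t. exp (c * E t)"])
    show "set_integrable lborel {a..b} (\<lambda>r. c * A r * exp (c * E r))"
      by (intro bounded_measurable_on_integrable bounded_measurable_on_mult bounded_measurable_on_const A bX)
    fix s t assume st: "a \<le> s" "s \<le> t" "t \<le> b"
    have sub: "{s..t} \<subseteq> {a..b}" using st by auto
    note b = bounded_measurable_on_subset[OF _ sub]
    let ?d = "c * E t - c * E s"
    have d: "?d = (LBINT q:{s..t}. c * A q)"
      using set_integral_Icc_combine[OF iA, of s t] st unfolding E_def by (simp add: algebra_simps)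
    have I: "set_integrable lborel {s..t} (\<lambda>r. c * A r * exp (c * E s))"
      "set_integrable lborel {s..t} (\<lambda>r. c * A r * (exp (c * E r) - exp (c * E s)))"
      by (intro bounded_measurable_on_integrable bounded_measurable_on_mult bounded_measurable_on_diff
          bounded_measurable_on_const b A bX)+
    have "(LBINT r:{s..t}. c * A r * exp (c * E r))
      = (LBINT r:{s..t}. c * A r * exp (c * E s) + c * A r * (exp (c * E r) - exp (c * E s)))"
      by (simp add: algebra_simps)
    also have "\<dots> = ?d * exp (c * E s) + (LBINT r:{s..t}. c * A r * (exp (c * E r) - exp (c * E s)))"
      unfolding d by (subst set_integral_add(2)[OF I]) simp
    finally have eq: "exp (c * E t) - exp (c * E s) - (LBINT r:{s..t}. c * A r * exp (c * E r))
      = (exp (c * E t) - exp (c * E s) - exp (c * E s) * ?d)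
        - (LBINT r:{s..t}. c * A r * (exp (c * E r) - exp (c * E s)))" by simp
    have 1: "\<bar>LBINT r:{s..t}. c * A r * (exp (c * E r) - exp (c * E s))\<bar> \<le> (K * (B * (K * (t - s)))) * (t - s)"
    proof (rule set_integral_Icc_bound)
      fix r assume r: "r \<in> {s..t}"
      have "\<bar>exp (c * E r) - exp (c * E s)\<bar> \<le> B * \<bar>c * E r - c * E s\<bar>"
        using B(2)[of r] B(2)[of s] r st by (intro ediff) auto
      also have "\<dots> \<le> B * (K * (t - s))" using B lip[OF st(1) r st(3)] by (intro mult_left_mono) auto
      finally show "\<bar>c * A r * (exp (c * E r) - exp (c * E s))\<bar> \<le> K * (B * (K * (t - s)))"
        unfolding abs_mult[of "c * A r"] using K sub r by (intro mult_mono) auto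
    qed (use st K B in auto)
    have 2: "\<bar>exp (c * E t) - exp (c * E s) - exp (c * E s) * ?d\<bar> \<le> B * (K * (t - s))\<^sup>2"
    proof -
      have "1 + ?d \<le> exp ?d" by (rule exp_ge_add_one_self)
      then have "exp (c * E s) * (1 + ?d) \<le> exp (c * E s) * exp ?d" by (intro mult_left_mono) auto
      then have lo: "0 \<le> exp (c * E t) - exp (c * E s) - exp (c * E s) * ?d"
        by (simp add: algebra_simps flip: exp_add)
      have "1 + (-?d) \<le> exp (-?d)" by (rule exp_ge_add_one_self)
      then have "exp (c * E t) * (1 + (-?d)) \<le> exp (c * E t) * exp (-?d)" by (intro mult_left_mono) auto
      then have "exp (c * E t) - exp (c * E s) \<le> exp (c * E t) * ?d"
        by (simp add: algebra_simps flip: exp_add)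
      then have "exp (c * E t) - exp (c * E s) - exp (c * E s) * ?d \<le> (exp (c * E t) - exp (c * E s)) * ?d"
        by (simp add: algebra_simps)
      also have "\<dots> \<le> \<bar>exp (c * E t) - exp (c * E s)\<bar> * \<bar>?d\<bar>" by (simp flip: abs_mult)
      also have "\<dots> \<le> (B * \<bar>?d\<bar>) * \<bar>?d\<bar>"
        using B(2)[of t] B(2)[of s] st by (intro mult_right_mono ediff) auto
      also have "\<dots> = B * (\<bar>?d\<bar> * \<bar>?d\<bar>)" by simp
      also have "\<dots> \<le> B * ((K * (t - s)) * (K * (t - s)))"
        using B lip[of s t t] st K by (intro mult_left_mono mult_mono) auto
      finally show ?thesis using lo by (simp add: power2_eq_square)
    qed
    show "\<bar>exp (c * E t) - exp (c * E s) - (LBINT r:{s..t}. c * A r * exp (c * E r))\<bar> \<le> 2 * (B * K * K) * (t - s)\<^sup>2"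
      unfolding eq using 1 2 by (simp add: algebra_simps power2_eq_square)
  qed (use t in auto)
  then show ?thesis by (simp add: Ea)
qed

text \<open>
  With \<open>\<Phi>(t) = exp (\<integral>\<^sub>0\<^sup>t A)\<close> this is \<open>\<Phi>(t) \<Phi>(s)\<^sup>-\<^sup>1 A(s)\<close>,
  the resolvent kernel of the Volterra equation \<open>z = q + \<integral> A z\<close>.
\<close>

definition resolvent :: "(real \<Rightarrow> real) \<Rightarrow> real \<Rightarrow> real \<Rightarrow> real"
  where "resolvent A t s = exp (LBINT r:{0..t}. A r) * exp (- (LBINT r:{0..s}. A r)) * A s"

text \<open>
  Variation of constants for \<open>w = z - q\<close>, which solves \<open>w' = A w + A q\<close>. The source \<open>q\<close> need not
  have a derivative, so that the formula also covers sources that contain a stochastic integral.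
\<close>

lemma volterra_solution:
  assumes A: "bounded_measurable_on 0 T A" and z: "bounded_measurable_on 0 T z" and q: "bounded_measurable_on 0 T q"
    and eq: "\<And>t. t \<in> {0..T} \<Longrightarrow> z t = q t + (LBINT s:{0..t}. A s * z s)" and t: "t \<in> {0..T}"
  shows "z t = q t + (LBINT s:{0..t}. resolvent A t s * q s)"
proof -
  define E where "E = (\<lambda>t. LBINT r:{0..t}. A r)"
  have bE: "continuous_on {0..T} E"
    unfolding E_def by (rule continuous_on_set_integral_Icc[OF bounded_measurable_on_integrable[OF A]])
  have bX: "bounded_measurable_on 0 T (\<lambda>t. exp (- E t))"
    by (intro bounded_measurable_on_continuous continuous_intros bE)
  have ex: "exp (- E t) = exp (- E 0) + (LBINT r:{0..t}. - A r * exp (- E r))" if "t \<in> {0..T}" for t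
    using indefinite_integral_exp[OF A that, of "-1"] by (simp add: E_def set_integral_singleton_lborel)
  define w where "w = (\<lambda>t. z t - q t)"
  have w: "w t = w 0 + (LBINT s:{0..t}. A s * z s)" if "t \<in> {0..T}" for t
    using eq[OF that] eq[of 0] that by (simp add: w_def set_integral_singleton_lborel)
  have w0: "w 0 = 0" using eq[of 0] t by (simp add: w_def set_integral_singleton_lborel)
  have "w t * exp (- E t) = w 0 * exp (- E 0) + (LBINT r:{0..t}. A r * z r * exp (- E r) + w r * (- A r * exp (- E r)))"
  proof (rule indefinite_integral_product[where b=T])
    show "bounded_measurable_on 0 T (\<lambda>r. - A r * exp (- E r))"
      using bounded_measurable_on_mult[OF bounded_measurable_on_mult[OF bounded_measurable_on_const[of _ _ "-1"] A] bX]
      by simp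
  qed (fact w ex t bounded_measurable_on_mult[OF A z])+
  also have "\<dots> = (LBINT r:{0..t}. exp (- E r) * A r * q r)"
    unfolding w0 by (simp add: w_def algebra_simps)
  finally have "exp (E t) * (w t * exp (- E t)) = exp (E t) * (LBINT r:{0..t}. exp (- E r) * A r * q r)" by simp
  also have "exp (E t) * (w t * exp (- E t)) = w t" by (simp add: exp_minus)
  finally show ?thesis by (simp add: w_def resolvent_def E_def mult.assoc flip: set_integral_mult_right)
qed

lemma volterra_solution_exists:
  assumes A: "bounded_measurable_on 0 T A" and q: "bounded_measurable_on 0 T q"
  defines "z \<equiv> \<lambda>t. q t + (LBINT s:{0..t}. resolvent A t s * q s)"
  shows "bounded_measurable_on 0 T z" "\<And>t. t \<in> {0..T} \<Longrightarrow> z t = q t + (LBINT s:{0..t}. A s * z s)"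
proof -
  define E where "E = (\<lambda>t. LBINT r:{0..t}. A r)"
  define G where "G = (\<lambda>t. LBINT s:{0..t}. exp (- E s) * A s * q s)"
  have bE: "continuous_on {0..T} E"
    unfolding E_def by (rule continuous_on_set_integral_Icc[OF bounded_measurable_on_integrable[OF A]])
  have bX: "bounded_measurable_on 0 T (\<lambda>t. exp (- E t))" "bounded_measurable_on 0 T (\<lambda>t. exp (E t))"
    by (intro bounded_measurable_on_continuous continuous_intros bE)+
  have bg: "bounded_measurable_on 0 T (\<lambda>s. exp (- E s) * A s * q s)"
    by (intro bounded_measurable_on_mult bX A q)
  have bG: "bounded_measurable_on 0 T G"
    unfolding G_def
    by (intro bounded_measurable_on_continuous continuous_on_set_integral_Icc bounded_measurable_on_integrable bg)
  have z: "z t = q t + exp (E t) * G t" for t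
    by (simp add: z_def G_def resolvent_def E_def mult.assoc flip: set_integral_mult_right)
  show bz: "bounded_measurable_on 0 T z"
    unfolding z[abs_def] by (intro bounded_measurable_on_add bounded_measurable_on_mult q bX bG)
  fix t assume t: "t \<in> {0..T}"
  have "exp (E t) * G t = exp (E 0) * G 0
      + (LBINT r:{0..t}. A r * exp (E r) * G r + exp (E r) * (exp (- E r) * A r * q r))"
  proof (rule indefinite_integral_product[where b=T])
    show "exp (E t) = exp (E 0) + (LBINT r:{0..t}. A r * exp (E r))" if "t \<in> {0..T}" for t
      using indefinite_integral_exp[OF A that, of "1"] by (simp add: E_def set_integral_singleton_lborel)
  qed (use t in \<open>auto simp: G_def set_integral_singleton_lborel intro!: bounded_measurable_on_mult A bX bg\<close>)
  also have "\<dots> = (LBINT r:{0..t}. A r * z r)"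
    by (simp add: z G_def set_integral_singleton_lborel algebra_simps exp_minus)
  finally show "z t = q t + (LBINT s:{0..t}. A s * z s)" by (simp add: z)
qed

text \<open>
  Integration by parts for \<open>\<phi> h\<close>: in its derivative the two terms containing \<open>A\<close> cancel.
\<close>

lemma linear_ode_duality:
  assumes A: "bounded_measurable_on a b A" and \<beta>: "bounded_measurable_on a b \<beta>" and \<gamma>: "bounded_measurable_on a b \<gamma>"
    and \<phi>: "bounded_measurable_on a b \<phi>" and h: "bounded_measurable_on a b h"
    and eq\<phi>: "\<And>t. t \<in> {a..b} \<Longrightarrow> \<phi> t = \<phi> b + (LBINT s:{t..b}. A s * \<phi> s + \<beta> s)"
    and eqh: "\<And>t. t \<in> {a..b} \<Longrightarrow> h t = (LBINT s:{a..t}. A s * h s + \<gamma> s)"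
    and "a \<le> b"
  shows "\<phi> b * h b = (LBINT s:{a..b}. \<phi> s * \<gamma> s - \<beta> s * h s)"
proof -
  have b: "bounded_measurable_on a b (\<lambda>s. A s * \<phi> s + \<beta> s)" "bounded_measurable_on a b (\<lambda>s. A s * h s + \<gamma> s)"
    by (intro bounded_measurable_on_add bounded_measurable_on_mult A \<phi> h \<beta> \<gamma>)+
  have h0: "h a = 0" using eqh[of a] \<open>a \<le> b\<close> set_integral_singleton_lborel[of a "\<lambda>s. A s * h s + \<gamma> s"] by simp
  have "\<phi> b * h b = \<phi> a * h a + (LBINT s:{a..b}. (-1 * (A s * \<phi> s + \<beta> s)) * h s + \<phi> s * (A s * h s + \<gamma> s))"
  proof (rule indefinite_integral_product[where b=b])
    fix t assume t: "t \<in> {a..b}"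
    have "(LBINT s:{a..b}. A s * \<phi> s + \<beta> s) = (LBINT s:{a..t}. A s * \<phi> s + \<beta> s) + (LBINT s:{t..b}. A s * \<phi> s + \<beta> s)"
      using t by (intro set_integral_Icc_combine[OF bounded_measurable_on_integrable[OF b(1)]]) auto
    then show "\<phi> t = \<phi> a + (LBINT s:{a..t}. -1 * (A s * \<phi> s + \<beta> s))"
      unfolding set_integral_mult_right using eq\<phi>[OF t] eq\<phi>[of a] t by simp
  next
    show "h t = h a + (LBINT s:{a..t}. A s * h s + \<gamma> s)" if "t \<in> {a..b}" for t
      using eqh[OF that] h0 by simp
  next
    show "b \<in> {a..b}" using \<open>a \<le> b\<close> by simp
  qed (fact bounded_measurable_on_mult[OF bounded_measurable_on_const b(1)] b(2))+
  then show ?thesis by (simp add: h0 algebra_simps)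
qed

section \<open>Histories and null sets\<close>

lemma measurable_mono_subalgebra:
  assumes "subalgebra H G" "f \<in> measurable G N" shows "f \<in> measurable H N"
  using measurable_from_subalg[OF assms] .

lemma space_generated_filtration [simp]: "space (generated_filtration M X t) = space M"
  unfolding generated_filtration_def by (rule space_measure_of) auto

lemma sets_generated_filtration:
  "sets (generated_filtration M X t) =
    sigma_sets (space M) {X r -` B \<inter> space M |r B. r \<in> {0..t} \<and> B \<in> sets borel}"
  unfolding generated_filtration_def by (rule sets_measure_of) auto

lemma measurable_generated_filtration:
  assumes "r \<in> {0..t}" shows "X r \<in> borel_measurable (generated_filtration M X t)"
  by (rule measurableI) (use assms in \<open>auto simp: sets_generated_filtration\<close>)

lemma generated_filtration_least:
  assumes "\<And>r. r \<in> {0..t} \<Longrightarrow> X r \<in> borel_measurable G" "space G = space M"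
  shows "subalgebra G (generated_filtration M X t)"
proof -
  have "sigma_sets (space M) {X r -` B \<inter> space M |r B. r \<in> {0..t} \<and> B \<in> sets borel} \<subseteq> sets G"
    unfolding assms(2)[symmetric]
    by (rule sets.sigma_sets_subset) (use assms in \<open>auto simp flip: assms(2) intro!: measurable_sets\<close>)
  then show ?thesis using assms(2) by (simp add: subalgebra_def sets_generated_filtration)
qed

lemma generated_filtration_mono:
  "s \<le> t \<Longrightarrow> subalgebra (generated_filtration M X t) (generated_filtration M X s)"
  by (rule generated_filtration_least) (auto intro: measurable_generated_filtration)

lemma space_augmented [simp]: "space (augmented M F t) = space M"
  unfolding augmented_def by (simp add: space_measure_of_conv)

lemma augmented_least:
  assumes "subalgebra G (F t)" "null_sets M \<subseteq> sets G" "space (F t) = space M"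
  shows "subalgebra G (augmented M F t)"
proof -
  have sp: "space G = space M" using assms by (simp add: subalgebra_def)
  have sub: "sets (F t) \<union> null_sets M \<subseteq> Pow (space M)"
    using assms(3) sets.sets_into_space[of _ "F t"] sets.sets_into_space[of _ M] by (auto simp: null_sets_def)
  have "sigma_sets (space M) (sets (F t) \<union> null_sets M) \<subseteq> sets G"
    unfolding sp[symmetric] using assms by (intro sets.sigma_sets_subset) (auto simp: subalgebra_def)
  then show ?thesis unfolding subalgebra_def augmented_def using sp sub by (simp add: space_measure_of_conv)
qed

lemma augmented_sets:
  assumes "space (F t) = space M"
  shows "sets (augmented M F t) = sigma_sets (space M) (sets (F t) \<union> null_sets M)"
proof -
  have sub: "sets (F t) \<union> null_sets M \<subseteq> Pow (space M)"
    using assms sets.sets_into_space[of _ "F t"] sets.sets_into_space[of _ M] by (auto simp: null_sets_def)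
  then show ?thesis by (simp add: augmented_def)
qed

lemma augmented_contains:
  assumes "space (F t) = space M"
  shows "subalgebra (augmented M F t) (F t)" "null_sets M \<subseteq> sets (augmented M F t)"
  using assms by (auto simp: subalgebra_def augmented_sets)

text \<open>
  The sets which agree with a set of \<open>F t\<close> up to a null set form a sigma-algebra.
\<close>

lemma augmented_sets_AE:
  assumes "space (F t) = space M" "C \<in> sets (augmented M F t)"
  shows "\<exists>C'\<in>sets (F t). AE \<omega> in M. \<omega> \<in> C \<longleftrightarrow> \<omega> \<in> C'"
  using assms(2) unfolding augmented_sets[of F t M, OF assms(1)]
proof (induction rule: sigma_sets.induct)
  case (Basic a)
  then show ?case
  proof
    assume "a \<in> null_sets M"
    then show ?thesis by (intro bexI[of _ "{}"]) (auto dest: AE_not_in)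
  qed auto
next
  case (Compl a)
  then obtain C' where C': "C' \<in> sets (F t)" "AE \<omega> in M. \<omega> \<in> a \<longleftrightarrow> \<omega> \<in> C'" by blast
  have "AE \<omega> in M. \<omega> \<in> space M - a \<longleftrightarrow> \<omega> \<in> space (F t) - C'"
    using C'(2) by eventually_elim (auto simp: assms)
  then show ?case using C'(1) by blast
next
  case (Union a)
  then obtain C' where C': "\<And>i::nat. C' i \<in> sets (F t)" "\<And>i. AE \<omega> in M. \<omega> \<in> a i \<longleftrightarrow> \<omega> \<in> C' i" by metis
  have "AE \<omega> in M. \<forall>i. \<omega> \<in> a i \<longleftrightarrow> \<omega> \<in> C' i" using C'(2) by (simp add: AE_all_countable)
  then have "AE \<omega> in M. \<omega> \<in> (\<Union>i. a i) \<longleftrightarrow> \<omega> \<in> (\<Union>i. C' i)" by eventually_elim auto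
  then show ?case using C'(1) by blast
qed auto

lemma measurable_AE_eq_complete:
  fixes f g :: "'a \<Rightarrow> real"
  assumes "complete_measure M" "subalgebra M G" "null_sets M \<subseteq> sets G"
    and f: "f \<in> borel_measurable G" and "AE \<omega> in M. f \<omega> = g \<omega>"
  shows "g \<in> borel_measurable G"
proof -
  interpret complete_measure M by fact
  from assms(5) obtain N where N: "{\<omega>\<in>space M. f \<omega> \<noteq> g \<omega>} \<subseteq> N" "N \<in> null_sets M"
    by (auto elim!: AE_E simp: null_sets_def)
  have sp: "space G = space M" using assms(2) by (simp add: subalgebra_def)
  show ?thesis
  proof (rule measurableI)
    fix B :: "real set" assume B: "B \<in> sets borel"
    have 1: "g -` B \<inter> N \<inter> space M \<in> sets G" using complete2[of _ N] N assms(3) by (meson inf_le1 inf_le2 le_infI1 subset_eq)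
    have 2: "(f -` B \<inter> space G) - N \<in> sets G" using f B N assms(3) by (intro sets.Diff measurable_sets) auto
    have "g -` B \<inter> space G = ((f -` B \<inter> space G) - N) \<union> (g -` B \<inter> N \<inter> space M)"
      using N(1) unfolding sp by auto
    with sets.Un[OF 2 1] show "g -` B \<inter> space G \<in> sets G" by simp
  qed simp
qed

section \<open>Integrable processes\<close>

abbreviation timeline :: "real \<Rightarrow> real measure"
  where "timeline T \<equiv> restrict_space lborel {0..T}"

text \<open>
  Integrability over the product of time and sample space, which is what Fubini's theorem asks for.
\<close>

definition integrable_process :: "'a measure \<Rightarrow> real \<Rightarrow> (real \<Rightarrow> 'a \<Rightarrow> real) \<Rightarrow> bool"
  where "integrable_process M T X \<longleftrightarrow> integrable (timeline T \<Otimes>\<^sub>M M) (\<lambda>(t, \<omega>). X t \<omega>)"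

lemma finite_measure_timeline: "finite_measure (timeline T)"
  by (rule finite_measureI) (simp add: emeasure_restrict_space emeasure_lborel_Icc_eq space_restrict_space)

lemma space_timeline [simp]: "space (timeline T) = {0..T}"
  by (simp add: space_restrict_space)

lemma sets_timeline_cong: "sets (timeline T \<Otimes>\<^sub>M M) = sets (restrict_space borel {0..T} \<Otimes>\<^sub>M M)"
  by (intro sets_pair_measure_cong refl) (simp add: sets_restrict_space)

lemma measurable_process_iff:
  "measurable_process M T X \<longleftrightarrow> (\<lambda>(t, \<omega>). X t \<omega>) \<in> borel_measurable (timeline T \<Otimes>\<^sub>M M)"
  unfolding measurable_process_def measurable_cong_sets[OF sets_timeline_cong refl] ..

lemma measurable_process_time:
  assumes "set_borel_measurable borel {0..T} f"
  shows "measurable_process M T (\<lambda>t \<omega>. f t)"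
proof -
  have "f \<in> borel_measurable (timeline T)"
    using assms by (simp add: borel_measurable_restrict_space_iff set_borel_measurable_def)
  then show ?thesis unfolding measurable_process_iff by simp
qed

lemma measurable_process_omega:
  assumes "Z \<in> borel_measurable M" shows "measurable_process M T (\<lambda>t. Z)"
  using assms unfolding measurable_process_iff by simp

lemma measurable_process_add:
  "measurable_process M T X \<Longrightarrow> measurable_process M T Y \<Longrightarrow> measurable_process M T (\<lambda>t \<omega>. X t \<omega> + Y t \<omega>)"
  unfolding measurable_process_iff by (simp add: split_beta')

lemma measurable_process_diff:
  "measurable_process M T X \<Longrightarrow> measurable_process M T Y \<Longrightarrow> measurable_process M T (\<lambda>t \<omega>. X t \<omega> - Y t \<omega>)"
  unfolding measurable_process_iff by (simp add: split_beta')

lemma measurable_process_mult: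
  "measurable_process M T X \<Longrightarrow> measurable_process M T Y \<Longrightarrow> measurable_process M T (\<lambda>t \<omega>. X t \<omega> * Y t \<omega>)"
  unfolding measurable_process_iff by (simp add: split_beta')

lemma measurable_process_power2:
  "measurable_process M T X \<Longrightarrow> measurable_process M T (\<lambda>t \<omega>. (X t \<omega>)\<^sup>2)"
  unfolding measurable_process_iff by (simp add: split_beta')

lemma measurable_process_at:
  assumes "measurable_process M T X" "t \<in> {0..T}" shows "X t \<in> borel_measurable M"
proof -
  have "(\<lambda>\<omega>. (t, \<omega>)) \<in> measurable M (timeline T \<Otimes>\<^sub>M M)"
    using assms(2) by (intro measurable_Pair) (auto)
  from measurable_compose[OF this assms(1)[unfolded measurable_process_iff]] show ?thesis by simp
qed

lemma set_integral_timeline: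
  fixes f :: "real \<Rightarrow> real"
  shows "(LBINT s:{0..T}. f s) = integral\<^sup>L (timeline T) f"
    "set_integrable lborel {0..T} f \<longleftrightarrow> integrable (timeline T) f"
  by (simp_all add: integral_restrict_space integrable_restrict_space set_lebesgue_integral_def set_integrable_def)

lemma set_integral_timeline_partial:
  fixes f :: "real \<Rightarrow> real"
  assumes "t \<le> T"
  shows "(LBINT s:{0..t}. f s) = (LINT s|timeline T. indicator {0..t} s * f s)"
proof -
  have "(LINT s|timeline T. indicator {0..t} s * f s) = (LBINT s:{0..T}. indicator {0..t} s * f s)"
    by (simp add: set_integral_timeline)
  also have "\<dots> = (LBINT s:{0..t}. f s)"
    unfolding set_lebesgue_integral_def using assms by (intro Bochner_Integration.integral_cong) (auto simp: indicator_def)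
  finally show ?thesis ..
qed

text \<open>
  The sets where \<open>Z\<close> is positive and where it is negative both belong to the sub-sigma-algebra.
\<close>

lemma AE_zero_if_set_integrals_zero:
  fixes Z :: "'a \<Rightarrow> real"
  assumes G: "subalgebra M G" and Z: "Z \<in> borel_measurable G" "integrable M Z"
    and zero: "\<And>C. C \<in> sets G \<Longrightarrow> (LINT \<omega>|M. indicator C \<omega> * Z \<omega>) = 0"
  shows "AE \<omega> in M. Z \<omega> = 0"
proof -
  have *: "AE \<omega> in M. Z \<omega> \<le> 0" if Z: "Z \<in> borel_measurable G" "integrable M Z"
    and zero: "\<And>C. C \<in> sets G \<Longrightarrow> (LINT \<omega>|M. indicator C \<omega> * Z \<omega>) = 0" for Z :: "'a \<Rightarrow> real"
  proof -
    define C where "C = {\<omega> \<in> space G. 0 < Z \<omega>}"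
    have C: "C \<in> sets G" unfolding C_def using Z(1) by measurable
    have CM: "C \<in> sets M" using C G by (auto simp: subalgebra_def)
    have i: "integrable M (\<lambda>\<omega>. indicator C \<omega> * Z \<omega>)" using integrable_mult_indicator[OF CM Z(2)] by simp
    have "AE \<omega> in M. indicator C \<omega> * Z \<omega> = 0"
      using zero[OF C] integral_nonneg_eq_0_iff_AE[OF i] by (auto simp: C_def indicator_def)
    moreover have "AE \<omega> in M. \<omega> \<in> space M" by simp
    ultimately show ?thesis
      by eventually_elim (use G in \<open>auto simp: C_def indicator_def subalgebra_def split: if_splits\<close>)
  qed
  have "AE \<omega> in M. - Z \<omega> \<le> 0" by (rule *) (use Z zero in auto)
  moreover have "AE \<omega> in M. Z \<omega> \<le> 0" by (rule *) (use Z zero in auto)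
  ultimately show ?thesis by eventually_elim auto
qed

lemma set_integral_zero_on_sigma_sets:
  fixes f :: "'b \<Rightarrow> real"
  assumes f: "integrable N f" and E: "E \<subseteq> sets N" "Int_stable E"
    and zero: "\<And>C. C \<in> E \<Longrightarrow> (LINT x|N. indicator C x * f x) = 0" "(LINT x|N. f x) = 0"
    and C: "C \<in> sigma_sets (space N) E"
  shows "(LINT x|N. indicator C x * f x) = 0"
proof -
  have sub: "sigma_sets (space N) E \<subseteq> sets N" using E(1) by (rule sets.sigma_sets_subset)
  have "E \<subseteq> Pow (space N)" using E(1) sets.sets_into_space by auto
  from E(2) this C show ?thesis
  proof (induction rule: sigma_sets_induct_disjoint)
    case (compl A)
    then have A: "A \<in> sets N" using sub by auto
    have "(LINT x|N. indicator (space N - A) x * f x) = (LINT x|N. f x - indicator A x * f x)"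
      by (intro Bochner_Integration.integral_cong) (auto simp: indicator_def)
    also have "\<dots> = 0"
      using integrable_mult_indicator[OF A f] f compl(2) zero(2) by (subst Bochner_Integration.integral_diff) auto
    finally show ?case .
  next
    case (union A)
    then have A: "\<And>i. A i \<in> sets N" using sub by auto
    have 0: "(LINT x:A i|N. f x) = 0" for i using union(3)[of i] by (simp add: set_lebesgue_integral_def)
    have "(LINT x:(\<Union>i. A i)|N. f x) = (\<Sum>i. LINT x:A i|N. f x)"
      by (rule lebesgue_integral_countable_add)
         (use A union(1) f integrable_mult_indicator[of "\<Union>i. A i", OF _ f] in \<open>auto simp: disjoint_family_on_def set_integrable_def\<close>)
    also have "\<dots> = 0" using 0 by simp
    finally show ?case by (simp add: set_lebesgue_integral_def)
  qed (use zero in auto)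
qed

context prob_space begin

lemma pair_sigma_finite_timeline: "pair_sigma_finite (timeline T) M"
proof -
  interpret finite_measure "timeline T" by (rule finite_measure_timeline)
  show ?thesis ..
qed

lemma finite_measure_timeline_pair: "finite_measure (timeline T \<Otimes>\<^sub>M M)"
  by (rule finite_measure_pair_measure) (intro finite_measure_timeline finite_measure_axioms)+

lemma measurable_process_integral:
  assumes X: "measurable_process M T X"
  shows "measurable_process M T (\<lambda>t \<omega>. LBINT s:{0..t}. X s \<omega>)"
proof -
  interpret T: finite_measure "timeline T" by (rule finite_measure_timeline)
  have X': "(\<lambda>p. X (fst p) (snd p)) \<in> borel_measurable (timeline T \<Otimes>\<^sub>M M)"
    using X by (simp add: measurable_process_iff split_beta')
  have c: "(\<lambda>p. (snd p, snd (fst p))) \<in> measurable ((timeline T \<Otimes>\<^sub>M M) \<Otimes>\<^sub>M timeline T) (timeline T \<Otimes>\<^sub>M M)"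
    by measurable
  have id: "(\<lambda>x. x) \<in> borel_measurable (timeline T)"
    by (rule measurable_restrict_space1) simp
  have m: "(\<lambda>(p, s). (if s \<le> fst p then X s (snd p) else 0))
      \<in> borel_measurable ((timeline T \<Otimes>\<^sub>M M) \<Otimes>\<^sub>M timeline T)"
  proof -
    have 1: "(\<lambda>p. X (snd p) (snd (fst p))) \<in> borel_measurable ((timeline T \<Otimes>\<^sub>M M) \<Otimes>\<^sub>M timeline T)"
      using measurable_compose[OF c X'] by simp
    have 2: "(\<lambda>p. snd p) \<in> borel_measurable ((timeline T \<Otimes>\<^sub>M M) \<Otimes>\<^sub>M timeline T)"
      "(\<lambda>p. fst (fst p)) \<in> borel_measurable ((timeline T \<Otimes>\<^sub>M M) \<Otimes>\<^sub>M timeline T)"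
      using measurable_compose[OF measurable_snd id] measurable_compose[OF measurable_compose[OF measurable_fst measurable_fst] id] by auto
    have "{p \<in> space ((timeline T \<Otimes>\<^sub>M M) \<Otimes>\<^sub>M timeline T). snd p \<le> fst (fst p)} \<in> sets ((timeline T \<Otimes>\<^sub>M M) \<Otimes>\<^sub>M timeline T)"
      by (rule borel_measurable_le[OF 2])
    from measurable_If[OF 1 borel_measurable_const this, of 0] show ?thesis
      by (simp add: split_beta')
  qed
  have "(\<lambda>p. LINT s|timeline T. (if s \<le> fst p then X s (snd p) else 0))
      \<in> borel_measurable (timeline T \<Otimes>\<^sub>M M)"
    by (rule T.borel_measurable_lebesgue_integral[OF m])
  then show ?thesis
    unfolding measurable_process_iff
  proof (subst measurable_cong)
    fix p assume p: "p \<in> space (timeline T \<Otimes>\<^sub>M M)"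
    show "(case p of (t, \<omega>) \<Rightarrow> LBINT s:{0..t}. X s \<omega>)
      = (LINT s|timeline T. (if s \<le> fst p then X s (snd p) else 0))"
      using p by (cases p) (auto simp: space_pair_measure set_integral_timeline_partial[of _ T] indicator_def
            intro!: Bochner_Integration.integral_cong)
  qed simp
qed

lemma integrable_process_measurable: "integrable_process M T X \<Longrightarrow> measurable_process M T X"
  unfolding integrable_process_def measurable_process_iff by auto

lemma integrable_processI_time:
  assumes "measurable_process M T X" "\<And>t. t \<in> {0..T} \<Longrightarrow> (\<integral>\<^sup>+\<omega>. ennreal \<bar>X t \<omega>\<bar> \<partial>M) \<le> ennreal C"
  shows "integrable_process M T X"
  unfolding integrable_process_def
proof (rule integrableI_bounded)
  interpret T: finite_measure "timeline T" by (rule finite_measure_timeline)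
  show m: "(\<lambda>(t, \<omega>). X t \<omega>) \<in> borel_measurable (timeline T \<Otimes>\<^sub>M M)"
    using assms(1) by (simp add: measurable_process_iff)
  have "(\<integral>\<^sup>+ p. ennreal (norm (case p of (t, \<omega>) \<Rightarrow> X t \<omega>)) \<partial>(timeline T \<Otimes>\<^sub>M M))
    = (\<integral>\<^sup>+ t. \<integral>\<^sup>+ \<omega>. ennreal \<bar>X t \<omega>\<bar> \<partial>M \<partial>timeline T)"
    using nn_integral_fst[OF measurable_compose[OF m, of "\<lambda>y. ennreal (norm y)"]] by simp
  also have "\<dots> \<le> (\<integral>\<^sup>+ t. ennreal C \<partial>timeline T)"
    by (intro nn_integral_mono) (use assms(2) in auto)
  also have "\<dots> = ennreal C * emeasure (timeline T) {0..T}" by simp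
  also have "\<dots> < \<infinity>" using T.emeasure_finite[of "{0..T}"]
    unfolding infinity_ennreal_def by (subst less_top[symmetric]) (simp add: ennreal_mult_eq_top_iff)
  finally show "(\<integral>\<^sup>+ p. ennreal (norm (case p of (t, \<omega>) \<Rightarrow> X t \<omega>)) \<partial>(timeline T \<Otimes>\<^sub>M M)) < \<infinity>" .
qed

lemma integrable_process_paths:
  assumes "integrable_process M T X"
  shows "AE \<omega> in M. set_integrable lborel {0..T} (\<lambda>t. X t \<omega>)"
    "integrable M (\<lambda>\<omega>. LBINT t:{0..T}. X t \<omega>)"
    "AE t in timeline T. integrable M (X t)"
    "set_integrable lborel {0..T} (\<lambda>t. expectation (X t))"
    "expectation (\<lambda>\<omega>. LBINT t:{0..T}. X t \<omega>) = (LBINT t:{0..T}. expectation (X t))"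
proof -
  interpret pair_sigma_finite "timeline T" M by (rule pair_sigma_finite_timeline)
  note i = assms[unfolded integrable_process_def]
  show "AE \<omega> in M. set_integrable lborel {0..T} (\<lambda>t. X t \<omega>)"
    using AE_integrable_snd[of X, OF i] by (simp add: set_integral_timeline)
  show "integrable M (\<lambda>\<omega>. LBINT t:{0..T}. X t \<omega>)"
    using integrable_snd[of X, OF i] by (simp add: set_integral_timeline)
  show "AE t in timeline T. integrable M (X t)"
    using AE_integrable_fst[of X, OF i] by simp
  show "set_integrable lborel {0..T} (\<lambda>t. expectation (X t))"
    using integrable_fst[of X, OF i] by (simp add: set_integral_timeline)
  show "expectation (\<lambda>\<omega>. LBINT t:{0..T}. X t \<omega>) = (LBINT t:{0..T}. expectation (X t))"
    using Fubini_integral[of X, OF i] by (simp add: set_integral_timeline)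
qed

lemma integrable_process_add:
  "integrable_process M T X \<Longrightarrow> integrable_process M T Y \<Longrightarrow> integrable_process M T (\<lambda>t \<omega>. X t \<omega> + Y t \<omega>)"
  unfolding integrable_process_def by (simp add: split_beta')

lemma integrable_process_bound:
  assumes "integrable_process M T X" "measurable_process M T Y"
    "\<And>t \<omega>. t \<in> {0..T} \<Longrightarrow> \<omega> \<in> space M \<Longrightarrow> \<bar>Y t \<omega>\<bar> \<le> \<bar>X t \<omega>\<bar>"
  shows "integrable_process M T Y"
  using assms(1) unfolding integrable_process_def
  by (rule Bochner_Integration.integrable_bound)
     (use assms(2,3) in \<open>auto simp: measurable_process_iff space_pair_measure\<close>)

lemma integrable_process_const: "integrable_process M T (\<lambda>t \<omega>. c)"
proof -
  interpret finite_measure "timeline T \<Otimes>\<^sub>M M" by (rule finite_measure_timeline_pair)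
  show ?thesis unfolding integrable_process_def split_beta' by simp
qed

lemma integrable_process_mult_bounded:
  assumes X: "integrable_process M T X" and Y: "measurable_process M T Y"
    and K: "\<And>t \<omega>. t \<in> {0..T} \<Longrightarrow> \<omega> \<in> space M \<Longrightarrow> \<bar>Y t \<omega>\<bar> \<le> K"
  shows "integrable_process M T (\<lambda>t \<omega>. Y t \<omega> * X t \<omega>)"
proof (rule integrable_process_bound[where X="\<lambda>t \<omega>. K * X t \<omega>"])
  show "integrable_process M T (\<lambda>t \<omega>. K * X t \<omega>)"
    using X unfolding integrable_process_def by (simp add: split_beta')
  show "measurable_process M T (\<lambda>t \<omega>. Y t \<omega> * X t \<omega>)"
    by (intro measurable_process_mult Y integrable_process_measurable X)
  fix t \<omega> assume "t \<in> {0..T}" "\<omega> \<in> space M"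
  from K[OF this] show "\<bar>Y t \<omega> * X t \<omega>\<bar> \<le> \<bar>K * X t \<omega>\<bar>"
    by (auto simp: abs_mult intro!: mult_right_mono)
qed

lemma integrable_process_coeff:
  assumes X: "integrable_process M T X" and f: "bounded_measurable_on 0 T f"
  shows "integrable_process M T (\<lambda>t \<omega>. f t * X t \<omega>)"
proof -
  obtain K where "K > 0" "\<And>t. t \<in> {0..T} \<Longrightarrow> \<bar>f t\<bar> \<le> K" using f by (rule bounded_measurable_onE) blast
  then show ?thesis
    using f by (intro integrable_process_mult_bounded[OF X, of _ K] measurable_process_time) (auto simp: bounded_measurable_on_def)
qed

lemma integrable_process_omega_bounded:
  assumes X: "integrable_process M T X" and "Z \<in> borel_measurable M" "\<And>\<omega>. \<bar>Z \<omega>\<bar> \<le> K"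
  shows "integrable_process M T (\<lambda>t \<omega>. Z \<omega> * X t \<omega>)"
  using assms by (intro integrable_process_mult_bounded[OF X, of _ K] measurable_process_omega) auto

text \<open>
  The integrand is dominated by \<open>X\<^sup>2 + Y\<^sup>2\<close>.
\<close>

lemma integrable_process_prod:
  assumes "measurable_process M T X" "measurable_process M T Y"
    "integrable_process M T (\<lambda>t \<omega>. (X t \<omega>)\<^sup>2)" "integrable_process M T (\<lambda>t \<omega>. (Y t \<omega>)\<^sup>2)"
  shows "integrable_process M T (\<lambda>t \<omega>. X t \<omega> * Y t \<omega>)"
proof (rule integrable_process_bound[OF integrable_process_add[OF assms(3,4)] measurable_process_mult[OF assms(1,2)]])
  fix t \<omega>
  have "2 * (\<bar>X t \<omega>\<bar> * \<bar>Y t \<omega>\<bar>) \<le> (X t \<omega>)\<^sup>2 + (Y t \<omega>)\<^sup>2"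
    using sum_squares_bound[of "\<bar>X t \<omega>\<bar>" "\<bar>Y t \<omega>\<bar>"] by simp
  moreover have "0 \<le> \<bar>X t \<omega>\<bar> * \<bar>Y t \<omega>\<bar>" by simp
  ultimately have "\<bar>X t \<omega>\<bar> * \<bar>Y t \<omega>\<bar> \<le> (X t \<omega>)\<^sup>2 + (Y t \<omega>)\<^sup>2" by linarith
  then show "\<bar>X t \<omega> * Y t \<omega>\<bar> \<le> \<bar>(X t \<omega>)\<^sup>2 + (Y t \<omega>)\<^sup>2\<bar>" by (simp add: abs_mult)
qed

lemma integrable_process_if_square:
  assumes "measurable_process M T X" "integrable_process M T (\<lambda>t \<omega>. (X t \<omega>)\<^sup>2)"
  shows "integrable_process M T X"
  using integrable_process_prod[OF assms(1) measurable_process_omega[of "\<lambda>_. 1"] assms(2)] integrable_process_const[of T 1]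
  by simp

text \<open>
  A process that is measurable in both variables and adapted need not be given as a progressively measurable
  one, so Fubini's theorem does not apply within \<open>G\<close>. Instead the integral \<open>Z\<close> is compared with
  its conditional expectation given \<open>G\<close>. Testing \<open>Z\<close> with an event \<open>A\<close> amounts, time by time, to testing the
  adapted integrand with \<open>E[1\<^bsub>A\<^esub> | G]\<close>, which is the same as testing \<open>E[Z | G]\<close> with \<open>A\<close>. Hence
  the two agree almost surely, and \<open>G\<close> contains the null sets.
\<close>

lemma adapted_integral:
  assumes compl: "complete_measure M" and G: "subalgebra M G" "null_sets M \<subseteq> sets G"
    and X: "integrable_process M T X" and t: "t \<in> {0..T}"
    and ad: "\<And>s. s \<in> {0..t} \<Longrightarrow> X s \<in> borel_measurable G"
  shows "(\<lambda>\<omega>. LBINT s:{0..t}. X s \<omega>) \<in> borel_measurable G"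
proof -
  interpret G: sigma_finite_subalgebra M G
    by (rule finite_measure_subalgebra_is_sigma_finite) (use G in unfold_locales)
  have "bounded_measurable_on 0 T (indicat_real {0..t})" by (intro bounded_measurable_on_indicator) auto
  from integrable_process_coeff[OF X this]
  have XI: "integrable_process M T (\<lambda>s \<omega>. indicator {0..t} s * X s \<omega>)" .
  define Z where "Z = (\<lambda>\<omega>. LBINT s:{0..t}. X s \<omega>)"
  have Z: "Z \<omega> = (LBINT s:{0..T}. indicator {0..t} s * X s \<omega>)" for \<omega>
    unfolding Z_def set_integral_timeline(1)[of T] using t by (intro set_integral_timeline_partial) simp
  have intZ: "integrable M Z" unfolding Z using integrable_process_paths(2)[OF XI] .
  have pull: "expectation (\<lambda>\<omega>. Y \<omega> * (c * X s \<omega>)) = c * expectation (\<lambda>\<omega>. Y \<omega> * X s \<omega>)" for Y c s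
    by (simp flip: integral_mult_right_zero add: mult.left_commute)
  \<comment> \<open>time and expectation are exchanged once, so that tests can be evaluated at a fixed time\<close>
  have test: "expectation (\<lambda>\<omega>. Y \<omega> * Z \<omega>) = (LBINT s:{0..T}. indicator {0..t} s * expectation (\<lambda>\<omega>. Y \<omega> * X s \<omega>))"
    if "Y \<in> borel_measurable M" "\<And>\<omega>. \<bar>Y \<omega>\<bar> \<le> 1" for Y
  proof -
    have "integrable_process M T (\<lambda>s \<omega>. Y \<omega> * (indicator {0..t} s * X s \<omega>))"
      by (rule integrable_process_omega_bounded[OF XI that])
    from integrable_process_paths(5)[OF this]
    have "expectation (\<lambda>\<omega>. Y \<omega> * Z \<omega>) = (LBINT s:{0..T}. expectation (\<lambda>\<omega>. Y \<omega> * (indicator {0..t} s * X s \<omega>)))"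
      by (simp add: Z)
    then show ?thesis by (simp add: pull)
  qed
  have "AE \<omega> in M. real_cond_exp M G Z \<omega> = Z \<omega>"
  proof (rule AE_symmetric, rule density_unique_real)
    fix A assume A: "A \<in> sets M"
    define Y where "Y = real_cond_exp M G (indicat_real A)"
    have iA: "integrable M (indicat_real A)"
      using A by (intro integrable_real_indicator) (auto simp: top.not_eq_extremum[symmetric])
    have YG: "Y \<in> borel_measurable G" by (auto simp: Y_def)
    have "AE \<omega> in M. 0 \<le> Y \<omega>" unfolding Y_def by (rule G.real_cond_exp_pos) (use A in auto)
    moreover have "AE \<omega> in M. Y \<omega> \<le> 1"
      unfolding Y_def using G.real_cond_exp_le_c[OF iA, of 1] by (auto simp: indicator_def)
    ultimately have Yb: "AE \<omega> in M. Y \<omega> = max 0 (min 1 (Y \<omega>))" by eventually_elim auto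
    define Y' where "Y' = (\<lambda>\<omega>. max 0 (min 1 (Y \<omega>)))"
    have Y': "Y' \<in> borel_measurable G" "\<And>\<omega>. \<bar>Y' \<omega>\<bar> \<le> 1" using YG by (auto simp: Y'_def)
    have Y'M: "Y' \<in> borel_measurable M" using measurable_mono_subalgebra[OF G(1) Y'(1)] .
    have swap: "expectation (\<lambda>\<omega>. indicator A \<omega> * V \<omega>) = expectation (\<lambda>\<omega>. Y' \<omega> * V \<omega>)"
      if V: "V \<in> borel_measurable G" "integrable M V" for V
    proof -
      have iAV: "integrable M (\<lambda>\<omega>. V \<omega> * indicator A \<omega>)"
        using integrable_mult_indicator[OF A V(2)] by (simp add: mult.commute)
      have "expectation (\<lambda>\<omega>. V \<omega> * Y \<omega>) = expectation (\<lambda>\<omega>. V \<omega> * indicator A \<omega>)"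
        unfolding Y_def by (rule G.real_cond_exp_intg(2)[OF iAV V(1)]) (use A in simp)
      moreover have "expectation (\<lambda>\<omega>. V \<omega> * Y \<omega>) = expectation (\<lambda>\<omega>. V \<omega> * Y' \<omega>)"
        using Yb YG V(2) Y'M measurable_mono_subalgebra[OF G(1) YG]
        by (intro integral_cong_AE) (auto simp: Y'_def)
      ultimately show ?thesis by (simp add: mult.commute)
    qed
    have "expectation (\<lambda>\<omega>. indicator A \<omega> * Z \<omega>) = expectation (\<lambda>\<omega>. Y' \<omega> * Z \<omega>)"
    proof -
      have "AE s in timeline T. indicator {0..t} s * expectation (\<lambda>\<omega>. indicator A \<omega> * X s \<omega>)
        = indicator {0..t} s * expectation (\<lambda>\<omega>. Y' \<omega> * X s \<omega>)"
        using integrable_process_paths(3)[OF X]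
        by eventually_elim (use swap ad in \<open>auto simp: indicator_def\<close>)
      moreover have "(\<lambda>s. indicator {0..t} s * expectation (\<lambda>\<omega>. Y \<omega> * X s \<omega>)) \<in> borel_measurable (timeline T)"
        if "Y \<in> borel_measurable M" "\<And>\<omega>. \<bar>Y \<omega>\<bar> \<le> 1" for Y
      proof -
        have "integrable_process M T (\<lambda>s \<omega>. Y \<omega> * (indicator {0..t} s * X s \<omega>))"
          by (rule integrable_process_omega_bounded[OF XI that])
        from integrable_process_paths(4)[OF this] show ?thesis
          by (auto simp: set_integral_timeline pull)
      qed
      ultimately have "(LBINT s:{0..T}. indicator {0..t} s * expectation (\<lambda>\<omega>. indicator A \<omega> * X s \<omega>))
        = (LBINT s:{0..T}. indicator {0..t} s * expectation (\<lambda>\<omega>. Y' \<omega> * X s \<omega>))"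
        unfolding set_integral_timeline using A Y'M Y' by (intro integral_cong_AE) auto
      then show ?thesis using A Y'M Y' by (subst (1 2) test) auto
    qed
    also have "\<dots> = expectation (\<lambda>\<omega>. Y' \<omega> * real_cond_exp M G Z \<omega>)"
      using Y'M intZ Y' by (intro G.real_cond_exp_intg(2)[symmetric] Bochner_Integration.integrable_bound[OF intZ])
        (auto simp: abs_mult intro!: mult_left_le_one_le)
    also have "\<dots> = expectation (\<lambda>\<omega>. indicator A \<omega> * real_cond_exp M G Z \<omega>)"
      by (rule swap[symmetric]) (auto intro: G.real_cond_exp_int(1)[OF intZ])
    finally show "(LINT \<omega>:A|M. Z \<omega>) = (LINT \<omega>:A|M. real_cond_exp M G Z \<omega>)"
      by (simp add: set_lebesgue_integral_def)
  qed (use intZ G.real_cond_exp_int(1)[OF intZ] in auto)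
  then show ?thesis
    unfolding Z_def[symmetric] by (rule measurable_AE_eq_complete[OF compl G borel_measurable_cond_exp])
qed

text \<open>
  The application has a supremum over uncountably many times for \<open>S\<close>. Its integral is to be understood as a
  lower integral, which is not additive in general, but a constant summand can be moved to the simple
  functions below the integrand.
\<close>

lemma nn_integral_affine_finite:
  assumes "(\<integral>\<^sup>+\<omega>. S \<omega> \<partial>M) < \<infinity>"
  shows "(\<integral>\<^sup>+\<omega>. 2 * S \<omega> + ennreal c \<partial>M) < \<infinity>"
proof -
  have "(\<integral>\<^sup>+\<omega>. 2 * S \<omega> + ennreal c \<partial>M) \<le> 2 * (\<integral>\<^sup>+\<omega>. S \<omega> \<partial>M) + ennreal c"
    unfolding nn_integral_def[of M "\<lambda>\<omega>. 2 * S \<omega> + ennreal c"]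
  proof (rule SUP_least)
    fix g assume "g \<in> {g. simple_function M g \<and> g \<le> (\<lambda>\<omega>. 2 * S \<omega> + ennreal c)}"
    then have g: "simple_function M g" "\<And>\<omega>. g \<omega> \<le> 2 * S \<omega> + ennreal c" by (auto simp: le_fun_def)
    note gm = borel_measurable_simple_function[OF g(1)]
    define k where "k = (\<lambda>\<omega>. (g \<omega> - ennreal c) / 2)"
    have k: "k \<in> borel_measurable M" unfolding k_def using gm by measurable
    have kS: "k \<omega> \<le> S \<omega>" for \<omega>
    proof -
      have "g \<omega> - ennreal c \<le> 2 * S \<omega>" using g(2)[of \<omega>] by (simp add: ennreal_minus_le_iff add.commute)
      then have "(g \<omega> - ennreal c) / 2 \<le> (2 * S \<omega>) / 2" by (rule divide_right_mono_ennreal)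
      also have "\<dots> = S \<omega>" by (simp add: ennreal_times_divide[symmetric] mult.commute[of 2] ennreal_mult_divide_eq mult_divide_eq_ennreal)
      finally show ?thesis by (simp add: k_def)
    qed
    have "integral\<^sup>S M g = (\<integral>\<^sup>+\<omega>. g \<omega> \<partial>M)" using nn_integral_eq_simple_integral[OF g(1)] by simp
    also have "\<dots> \<le> (\<integral>\<^sup>+\<omega>. 2 * k \<omega> + ennreal c \<partial>M)"
    proof (rule nn_integral_mono)
      fix \<omega>
      have "2 * k \<omega> = g \<omega> - ennreal c"
        unfolding k_def by (simp add: ennreal_times_divide mult.commute[of 2] mult_divide_eq_ennreal)
      then show "g \<omega> \<le> 2 * k \<omega> + ennreal c"
        by (metis add.commute ennreal_minus_le_iff order_refl)
    qed
    also have "\<dots> = 2 * (\<integral>\<^sup>+\<omega>. k \<omega> \<partial>M) + ennreal c"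
      using k by (subst nn_integral_add) (auto simp: nn_integral_cmult emeasure_space_1)
    also have "\<dots> \<le> 2 * (\<integral>\<^sup>+\<omega>. S \<omega> \<partial>M) + ennreal c"
      by (intro add_right_mono mult_left_mono nn_integral_mono kS) auto
    finally show "integral\<^sup>S M g \<le> 2 * (\<integral>\<^sup>+\<omega>. S \<omega> \<partial>M) + ennreal c" .
  qed
  also have "\<dots> < \<infinity>" using assms by (simp add: ennreal_mult_less_top)
  finally show ?thesis .
qed

end

section \<open>The Ito integral through the isometry for simple integrands\<close>

lemma integrable_bounded_mult:
  fixes f g :: "'a \<Rightarrow> real"
  assumes "integrable M f" "g \<in> borel_measurable M" "\<And>x. x \<in> space M \<Longrightarrow> \<bar>g x\<bar> \<le> L"
  shows "integrable M (\<lambda>x. g x * f x)"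
proof (rule Bochner_Integration.integrable_bound[of M "\<lambda>x. L * f x"])
  show "AE x in M. norm (g x * f x) \<le> norm (L * f x)"
  proof (rule AE_I2)
    fix x assume "x \<in> space M"
    then have "\<bar>g x\<bar> * \<bar>f x\<bar> \<le> \<bar>L\<bar> * \<bar>f x\<bar>" using assms(3)[of x] by (intro mult_right_mono) auto
    then show "norm (g x * f x) \<le> norm (L * f x)" by (simp add: abs_mult)
  qed
qed (use assms in auto)

lemma ennreal_integral_le_nn_integral:
  fixes f :: "'a \<Rightarrow> real"
  assumes "\<And>x. 0 \<le> f x"
  shows "ennreal (LINT x|M. f x) \<le> (\<integral>\<^sup>+x. ennreal (f x) \<partial>M)"
  using nn_integral_eq_integral[of M f] assms
  by (cases "integrable M f") (auto simp: not_integrable_integral_eq)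

text \<open>
  The point is approximated by rationals between \<open>r (1 - 1/(n+2))\<close> and a number slightly larger, which
  stays below \<open>t\<close> even for \<open>r = t\<close>.
\<close>

lemma rational_sequence_below:
  fixes r t :: real
  assumes "0 \<le> r" "r \<le> t" "0 < t"
  obtains q :: "nat \<Rightarrow> real" where "\<And>n. q n \<in> \<rat>" "\<And>n. 0 \<le> q n" "\<And>n. q n < t" "q \<longlonglongrightarrow> r"
proof -
  define l where "l = (\<lambda>n::nat. r * (1 - inverse (real (Suc (Suc n)))))"
  define u where "u = (\<lambda>n::nat. l n + (t - l n) * inverse (real (Suc (Suc n))))"
  have l: "0 \<le> l n" "l n < t" for n
  proof -
    have "inverse (real (Suc (Suc n))) \<le> 1" by (simp add: inverse_eq_divide)
    then show "0 \<le> l n" using assms by (simp add: l_def)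
    show "l n < t"
    proof (cases "r = 0")
      case False
      then have "l n < r" using assms by (simp add: l_def field_simps)
      then show ?thesis using assms by simp
    qed (use assms in \<open>simp add: l_def\<close>)
  qed
  have lu: "l n < u n" "u n < t" for n
  proof -
    show "l n < u n" using l(2)[of n] by (simp add: u_def)
    have "inverse (real (Suc (Suc n))) < 1" by (simp add: inverse_eq_divide)
    then have "(t - l n) * inverse (real (Suc (Suc n))) < (t - l n) * 1" using l(2)[of n] by (intro mult_strict_left_mono) auto
    then show "u n < t" by (simp add: u_def)
  qed
  have "\<exists>q\<in>\<rat>. l n < q \<and> q < u n" for n using Rats_dense_in_real[OF lu(1)[of n]] by blast
  then obtain q where q: "\<And>n. q n \<in> \<rat>" "\<And>n. l n < q n" "\<And>n. q n < u n" by metis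
  have inv: "(\<lambda>n. inverse (real (Suc (Suc n)))) \<longlonglongrightarrow> 0"
    using LIMSEQ_inverse_real_of_nat by (rule LIMSEQ_Suc)
  have ll: "l \<longlonglongrightarrow> r" unfolding l_def using tendsto_mult[OF tendsto_const tendsto_diff[OF tendsto_const inv], of r 1] by simp
  have "u \<longlonglongrightarrow> r"
    unfolding u_def using tendsto_add[OF ll tendsto_mult[OF tendsto_diff[OF tendsto_const ll] inv], of t] by simp
  from tendsto_sandwich[OF _ _ ll this, of q] have "q \<longlonglongrightarrow> r"
    using q by (auto simp: less_imp_le)
  show ?thesis
  proof (rule that[of q])
    show "0 \<le> q n" "q n < t" for n using q(2,3)[of n] l(1)[of n] lu(2)[of n] by auto
  qed fact+
qed

abbreviation mean_square :: "'a measure \<Rightarrow> ('a \<Rightarrow> real) \<Rightarrow> ennreal"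
  where "mean_square M f \<equiv> \<integral>\<^sup>+x. ennreal ((f x)\<^sup>2) \<partial>M"

abbreviation process_mean_square :: "'a measure \<Rightarrow> real \<Rightarrow> (real \<Rightarrow> 'a \<Rightarrow> real) \<Rightarrow> ennreal"
  where "process_mean_square M T X \<equiv> \<integral>\<^sup>+\<omega>. (\<integral>\<^sup>+t\<in>{0..T}. ennreal ((X t \<omega>)\<^sup>2) \<partial>lborel) \<partial>M"

lemma nn_integral_square_add:
  assumes [measurable]: "f \<in> borel_measurable M" "g \<in> borel_measurable M"
  shows "mean_square M (\<lambda>x. f x + g x) \<le> 2 * mean_square M (\<lambda>x. f x) + 2 * mean_square M (\<lambda>x. g x)"
proof -
  have "mean_square M (\<lambda>x. f x + g x) \<le> (\<integral>\<^sup>+x. 2 * ennreal ((f x)\<^sup>2) + 2 * ennreal ((g x)\<^sup>2) \<partial>M)"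
  proof (rule nn_integral_mono)
    fix x
    have "(f x + g x)\<^sup>2 \<le> 2 * (f x)\<^sup>2 + 2 * (g x)\<^sup>2"
      using zero_le_power2[of "f x - g x"] by (simp add: power2_sum power2_diff)
    then show "ennreal ((f x + g x)\<^sup>2) \<le> 2 * ennreal ((f x)\<^sup>2) + 2 * ennreal ((g x)\<^sup>2)"
      by (simp flip: ennreal_plus ennreal_numeral ennreal_mult)
  qed
  also have "\<dots> = 2 * mean_square M (\<lambda>x. f x) + 2 * mean_square M (\<lambda>x. g x)"
    by (simp add: nn_integral_add nn_integral_cmult)
  finally show ?thesis .
qed

lemma (in prob_space) nn_integral_process_eq:
  assumes "measurable_process M T X"
  shows "process_mean_square M T X
    = (\<integral>\<^sup>+p. ennreal ((X (fst p) (snd p))\<^sup>2) \<partial>(timeline T \<Otimes>\<^sub>M M))"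
proof -
  interpret pair_sigma_finite "timeline T" M by (rule pair_sigma_finite_timeline)
  have m: "(\<lambda>p. X (fst p) (snd p)) \<in> borel_measurable (timeline T \<Otimes>\<^sub>M M)"
    using assms(1) by (simp add: measurable_process_iff split_beta')
  have "(\<lambda>p. ennreal ((X (fst p) (snd p))\<^sup>2)) \<in> borel_measurable (timeline T \<Otimes>\<^sub>M M)" using m by measurable
  from nn_integral_snd[of "\<lambda>p. ennreal ((X (fst p) (snd p))\<^sup>2)", OF this] show ?thesis
    by (simp add: nn_integral_restrict_space)
qed

lemma (in prob_space) nn_integral_process_square_add:
  assumes X: "measurable_process M T X" and Y: "measurable_process M T Y"
  shows "process_mean_square M T (\<lambda>t \<omega>. X t \<omega> + Y t \<omega>)
    \<le> 2 * process_mean_square M T X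
      + 2 * process_mean_square M T Y"
  unfolding nn_integral_process_eq[OF X] nn_integral_process_eq[OF Y] nn_integral_process_eq[OF measurable_process_add[OF X Y]]
  by (rule nn_integral_square_add) (use X Y in \<open>auto simp: measurable_process_iff split_beta'\<close>)

text \<open>
  A Brownian motion whose increments are independent of the past of a filtration that may be larger than
  its own. The two driving noises are both treated in this way, with their joint filtration.
\<close>

locale brownian_in_filtration = prob_space M for M :: "'a measure" +
  fixes T :: real and F :: "real \<Rightarrow> 'a measure" and B :: "real \<Rightarrow> 'a \<Rightarrow> real"
  assumes sub_F: "t \<in> {0..T} \<Longrightarrow> subalgebra M (F t)"
    and mono_F: "0 \<le> s \<Longrightarrow> s \<le> t \<Longrightarrow> t \<le> T \<Longrightarrow> subalgebra (F t) (F s)"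
    and adapted_B: "t \<in> {0..T} \<Longrightarrow> B t \<in> borel_measurable (F t)"
    and increment_distr: "0 \<le> s \<Longrightarrow> s < t \<Longrightarrow> t \<le> T \<Longrightarrow>
      distributed M lborel (\<lambda>\<omega>. B t \<omega> - B s \<omega>) (\<lambda>y. ennreal (normal_density 0 (sqrt (t - s)) y))"
    and increment_indep: "0 \<le> s \<Longrightarrow> s < t \<Longrightarrow> t \<le> T \<Longrightarrow>
      indep_set (sets (F s)) (sets (vimage_algebra (space M) (\<lambda>\<omega>. B t \<omega> - B s \<omega>) borel))"
begin

lemma measurable_F_mono:
  assumes "f \<in> borel_measurable (F s)" "0 \<le> s" "s \<le> t" "t \<le> T"
  shows "f \<in> borel_measurable (F t)"
  using measurable_mono_subalgebra[OF mono_F[OF assms(2-)] assms(1)] .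

lemma measurable_F_M:
  assumes "f \<in> borel_measurable (F s)" "0 \<le> s" "s \<le> T"
  shows "f \<in> borel_measurable M"
  using measurable_mono_subalgebra[OF sub_F assms(1)] assms(2,3) by simp

lemma B_measurable_M: "t \<in> {0..T} \<Longrightarrow> B t \<in> borel_measurable M"
  using adapted_B measurable_F_M by auto

lemma increment_indep_var:
  assumes st: "0 \<le> s" "s < t" "t \<le> T" and \<eta>: "\<eta> \<in> borel_measurable (F s)" and f: "f \<in> borel_measurable borel"
  shows "indep_var borel \<eta> borel (\<lambda>\<omega>. f (B t \<omega> - B s \<omega>) :: real)"
proof -
  let ?D = "\<lambda>\<omega>. B t \<omega> - B s \<omega>"
  have meas: "\<eta> \<in> borel_measurable M" "?D \<in> borel_measurable M"
    using st \<eta> B_measurable_M[of s] B_measurable_M[of t] by (auto intro: measurable_F_M)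
  have sp: "space (F s) = space M" using sub_F[of s] st by (simp add: subalgebra_def)
  have "sigma_sets (space M) {\<eta> -` A \<inter> space M |A. A \<in> sets borel} \<subseteq> sets (F s)"
    unfolding sp[symmetric] by (rule sets.sigma_sets_subset) (use \<eta> in \<open>auto intro: measurable_sets\<close>)
  moreover have "sigma_sets (space M) {(\<lambda>\<omega>. f (?D \<omega>)) -` A \<inter> space M |A. A \<in> sets borel}
    \<subseteq> sets (vimage_algebra (space M) ?D borel)"
  proof -
    let ?V = "vimage_algebra (space M) ?D borel"
    have "(\<lambda>\<omega>. f (?D \<omega>)) \<in> borel_measurable ?V"
      using measurable_compose[OF measurable_vimage_algebra1[of ?D "space M" borel] f] by auto
    then have "sigma_sets (space ?V) {(\<lambda>\<omega>. f (?D \<omega>)) -` A \<inter> space ?V |A. A \<in> sets borel} \<subseteq> sets ?V"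
      by (intro sets.sigma_sets_subset) (auto simp del: space_vimage_algebra intro!: measurable_sets[of _ ?V borel])
    then show ?thesis by simp
  qed
  ultimately have "indep_set (sigma_sets (space M) {\<eta> -` A \<inter> space M |A. A \<in> sets borel})
    (sigma_sets (space M) {(\<lambda>\<omega>. f (?D \<omega>)) -` A \<inter> space M |A. A \<in> sets borel})"
    using increment_indep[OF st] unfolding indep_sets2_eq by blast
  then show ?thesis unfolding indep_var_eq using meas f by auto
qed

lemma increment_moments:
  assumes st: "0 \<le> s" "s \<le> t" "t \<le> T" and \<eta>: "\<eta> \<in> borel_measurable (F s)" "integrable M \<eta>"
  shows "integrable M (\<lambda>\<omega>. \<eta> \<omega> * (B t \<omega> - B s \<omega>))"
    and "expectation (\<lambda>\<omega>. \<eta> \<omega> * (B t \<omega> - B s \<omega>)) = 0"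
    and "integrable M (\<lambda>\<omega>. \<eta> \<omega> * (B t \<omega> - B s \<omega>)\<^sup>2)"
    and "expectation (\<lambda>\<omega>. \<eta> \<omega> * (B t \<omega> - B s \<omega>)\<^sup>2) = (t - s) * expectation \<eta>"
proof -
  let ?D = "\<lambda>\<omega>. B t \<omega> - B s \<omega>"
  have "integrable M (\<lambda>\<omega>. \<eta> \<omega> * ?D \<omega>) \<and> expectation (\<lambda>\<omega>. \<eta> \<omega> * ?D \<omega>) = 0 \<and>
    integrable M (\<lambda>\<omega>. \<eta> \<omega> * (?D \<omega>)\<^sup>2) \<and> expectation (\<lambda>\<omega>. \<eta> \<omega> * (?D \<omega>)\<^sup>2) = (t - s) * expectation \<eta>"
  proof (cases "s = t")
    case False
    then have lt: "s < t" using st by simp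
    let ?\<sigma> = "sqrt (t - s)"
    have pos: "0 < ?\<sigma>" using lt by simp
    note D = increment_distr[OF st(1) lt st(3)]
    have i: "integrable M (\<lambda>\<omega>. (?D \<omega>)^k)" for k :: nat
      using distributed_integrable[OF D, of "\<lambda>x. x^k"] integrable_normal_moment[OF pos, of 0 k]
      by (simp add: normal_density_nonneg)
    have i1: "integrable M ?D" using i[of 1] by simp
    have e1: "expectation ?D = 0" by (rule normal_distributed_expectation[OF pos D])
    have e2: "expectation (\<lambda>\<omega>. (?D \<omega>)\<^sup>2) = t - s"
      using normal_distributed_variance[OF pos D] e1 lt by simp
    have v1: "indep_var borel \<eta> borel ?D" using increment_indep_var[OF st(1) lt st(3) \<eta>(1), of "\<lambda>x. x"] by simp
    have v2: "indep_var borel \<eta> borel (\<lambda>\<omega>. (?D \<omega>)\<^sup>2)"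
      using increment_indep_var[OF st(1) lt st(3) \<eta>(1), of "\<lambda>x. x\<^sup>2"] by simp
    show ?thesis
      using indep_var_integrable[OF v1 \<eta>(2) i1] indep_var_lebesgue_integral[OF v1 \<eta>(2) i1]
        indep_var_integrable[OF v2 \<eta>(2) i] indep_var_lebesgue_integral[OF v2 \<eta>(2) i] e1 e2 by (simp add: mult.commute)
  qed simp
  then show "integrable M (\<lambda>\<omega>. \<eta> \<omega> * (B t \<omega> - B s \<omega>))"
    and "expectation (\<lambda>\<omega>. \<eta> \<omega> * (B t \<omega> - B s \<omega>)) = 0"
    and "integrable M (\<lambda>\<omega>. \<eta> \<omega> * (B t \<omega> - B s \<omega>)\<^sup>2)"
    and "expectation (\<lambda>\<omega>. \<eta> \<omega> * (B t \<omega> - B s \<omega>)\<^sup>2) = (t - s) * expectation \<eta>" by auto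
qed

lemma integrable_bounded_F:
  fixes \<xi> :: "'a \<Rightarrow> real"
  assumes "\<xi> \<in> borel_measurable (F s)" "0 \<le> s" "s \<le> T" "\<And>\<omega>. \<omega> \<in> space M \<Longrightarrow> \<bar>\<xi> \<omega>\<bar> \<le> K"
  shows "integrable M \<xi>"
  using measurable_F_M[OF assms(1-3)] assms(4) by (intro integrable_const_bound[of _ K]) auto

text \<open>
  Write both increments as sums over the pieces into which their end points divide the time axis.
  In a product over two different pieces the later increment is independent of everything else and has mean
  zero. Only the square of the increment over the common piece, from \<open>c\<close> to \<open>e\<close>, contributes.
\<close>

lemma increment_covariance_ordered:
  assumes a: "0 \<le> a" "a \<le> b" "b \<le> T" and c: "a \<le> c" "c \<le> d" "d \<le> T" and t: "t \<in> {0..T}"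
    and \<xi>: "\<xi> \<in> borel_measurable (F a)" "\<And>\<omega>. \<omega> \<in> space M \<Longrightarrow> \<bar>\<xi> \<omega>\<bar> \<le> K"
    and \<eta>: "\<eta> \<in> borel_measurable (F c)" "\<And>\<omega>. \<omega> \<in> space M \<Longrightarrow> \<bar>\<eta> \<omega>\<bar> \<le> L"
  defines "U \<equiv> \<lambda>\<omega>. \<xi> \<omega> * (B (min t b) \<omega> - B (min t a) \<omega>)"
    and "V \<equiv> \<lambda>\<omega>. \<eta> \<omega> * (B (min t d) \<omega> - B (min t c) \<omega>)"
  shows "integrable M (\<lambda>\<omega>. U \<omega> * V \<omega>) \<and>
    expectation (\<lambda>\<omega>. U \<omega> * V \<omega>) = max 0 (min t (min b d) - c) * expectation (\<lambda>\<omega>. \<xi> \<omega> * \<eta> \<omega>)"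
proof (cases "t \<le> c")
  case True
  then have "V = (\<lambda>_. 0)" using c by (auto simp: V_def min_def)
  then show ?thesis using True by auto
next
  case ct: False
  define P where "P = (\<lambda>\<omega>. \<xi> \<omega> * \<eta> \<omega>)"
  have Pm: "P \<in> borel_measurable (F c)"
    unfolding P_def using measurable_F_mono[OF \<xi>(1), of c] \<eta>(1) a c by (intro borel_measurable_times) auto
  have Pb: "\<bar>P \<omega>\<bar> \<le> K * L" if "\<omega> \<in> space M" for \<omega>
    unfolding P_def abs_mult using \<xi>(2)[OF that] \<eta>(2)[OF that] by (intro mult_mono) auto
  have P: "integrable M P" by (rule integrable_bounded_F[OF Pm _ _ Pb]) (use a c in auto)
  have PB: "(\<lambda>\<omega>. P \<omega> * (B v \<omega> - B u \<omega>)) \<in> borel_measurable (F e)" if "c \<le> e" "0 \<le> u" "0 \<le> v" "u \<le> e" "v \<le> e" "e \<le> T" for u v e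
    using that a c Pm measurable_F_mono[OF Pm, of e] measurable_F_mono[OF adapted_B, of u e] measurable_F_mono[OF adapted_B, of v e]
    by (intro borel_measurable_times borel_measurable_diff) auto
  have P1: "integrable M (\<lambda>\<omega>. P \<omega> * (B v \<omega> - B u \<omega>))" if "c \<le> u" "u \<le> v" "v \<le> T" for u v
    using increment_moments(1)[of u v P] measurable_F_mono[OF Pm, of u] that a c P by auto
  show ?thesis
  proof (cases "b \<le> c")
    case True
    have Pac: "integrable M (\<lambda>\<omega>. P \<omega> * (B b \<omega> - B a \<omega>))"
    proof -
      have "integrable M (\<lambda>\<omega>. \<xi> \<omega> * (B b \<omega> - B a \<omega>))"
        by (rule increment_moments(1)) (use a c \<xi> integrable_bounded_F[OF \<xi>(1) _ _ \<xi>(2)] in auto)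
      from integrable_bounded_mult[OF this measurable_F_M[OF \<eta>(1)] \<eta>(2)] show ?thesis
        using a c by (simp add: P_def mult.assoc mult.left_commute)
    qed
    have eq: "(\<lambda>\<omega>. U \<omega> * V \<omega>) = (\<lambda>\<omega>. (P \<omega> * (B b \<omega> - B a \<omega>)) * (B (min t d) \<omega> - B c \<omega>))"
      using ct True a by (auto simp: U_def V_def P_def min_def fun_eq_iff)
    have "(\<lambda>\<omega>. P \<omega> * (B b \<omega> - B a \<omega>)) \<in> borel_measurable (F c)" by (rule PB) (use a c True in auto)
    from increment_moments(1,2)[OF _ _ _ this Pac, of "min t d"] show ?thesis
      unfolding eq using a c t ct True by auto
  next
    case False
    define e where "e = min t (min b d)"
    define b' where "b' = min t b"
    define d' where "d' = min t d"
    have o: "c \<le> e" "e \<le> b'" "e \<le> d'" "b' \<le> T" "d' \<le> T" "e \<le> T" "0 \<le> c" "c \<le> T" and or: "e = b' \<or> e = d'"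
      using ct False a c t by (auto simp: e_def b'_def d'_def)
    have eq: "U \<omega> * V \<omega> = (P \<omega> * (B c \<omega> - B a \<omega>)) * (B d' \<omega> - B c \<omega>) + P \<omega> * (B e \<omega> - B c \<omega>)\<^sup>2
        + (P \<omega> * (B e \<omega> - B c \<omega>)) * (B d' \<omega> - B e \<omega>) + (P \<omega> * (B e \<omega> - B c \<omega>)) * (B b' \<omega> - B e \<omega>)" for \<omega>
    proof -
      have UV: "U \<omega> * V \<omega> = P \<omega> * ((B b' \<omega> - B a \<omega>) * (B d' \<omega> - B c \<omega>))"
        using ct c a by (simp add: U_def V_def P_def b'_def d'_def min_def)
      have "(B b' \<omega> - B e \<omega>) * (B d' \<omega> - B e \<omega>) = 0" using or by auto
      then have split: "(B b' \<omega> - B a \<omega>) * (B d' \<omega> - B c \<omega>) = (B c \<omega> - B a \<omega>) * (B d' \<omega> - B c \<omega>) + (B e \<omega> - B c \<omega>)\<^sup>2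
        + (B e \<omega> - B c \<omega>) * (B d' \<omega> - B e \<omega>) + (B e \<omega> - B c \<omega>) * (B b' \<omega> - B e \<omega>)"
        by (simp add: power2_eq_square algebra_simps)
      show ?thesis unfolding UV split by (simp add: distrib_left mult.assoc)
    qed
    have Pac: "integrable M (\<lambda>\<omega>. P \<omega> * (B c \<omega> - B a \<omega>))"
    proof -
      have "integrable M (\<lambda>\<omega>. \<xi> \<omega> * (B c \<omega> - B a \<omega>))"
        by (rule increment_moments(1)) (use a c \<xi> integrable_bounded_F[OF \<xi>(1) _ _ \<xi>(2)] in auto)
      from integrable_bounded_mult[OF this measurable_F_M[OF \<eta>(1)] \<eta>(2)] show ?thesis
        using a c by (simp add: P_def mult.assoc mult.left_commute)
    qed
    note m1 = increment_moments(1,2)[OF _ _ _ PB[of c a c] Pac, of d']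
    note m2 = increment_moments(3,4)[OF _ _ _ Pm P, of e]
    note m3 = increment_moments(1,2)[OF _ _ _ PB[of e c e] P1[of c e], of d']
    note m4 = increment_moments(1,2)[OF _ _ _ PB[of e c e] P1[of c e], of b']
    have "max 0 (min t (min b d) - c) = e - c" using o by (simp add: e_def)
    then show ?thesis
      unfolding eq P_def[symmetric] using m1 m2 m3 m4 o a c by simp
  qed
qed

lemma increment_covariance:
  assumes a: "0 \<le> a" "a \<le> b" "b \<le> T" and c: "0 \<le> c" "c \<le> d" "d \<le> T" and t: "t \<in> {0..T}"
    and \<xi>: "\<xi> \<in> borel_measurable (F a)" "\<And>\<omega>. \<omega> \<in> space M \<Longrightarrow> \<bar>\<xi> \<omega>\<bar> \<le> K"
    and \<eta>: "\<eta> \<in> borel_measurable (F c)" "\<And>\<omega>. \<omega> \<in> space M \<Longrightarrow> \<bar>\<eta> \<omega>\<bar> \<le> L"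
  defines "U \<equiv> \<lambda>\<omega>. \<xi> \<omega> * (B (min t b) \<omega> - B (min t a) \<omega>)"
    and "V \<equiv> \<lambda>\<omega>. \<eta> \<omega> * (B (min t d) \<omega> - B (min t c) \<omega>)"
  shows "integrable M (\<lambda>\<omega>. U \<omega> * V \<omega>)"
    "expectation (\<lambda>\<omega>. U \<omega> * V \<omega>) =
      (LBINT s:{0..t}. indicator {a<..b} s * indicator {c<..d} s) * expectation (\<lambda>\<omega>. \<xi> \<omega> * \<eta> \<omega>)"
proof -
  have len: "(LBINT s:{0..t}. indicator {a<..b} s * indicator {c<..d} s) = max 0 (min t (min b d) - max a c)"
  proof -
    have "(LBINT s:{0..t}. indicator {a<..b} s * indicator {c<..d} s) = (LBINT s. indicat_real {max a c<..min t (min b d)} s)"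
      unfolding set_lebesgue_integral_def using a c
      by (intro Bochner_Integration.integral_cong) (auto simp: indicator_def)
    also have "\<dots> = max 0 (min t (min b d) - max a c)"
      by (cases "max a c \<le> min t (min b d)") auto
    finally show ?thesis .
  qed
  have "integrable M (\<lambda>\<omega>. U \<omega> * V \<omega>) \<and>
    expectation (\<lambda>\<omega>. U \<omega> * V \<omega>) = max 0 (min t (min b d) - max a c) * expectation (\<lambda>\<omega>. \<xi> \<omega> * \<eta> \<omega>)"
  proof (cases "a \<le> c")
    case True
    with increment_covariance_ordered[OF a True c(2,3) t \<xi> \<eta>] show ?thesis
      unfolding U_def V_def by (simp add: max_def)
  next
    case False
    then have "c \<le> a" by simp
    with increment_covariance_ordered[OF c this a(2,3) t \<eta> \<xi>] show ?thesis
      unfolding U_def V_def by (simp add: max_def mult.commute min.commute[of b])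
  qed
  then show "integrable M (\<lambda>\<omega>. U \<omega> * V \<omega>)"
    "expectation (\<lambda>\<omega>. U \<omega> * V \<omega>) =
      (LBINT s:{0..t}. indicator {a<..b} s * indicator {c<..d} s) * expectation (\<lambda>\<omega>. \<xi> \<omega> * \<eta> \<omega>)"
    unfolding len by auto
qed

text \<open>
  Both sides are double sums over \<open>J\<close>, and \<open>increment_covariance\<close> compares them term by term. The
  index set is arbitrary and the intervals may overlap, so that a difference of two simple integrals over
  different partitions is an instance.
\<close>

lemma simple_isometry:
  fixes J :: "'i set" and a b :: "'i \<Rightarrow> real" and \<xi> :: "'i \<Rightarrow> 'a \<Rightarrow> real"
  assumes J: "finite J" and t: "t \<in> {0..T}"
    and ab: "\<And>j. j \<in> J \<Longrightarrow> 0 \<le> a j \<and> a j \<le> b j \<and> b j \<le> T"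
    and \<xi>: "\<And>j. j \<in> J \<Longrightarrow> \<xi> j \<in> borel_measurable (F (a j))"
    and bd: "\<And>j. j \<in> J \<Longrightarrow> \<exists>K. \<forall>\<omega>\<in>space M. \<bar>\<xi> j \<omega>\<bar> \<le> K"
  shows "mean_square M (\<lambda>\<omega>. \<Sum>j\<in>J. \<xi> j \<omega> * (B (min t (b j)) \<omega> - B (min t (a j)) \<omega>))
    \<le> process_mean_square M T (\<lambda>s \<omega>. \<Sum>j\<in>J. \<xi> j \<omega> * indicator {a j<..b j} s)"
proof -
  define D where "D = (\<lambda>j \<omega>. \<xi> j \<omega> * (B (min t (b j)) \<omega> - B (min t (a j)) \<omega>))"
  define I :: "'i \<Rightarrow> 'i \<Rightarrow> real" where "I = (\<lambda>i j. LBINT s:{0..t}. indicator {a i<..b i} s * indicator {a j<..b j} s)"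
  obtain K where K: "\<And>j \<omega>. j \<in> J \<Longrightarrow> \<omega> \<in> space M \<Longrightarrow> \<bar>\<xi> j \<omega>\<bar> \<le> K j" using bd by metis
  have \<xi>M: "\<xi> j \<in> borel_measurable M" if "j \<in> J" for j
    using measurable_F_M[OF \<xi>[OF that]] ab[OF that] by auto
  have cov: "integrable M (\<lambda>\<omega>. D i \<omega> * D j \<omega>)"
    "expectation (\<lambda>\<omega>. D i \<omega> * D j \<omega>) = I i j * expectation (\<lambda>\<omega>. \<xi> i \<omega> * \<xi> j \<omega>)" if "i \<in> J" "j \<in> J" for i j
    unfolding D_def I_def
    using increment_covariance[of "a i" "b i" "a j" "b j" t "\<xi> i" "K i" "\<xi> j" "K j"] ab[OF that(1)] ab[OF that(2)] t \<xi> K that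
    by auto
  have \<xi>\<xi>: "integrable M (\<lambda>\<omega>. \<xi> i \<omega> * \<xi> j \<omega>)" if "i \<in> J" "j \<in> J" for i j
    using \<xi>M[OF that(1)] \<xi>M[OF that(2)] K[OF that(1)] K[OF that(2)]
    by (intro integrable_const_bound[of _ "K i * K j"] AE_I2)
       (auto simp: abs_mult intro!: mult_mono intro: order_trans[OF abs_ge_zero])
  have "mean_square M (\<lambda>\<omega>. \<Sum>j\<in>J. D j \<omega>) = ennreal (expectation (\<lambda>\<omega>. (\<Sum>j\<in>J. D j \<omega>)\<^sup>2))"
  proof (rule nn_integral_eq_integral)
    show "integrable M (\<lambda>\<omega>. (\<Sum>j\<in>J. D j \<omega>)\<^sup>2)"
      unfolding power2_eq_square sum_product using cov by (intro Bochner_Integration.integrable_sum)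
  qed simp
  also have "expectation (\<lambda>\<omega>. (\<Sum>j\<in>J. D j \<omega>)\<^sup>2) = (\<Sum>i\<in>J. \<Sum>j\<in>J. I i j * expectation (\<lambda>\<omega>. \<xi> i \<omega> * \<xi> j \<omega>))"
    using cov by (simp add: power2_eq_square sum_product)
  also have "\<dots> = expectation (\<lambda>\<omega>. \<Sum>i\<in>J. \<Sum>j\<in>J. I i j * (\<xi> i \<omega> * \<xi> j \<omega>))"
    using \<xi>\<xi> by simp
  also have "\<dots> = expectation (\<lambda>\<omega>. LBINT s:{0..t}. (\<Sum>j\<in>J. \<xi> j \<omega> * indicator {a j<..b j} s)\<^sup>2)"
  proof (rule Bochner_Integration.integral_cong)
    fix \<omega>
    have ii: "set_integrable lborel {0..t} (\<lambda>s. c * (indicat_real {a i<..b i} s * indicat_real {a j<..b j} s))" for c i j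
      by (intro bounded_measurable_on_integrable bounded_measurable_on_mult bounded_measurable_on_const bounded_measurable_on_indicator) auto
    have "(LBINT s:{0..t}. (\<Sum>j\<in>J. \<xi> j \<omega> * indicator {a j<..b j} s)\<^sup>2)
      = (LBINT s:{0..t}. \<Sum>i\<in>J. \<Sum>j\<in>J. (\<xi> i \<omega> * \<xi> j \<omega>) * (indicator {a i<..b i} s * indicator {a j<..b j} s))"
      by (simp add: power2_eq_square sum_product ac_simps)
    also have "\<dots> = (\<Sum>i\<in>J. \<Sum>j\<in>J. LBINT s:{0..t}. (\<xi> i \<omega> * \<xi> j \<omega>) * (indicator {a i<..b i} s * indicator {a j<..b j} s))"
      using ii J unfolding set_lebesgue_integral_def set_integrable_def scaleR_sum_right
      by (subst Bochner_Integration.integral_sum, force intro!: Bochner_Integration.integrable_sum, subst Bochner_Integration.integral_sum) auto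
    also have "\<dots> = (\<Sum>i\<in>J. \<Sum>j\<in>J. I i j * (\<xi> i \<omega> * \<xi> j \<omega>))"
      unfolding set_integral_mult_right I_def by (simp add: mult.commute)
    finally show "(\<Sum>i\<in>J. \<Sum>j\<in>J. I i j * (\<xi> i \<omega> * \<xi> j \<omega>)) = (LBINT s:{0..t}. (\<Sum>j\<in>J. \<xi> j \<omega> * indicator {a j<..b j} s)\<^sup>2)" ..
  qed simp
  also have "ennreal \<dots> \<le> (\<integral>\<^sup>+\<omega>. ennreal (LBINT s:{0..t}. (\<Sum>j\<in>J. \<xi> j \<omega> * indicator {a j<..b j} s)\<^sup>2) \<partial>M)"
    by (rule ennreal_integral_le_nn_integral) (auto simp: set_lebesgue_integral_def)
  also have "\<dots> \<le> process_mean_square M T (\<lambda>s \<omega>. \<Sum>j\<in>J. \<xi> j \<omega> * indicator {a j<..b j} s)"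
  proof (rule nn_integral_mono)
    fix \<omega>
    have "ennreal (LBINT s:{0..t}. (\<Sum>j\<in>J. \<xi> j \<omega> * indicator {a j<..b j} s)\<^sup>2)
      \<le> (\<integral>\<^sup>+s. ennreal (indicator {0..t} s * (\<Sum>j\<in>J. \<xi> j \<omega> * indicator {a j<..b j} s)\<^sup>2) \<partial>lborel)"
      unfolding set_lebesgue_integral_def real_scaleR_def by (rule ennreal_integral_le_nn_integral) auto
    also have "\<dots> \<le> (\<integral>\<^sup>+s\<in>{0..T}. ennreal ((\<Sum>j\<in>J. \<xi> j \<omega> * indicator {a j<..b j} s)\<^sup>2) \<partial>lborel)"
      using t by (intro nn_integral_mono) (auto simp: indicator_def)
    finally show "ennreal (LBINT s:{0..t}. (\<Sum>j\<in>J. \<xi> j \<omega> * indicator {a j<..b j} s)\<^sup>2)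
      \<le> (\<integral>\<^sup>+s\<in>{0..T}. ennreal ((\<Sum>j\<in>J. \<xi> j \<omega> * indicator {a j<..b j} s)\<^sup>2) \<partial>lborel)" .
  qed
  finally show ?thesis by (simp add: D_def)
qed

lemma simple_martingale:
  assumes ab: "0 \<le> a" "a \<le> b" "b \<le> T" and st: "0 \<le> s" "s \<le> t" "t \<le> T"
    and \<xi>: "\<xi> \<in> borel_measurable (F a)" "\<And>\<omega>. \<omega> \<in> space M \<Longrightarrow> \<bar>\<xi> \<omega>\<bar> \<le> K"
    and \<eta>: "\<eta> \<in> borel_measurable (F s)" "\<And>\<omega>. \<omega> \<in> space M \<Longrightarrow> \<bar>\<eta> \<omega>\<bar> \<le> L"
  defines "D \<equiv> \<lambda>\<omega>. \<eta> \<omega> * (\<xi> \<omega> * (B (min t b) \<omega> - B (min t a) \<omega>) - \<xi> \<omega> * (B (min s b) \<omega> - B (min s a) \<omega>))"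
  shows "integrable M D" "expectation D = 0"
proof -
  have "integrable M D \<and> expectation D = 0"
  proof (cases "b \<le> s \<or> t \<le> a")
    case True
    then have "min t b = min s b \<and> min t a = min s a \<or> min t b = min t a \<and> min s b = min s a"
      using ab st by (auto simp: min_def)
    then have "D = (\<lambda>\<omega>. 0)" by (auto simp: D_def fun_eq_iff)
    then show ?thesis by simp
  next
    case False
    let ?m = "max a s"
    have eq: "D = (\<lambda>\<omega>. (\<eta> \<omega> * \<xi> \<omega>) * (B (min t b) \<omega> - B ?m \<omega>))"
      using False ab st by (auto simp: D_def fun_eq_iff min_def max_def algebra_simps)
    have m: "(\<lambda>\<omega>. \<eta> \<omega> * \<xi> \<omega>) \<in> borel_measurable (F ?m)"
      using measurable_F_mono[OF \<xi>(1), of ?m] measurable_F_mono[OF \<eta>(1), of ?m] ab st by (intro borel_measurable_times) auto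
    have "integrable M (\<lambda>\<omega>. \<eta> \<omega> * \<xi> \<omega>)"
      by (rule integrable_bounded_F[OF m, where K="L * K"])
         (use ab st \<xi>(2) \<eta>(2) in \<open>auto simp: abs_mult intro!: mult_mono intro: order_trans[OF abs_ge_zero]\<close>)
    from increment_moments(1,2)[OF _ _ _ m this, of "min t b"] show ?thesis
      unfolding eq using False ab st by auto
  qed
  then show "integrable M D" "expectation D = 0" by auto
qed


lemma simple_integrand_interval:
  assumes "simple_integrand F T N \<tau> \<xi>" "i < N"
  shows "0 \<le> \<tau> i" "\<tau> i \<le> \<tau> (Suc i)" "\<tau> (Suc i) \<le> T"
proof -
  have step: "\<And>i. i < N \<Longrightarrow> \<tau> i \<le> \<tau> (Suc i)" and 0: "0 \<le> \<tau> 0" and N: "\<tau> N \<le> T"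
    using assms(1) by (auto simp: simple_integrand_def)
  have "i < N \<Longrightarrow> 0 \<le> \<tau> i" for i
  proof (induction i)
    case (Suc i) then show ?case using step[of i] by auto
  qed (use 0 in simp)
  then show "0 \<le> \<tau> i" using assms by simp
  show "\<tau> i \<le> \<tau> (Suc i)" using step assms by simp
  have "n \<le> N \<Longrightarrow> \<tau> n \<le> \<tau> N" for n
  proof (induction "N - n" arbitrary: n)
    case (Suc m)
    then have "\<tau> (Suc n) \<le> \<tau> N" "n < N" by auto
    then show ?case using step[of n] by simp
  qed simp
  from this[of "Suc i"] show "\<tau> (Suc i) \<le> T" using assms N by simp
qed

lemma simple_integrand_coefficient:
  assumes "simple_integrand F T N \<tau> \<xi>" "i < N"
  shows "\<xi> i \<in> borel_measurable (F (\<tau> i))" "\<exists>K. \<forall>\<omega>\<in>space M. \<bar>\<xi> i \<omega>\<bar> \<le> K" "\<xi> i \<in> borel_measurable M"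
proof -
  note \<tau> = simple_integrand_interval[OF assms]
  have "space (F (\<tau> i)) = space M" using sub_F[of "\<tau> i"] \<tau> by (simp add: subalgebra_def)
  moreover have "\<xi> i \<in> borel_measurable (F (\<tau> i)) \<and> (\<exists>K. \<forall>\<omega>\<in>space (F (\<tau> i)). \<bar>\<xi> i \<omega>\<bar> \<le> K)"
    using assms unfolding simple_integrand_def by blast
  ultimately show "\<xi> i \<in> borel_measurable (F (\<tau> i))" "\<exists>K. \<forall>\<omega>\<in>space M. \<bar>\<xi> i \<omega>\<bar> \<le> K"
    by auto
  show "\<xi> i \<in> borel_measurable M"
    by (rule measurable_F_M[OF \<open>\<xi> i \<in> borel_measurable (F (\<tau> i))\<close>]) (use \<tau> in auto)
qed

lemma measurable_simple_process:
  assumes "simple_integrand F T N \<tau> \<xi>"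
  shows "measurable_process M T (simple_process N \<tau> \<xi>)"
proof -
  have "measurable_process M T (\<lambda>t \<omega>. \<xi> i \<omega> * indicator {\<tau> i<..\<tau> (Suc i)} t)" if "i < N" for i
    using bounded_measurable_on_indicator[of "{\<tau> i<..\<tau> (Suc i)}" 0 T] simple_integrand_coefficient(3)[OF assms that]
    by (intro measurable_process_mult measurable_process_omega measurable_process_time) (auto simp: bounded_measurable_on_def)
  then show ?thesis
    unfolding measurable_process_iff simple_process_def split_beta' by (intro borel_measurable_sum) auto
qed

lemma measurable_simple_integral:
  assumes "simple_integrand F T N \<tau> \<xi>" "t \<in> {0..T}"
  shows "simple_integral B N \<tau> \<xi> t \<in> borel_measurable M"
proof -
  have "B (min t (\<tau> i)) \<in> borel_measurable M" "B (min t (\<tau> (Suc i))) \<in> borel_measurable M" if "i < N" for i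
    using simple_integrand_interval[OF assms(1) that] assms(2) by (auto intro!: B_measurable_M)
  then show ?thesis
    unfolding simple_integral_def[abs_def] using simple_integrand_coefficient(3)[OF assms(1)]
    by (intro borel_measurable_sum borel_measurable_times borel_measurable_diff) auto
qed

text \<open>
  The disjoint union of the two partitions serves as index set; no common refinement is needed.
\<close>

lemma simple_integral_diff_isometry:
  assumes 1: "simple_integrand F T N \<tau> \<xi>" and 2: "simple_integrand F T N' \<tau>' \<xi>'" and t: "t \<in> {0..T}"
  shows "mean_square M (\<lambda>\<omega>. simple_integral B N \<tau> \<xi> t \<omega> - simple_integral B N' \<tau>' \<xi>' t \<omega>)
    \<le> process_mean_square M T (\<lambda>s \<omega>. simple_process N \<tau> \<xi> s \<omega> - simple_process N' \<tau>' \<xi>' s \<omega>)"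
proof -
  define J where "J = {..<N} <+> {..<N'}"
  define a where "a = case_sum \<tau> \<tau>'"
  define b where "b = case_sum (\<lambda>i. \<tau> (Suc i)) (\<lambda>i. \<tau>' (Suc i))"
  define \<zeta> where "\<zeta> = case_sum \<xi> (\<lambda>i \<omega>. - \<xi>' i \<omega>)"
  have "mean_square M (\<lambda>\<omega>. \<Sum>j\<in>J. \<zeta> j \<omega> * (B (min t (b j)) \<omega> - B (min t (a j)) \<omega>))
    \<le> process_mean_square M T (\<lambda>s \<omega>. \<Sum>j\<in>J. \<zeta> j \<omega> * indicator {a j<..b j} s)"
  proof (rule simple_isometry)
    show "finite J" by (simp add: J_def)
    show "0 \<le> a j \<and> a j \<le> b j \<and> b j \<le> T" if "j \<in> J" for j
      using that simple_integrand_interval[OF 1] simple_integrand_interval[OF 2] by (auto simp: J_def a_def b_def)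
    show "\<zeta> j \<in> borel_measurable (F (a j))" if "j \<in> J" for j
      using that simple_integrand_coefficient(1)[OF 1] simple_integrand_coefficient(1)[OF 2] by (auto simp: J_def a_def \<zeta>_def)
    show "\<exists>K. \<forall>\<omega>\<in>space M. \<bar>\<zeta> j \<omega>\<bar> \<le> K" if "j \<in> J" for j
      using that simple_integrand_coefficient(2)[OF 1] simple_integrand_coefficient(2)[OF 2] by (auto simp: J_def \<zeta>_def)
  qed (rule t)
  also have "(\<lambda>\<omega>. \<Sum>j\<in>J. \<zeta> j \<omega> * (B (min t (b j)) \<omega> - B (min t (a j)) \<omega>))
    = (\<lambda>\<omega>. simple_integral B N \<tau> \<xi> t \<omega> - simple_integral B N' \<tau>' \<xi>' t \<omega>)"
    by (simp add: J_def sum.Plus a_def b_def \<zeta>_def simple_integral_def sum_negf)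
  also have "(\<lambda>\<omega> s. \<Sum>j\<in>J. \<zeta> j \<omega> * indicator {a j<..b j} s)
    = (\<lambda>\<omega> s. simple_process N \<tau> \<xi> s \<omega> - simple_process N' \<tau>' \<xi>' s \<omega>)"
    by (simp add: J_def sum.Plus a_def b_def \<zeta>_def simple_process_def sum_negf del: sum_mult_indicator)
  finally show ?thesis .
qed

lemma simple_integral_bound:
  assumes "simple_integrand F T N \<tau> \<xi>" "t \<in> {0..T}"
  shows "mean_square M (\<lambda>\<omega>. simple_integral B N \<tau> \<xi> t \<omega>)
    \<le> process_mean_square M T (\<lambda>s \<omega>. simple_process N \<tau> \<xi> s \<omega>)"
proof -
  have "simple_integrand F T 0 (\<lambda>_. 0) (\<lambda>_ _. 0)" using assms(2) by (simp add: simple_integrand_def)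
  from simple_integral_diff_isometry[OF assms(1) this assms(2)] show ?thesis
    by (simp add: simple_integral_def simple_process_def)
qed

lemma ito_integral_measurable:
  assumes "ito_integral M F B T k I" shows "t \<in> {0..T} \<Longrightarrow> I t \<in> borel_measurable M"
    "measurable_process M T k" "measurable_process M T I" "continuous_process M T I"
  using assms measurable_process_at[of M T I t] unfolding ito_integral_def by blast+

text \<open>
  The bound is the isometry along an approximating sequence, in the weaker form that the inequality
  \<open>(x + y)\<^sup>2 \<le> 2 x\<^sup>2 + 2 y\<^sup>2\<close> gives. It is uniform in time, which makes pathwise estimates
  without a maximal inequality possible.
\<close>

lemma ito_integral_second_moment:
  assumes I: "ito_integral M F B T k I"
  obtains C where "\<And>t. t \<in> {0..T} \<Longrightarrow> mean_square M (I t) \<le> ennreal C"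
proof -
  define Q where "Q = (\<lambda>X. process_mean_square M T X)"
  from I obtain N \<tau> \<xi> where s: "\<And>j. simple_integrand F T (N j) (\<tau> j) (\<xi> j)"
    and lim: "(\<lambda>j. Q (\<lambda>t \<omega>. simple_process (N j) (\<tau> j) (\<xi> j) t \<omega> - k t \<omega>)) \<longlonglongrightarrow> 0"
    and limI: "\<And>t. t \<in> {0..T} \<Longrightarrow> (\<lambda>j. \<integral>\<^sup>+\<omega>. ennreal ((simple_integral B (N j) (\<tau> j) (\<xi> j) t \<omega> - I t \<omega>)\<^sup>2) \<partial>M) \<longlonglongrightarrow> 0"
    unfolding ito_integral_def Q_def by blast
  have fin: "Q k < \<infinity>" using I unfolding ito_integral_def Q_def by blast
  note k = ito_integral_measurable(2)[OF I]
  have "mean_square M (I t) \<le> 4 * Q k" if t: "t \<in> {0..T}" for t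
  proof (rule LIMSEQ_le_const)
    define S where "S = (\<lambda>j. simple_integral B (N j) (\<tau> j) (\<xi> j) t)"
    define s where "s = (\<lambda>j. simple_process (N j) (\<tau> j) (\<xi> j))"
    have Sm: "S j \<in> borel_measurable M" for j using measurable_simple_integral[OF s t] by (simp add: S_def)
    have sm: "measurable_process M T (s j)" for j using measurable_simple_process[OF s] by (simp add: s_def)
    let ?a = "\<lambda>j. \<integral>\<^sup>+\<omega>. ennreal ((S j \<omega> - I t \<omega>)\<^sup>2) \<partial>M"
    let ?b = "\<lambda>j. Q (\<lambda>t \<omega>. s j t \<omega> - k t \<omega>)"
    have "(\<lambda>j. 2 * ?a j + 2 * (2 * ?b j + 2 * Q k)) \<longlonglongrightarrow> 2 * 0 + 2 * (2 * 0 + 2 * Q k)"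
      using lim limI[OF t] unfolding S_def s_def
      by (intro tendsto_add ennreal_tendsto_cmult tendsto_const) auto
    then show "(\<lambda>j. 2 * ?a j + 2 * (2 * ?b j + 2 * Q k)) \<longlonglongrightarrow> 4 * Q k"
      by (simp add: mult.assoc[symmetric])
    have "mean_square M (I t) \<le> 2 * ?a j + 2 * (2 * ?b j + 2 * Q k)" for j
    proof -
      have "mean_square M (I t) = mean_square M (\<lambda>\<omega>. (I t \<omega> - S j \<omega>) + S j \<omega>)" by simp
      also have "\<dots> \<le> 2 * mean_square M (\<lambda>\<omega>. I t \<omega> - S j \<omega>) + 2 * mean_square M (\<lambda>\<omega>. S j \<omega>)"
        using Sm ito_integral_measurable(1)[OF I t] by (intro nn_integral_square_add) auto
      also have "(\<lambda>\<omega>. (I t \<omega> - S j \<omega>)\<^sup>2) = (\<lambda>\<omega>. (S j \<omega> - I t \<omega>)\<^sup>2)" by (simp add: power2_commute)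
      also have "mean_square M (\<lambda>\<omega>. S j \<omega>) \<le> Q (s j)"
        using simple_integral_bound[OF s t] by (simp add: S_def s_def Q_def)
      also have "Q (s j) \<le> 2 * ?b j + 2 * Q k"
        using nn_integral_process_square_add[OF measurable_process_diff[OF sm k] k, of j] by (simp add: Q_def)
      finally show ?thesis by (simp add: add_mono mult_left_mono)
    qed
    then show "\<exists>N. \<forall>j\<ge>N. mean_square M (I t) \<le> 2 * ?a j + 2 * (2 * ?b j + 2 * Q k)" by blast
  qed
  moreover have "4 * Q k = ennreal (enn2real (4 * Q k))" using fin by (simp add: ennreal_mult_less_top)
  ultimately show ?thesis using that[of "enn2real (4 * Q k)"] by metis
qed

text \<open>
  Two versions may come from different approximating sequences. The isometry for the difference of the
  simple integrals shows that they agree almost surely at each time, and continuity of the paths extends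
  this from the rational times to all times at once.
\<close>

lemma ito_integral_unique:
  assumes I: "ito_integral M F B T k I" and I': "ito_integral M F B T k I'" and "T > 0"
  shows "AE \<omega> in M. \<forall>t\<in>{0..T}. I t \<omega> = I' t \<omega>"
proof -
  define Q where "Q = (\<lambda>X. process_mean_square M T X)"
  from I obtain N \<tau> \<xi> where s: "\<And>j. simple_integrand F T (N j) (\<tau> j) (\<xi> j)"
    and lim: "(\<lambda>j. Q (\<lambda>t \<omega>. simple_process (N j) (\<tau> j) (\<xi> j) t \<omega> - k t \<omega>)) \<longlonglongrightarrow> 0"
    and limI: "\<And>t. t \<in> {0..T} \<Longrightarrow> (\<lambda>j. \<integral>\<^sup>+\<omega>. ennreal ((simple_integral B (N j) (\<tau> j) (\<xi> j) t \<omega> - I t \<omega>)\<^sup>2) \<partial>M) \<longlonglongrightarrow> 0"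
    unfolding ito_integral_def Q_def by blast
  from I' obtain N' \<tau>' \<xi>' where s': "\<And>j. simple_integrand F T (N' j) (\<tau>' j) (\<xi>' j)"
    and lim': "(\<lambda>j. Q (\<lambda>t \<omega>. simple_process (N' j) (\<tau>' j) (\<xi>' j) t \<omega> - k t \<omega>)) \<longlonglongrightarrow> 0"
    and limI': "\<And>t. t \<in> {0..T} \<Longrightarrow> (\<lambda>j. \<integral>\<^sup>+\<omega>. ennreal ((simple_integral B (N' j) (\<tau>' j) (\<xi>' j) t \<omega> - I' t \<omega>)\<^sup>2) \<partial>M) \<longlonglongrightarrow> 0"
    unfolding ito_integral_def Q_def by blast
  note k = ito_integral_measurable(2)[OF I]
  have eq: "AE \<omega> in M. I t \<omega> = I' t \<omega>" if t: "t \<in> {0..T}" for t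
  proof -
    define S where "S = (\<lambda>j. simple_integral B (N j) (\<tau> j) (\<xi> j) t)"
    define S' where "S' = (\<lambda>j. simple_integral B (N' j) (\<tau>' j) (\<xi>' j) t)"
    define z where "z = (\<lambda>j. simple_process (N j) (\<tau> j) (\<xi> j))"
    define z' where "z' = (\<lambda>j. simple_process (N' j) (\<tau>' j) (\<xi>' j))"
    note [measurable] = ito_integral_measurable(1)[OF I t] ito_integral_measurable(1)[OF I' t]
    have [measurable]: "S j \<in> borel_measurable M" "S' j \<in> borel_measurable M" for j
      using measurable_simple_integral[OF s t] measurable_simple_integral[OF s' t] by (auto simp: S_def S'_def)
    have zm: "measurable_process M T (z j)" "measurable_process M T (z' j)" for j
      using measurable_simple_process[OF s] measurable_simple_process[OF s'] by (auto simp: z_def z'_def)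
    let ?a = "\<lambda>j. \<integral>\<^sup>+\<omega>. ennreal ((S j \<omega> - I t \<omega>)\<^sup>2) \<partial>M"
    let ?a' = "\<lambda>j. \<integral>\<^sup>+\<omega>. ennreal ((S' j \<omega> - I' t \<omega>)\<^sup>2) \<partial>M"
    let ?b = "\<lambda>j. Q (\<lambda>t \<omega>. z j t \<omega> - k t \<omega>)"
    let ?b' = "\<lambda>j. Q (\<lambda>t \<omega>. z' j t \<omega> - k t \<omega>)"
    let ?r = "\<lambda>j. 2 * ?a j + 2 * (2 * (2 * ?b j + 2 * ?b' j) + 2 * ?a' j)"
    have "?r \<longlonglongrightarrow> 2 * 0 + 2 * (2 * (2 * 0 + 2 * 0) + 2 * 0)"
      using lim limI[OF t] lim' limI'[OF t] unfolding S_def z_def S'_def z'_def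
      by (intro tendsto_add ennreal_tendsto_cmult) auto
    then have r0: "?r \<longlonglongrightarrow> 0" by simp
    have "mean_square M (\<lambda>\<omega>. I t \<omega> - I' t \<omega>) \<le> ?r j" for j
    proof -
      have 1: "mean_square M (\<lambda>\<omega>. I t \<omega> - S j \<omega>) = ?a j" by (simp add: power2_commute)
      have "mean_square M (\<lambda>\<omega>. S j \<omega> - S' j \<omega>) \<le> Q (\<lambda>t \<omega>. z j t \<omega> - z' j t \<omega>)"
        using simple_integral_diff_isometry[OF s s' t] by (simp add: S_def z_def S'_def z'_def Q_def)
      also have "\<dots> = Q (\<lambda>t \<omega>. (z j t \<omega> - k t \<omega>) + (k t \<omega> - z' j t \<omega>))" by simp
      also have "\<dots> \<le> 2 * ?b j + 2 * Q (\<lambda>t \<omega>. k t \<omega> - z' j t \<omega>)"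
        unfolding Q_def by (intro nn_integral_process_square_add measurable_process_diff zm k)
      also have "Q (\<lambda>t \<omega>. k t \<omega> - z' j t \<omega>) = ?b' j" by (simp add: Q_def power2_commute)
      finally have 2: "mean_square M (\<lambda>\<omega>. S j \<omega> - S' j \<omega>) \<le> 2 * ?b j + 2 * ?b' j" .
      have "mean_square M (\<lambda>\<omega>. S j \<omega> - I' t \<omega>) = mean_square M (\<lambda>\<omega>. (S j \<omega> - S' j \<omega>) + (S' j \<omega> - I' t \<omega>))" by simp
      also have "\<dots> \<le> 2 * mean_square M (\<lambda>\<omega>. S j \<omega> - S' j \<omega>) + 2 * ?a' j"
        by (intro nn_integral_square_add) auto
      also have "\<dots> \<le> 2 * (2 * ?b j + 2 * ?b' j) + 2 * ?a' j"
        by (intro add_right_mono mult_left_mono 2) auto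
      finally have 3: "mean_square M (\<lambda>\<omega>. S j \<omega> - I' t \<omega>) \<le> 2 * (2 * ?b j + 2 * ?b' j) + 2 * ?a' j" .
      have "mean_square M (\<lambda>\<omega>. I t \<omega> - I' t \<omega>) = mean_square M (\<lambda>\<omega>. (I t \<omega> - S j \<omega>) + (S j \<omega> - I' t \<omega>))" by simp
      also have "\<dots> \<le> 2 * mean_square M (\<lambda>\<omega>. I t \<omega> - S j \<omega>) + 2 * mean_square M (\<lambda>\<omega>. S j \<omega> - I' t \<omega>)"
        by (intro nn_integral_square_add) auto
      also have "\<dots> \<le> ?r j" unfolding 1 by (intro add_left_mono mult_left_mono 3) auto
      finally show ?thesis .
    qed
    then have "mean_square M (\<lambda>\<omega>. I t \<omega> - I' t \<omega>) \<le> 0"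
      by (intro LIMSEQ_le_const[OF r0]) auto
    then have "AE \<omega> in M. ennreal ((I t \<omega> - I' t \<omega>)\<^sup>2) = 0"
      by (subst nn_integral_0_iff_AE[symmetric]) auto
    then show ?thesis by eventually_elim (simp add: ennreal_eq_0_iff)
  qed
  have "countable (\<rat> \<inter> {0..T})" using countable_rat by (rule countable_Int1)
  then have "AE \<omega> in M. \<forall>q\<in>\<rat> \<inter> {0..T}. I q \<omega> = I' q \<omega>"
    using eq by (subst AE_ball_countable) auto
  moreover have "AE \<omega> in M. continuous_on {0..T} (\<lambda>t. I t \<omega>)" "AE \<omega> in M. continuous_on {0..T} (\<lambda>t. I' t \<omega>)"
    using I I' unfolding ito_integral_def continuous_process_def by auto
  ultimately show ?thesis
  proof eventually_elim
    case (elim \<omega>)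
    show ?case
    proof
      fix t assume t: "t \<in> {0..T}"
      then obtain q where q: "\<And>n. q n \<in> \<rat>" "\<And>n. 0 \<le> q n" "\<And>n. q n < T" "q \<longlonglongrightarrow> t"
        using rational_sequence_below[of t T] \<open>T > 0\<close> by auto
      have *: "(\<lambda>n. f (q n)) \<longlonglongrightarrow> f t" if "continuous_on {0..T} f" for f :: "real \<Rightarrow> real"
        using continuous_on_tendsto_compose[OF that q(4) t] q by (simp add: less_imp_le)
      have "(\<lambda>n. I (q n) \<omega>) = (\<lambda>n. I' (q n) \<omega>)" using elim(1) q by (auto simp: less_imp_le)
      then show "I t \<omega> = I' t \<omega>"
        using LIMSEQ_unique[OF *[OF elim(2)]] *[OF elim(3)] by simp
    qed
  qed
qed

text \<open>
  The square of the expectation is at most the second moment, so mean square approximation by simple integrals,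
  for which \<open>simple_martingale\<close> gives zero, is enough.
\<close>

lemma ito_integral_martingale:
  assumes I: "ito_integral M F B T k I" and st: "0 \<le> s" "s \<le> t" "t \<le> T"
    and \<eta>: "\<eta> \<in> borel_measurable (F s)" "\<And>\<omega>. \<omega> \<in> space M \<Longrightarrow> \<bar>\<eta> \<omega>\<bar> \<le> K"
  shows "expectation (\<lambda>\<omega>. \<eta> \<omega> * (I t \<omega> - I s \<omega>)) = 0"
proof -
  from I obtain N \<tau> \<xi> where si: "\<And>j. simple_integrand F T (N j) (\<tau> j) (\<xi> j)"
    and limI: "\<And>t. t \<in> {0..T} \<Longrightarrow> (\<lambda>j. \<integral>\<^sup>+\<omega>. ennreal ((simple_integral B (N j) (\<tau> j) (\<xi> j) t \<omega> - I t \<omega>)\<^sup>2) \<partial>M) \<longlonglongrightarrow> 0"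
    unfolding ito_integral_def by blast
  define S where "S = (\<lambda>j. simple_integral B (N j) (\<tau> j) (\<xi> j))"
  have t: "t \<in> {0..T}" and s: "s \<in> {0..T}" using st by auto
  note [measurable] = ito_integral_measurable(1)[OF I t] ito_integral_measurable(1)[OF I s]
  have [measurable]: "S j t \<in> borel_measurable M" "S j s \<in> borel_measurable M" for j
    using measurable_simple_integral[OF si t] measurable_simple_integral[OF si s] by (auto simp: S_def)
  have [measurable]: "\<eta> \<in> borel_measurable M" using measurable_F_M[OF \<eta>(1)] st by simp
  define X where "X = (\<lambda>j \<omega>. (I t \<omega> - S j t \<omega>) + (S j s \<omega> - I s \<omega>))"
  have [measurable]: "X j \<in> borel_measurable M" for j unfolding X_def by measurable
  have mart: "integrable M (\<lambda>\<omega>. \<eta> \<omega> * (S j t \<omega> - S j s \<omega>)) \<and> expectation (\<lambda>\<omega>. \<eta> \<omega> * (S j t \<omega> - S j s \<omega>)) = 0" for j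
  proof -
    define D where "D = (\<lambda>i \<omega>. \<eta> \<omega> * (\<xi> j i \<omega> * (B (min t (\<tau> j (Suc i))) \<omega> - B (min t (\<tau> j i)) \<omega>)
      - \<xi> j i \<omega> * (B (min s (\<tau> j (Suc i))) \<omega> - B (min s (\<tau> j i)) \<omega>)))"
    have D: "integrable M (D i)" "expectation (D i) = 0" if "i < N j" for i
    proof -
      have "\<exists>K. \<forall>\<omega>\<in>space M. \<bar>\<xi> j i \<omega>\<bar> \<le> K" by (rule simple_integrand_coefficient(2)[OF si that])
      then obtain L where "\<And>\<omega>. \<omega> \<in> space M \<Longrightarrow> \<bar>\<xi> j i \<omega>\<bar> \<le> L" by blast
      from simple_martingale[OF simple_integrand_interval[OF si that] st simple_integrand_coefficient(1)[OF si that] this \<eta>]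
      show "integrable M (D i)" "expectation (D i) = 0" by (auto simp: D_def)
    qed
    have sum: "(\<lambda>\<omega>. \<eta> \<omega> * (S j t \<omega> - S j s \<omega>)) = (\<lambda>\<omega>. \<Sum>i<N j. D i \<omega>)"
      by (simp add: S_def simple_integral_def D_def sum_distrib_left sum_subtractf right_diff_distrib)
    have "integrable M (\<lambda>\<omega>. \<Sum>i<N j. D i \<omega>)"
      using D(1) by (intro Bochner_Integration.integrable_sum) simp
    moreover have "expectation (\<lambda>\<omega>. \<Sum>i<N j. D i \<omega>) = (\<Sum>i<N j. expectation (D i))"
      using D(1) by (intro Bochner_Integration.integral_sum) simp
    then have "expectation (\<lambda>\<omega>. \<Sum>i<N j. D i \<omega>) = 0" using D(2) by simp
    ultimately show ?thesis unfolding sum by blast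
  qed
  obtain C where C: "\<And>t. t \<in> {0..T} \<Longrightarrow> mean_square M (I t) \<le> ennreal C"
    using ito_integral_second_moment[OF I] by blast
  define c where "c = expectation (\<lambda>\<omega>. \<eta> \<omega> * (I t \<omega> - I s \<omega>))"
  have Ii: "integrable M (I u)" if u: "u \<in> {0..T}" for u
  proof (rule square_integrable_imp_integrable[OF ito_integral_measurable(1)[OF I u]])
    show "integrable M (\<lambda>\<omega>. (I u \<omega>)\<^sup>2)"
      using C[OF u] ito_integral_measurable(1)[OF I u]
      by (intro integrableI_bounded) (auto intro: le_less_trans)
  qed
  have Ie: "integrable M (\<lambda>\<omega>. \<eta> \<omega> * (I t \<omega> - I s \<omega>))"
    by (rule integrable_bounded_mult[OF _ _ \<eta>(2)]) (use Ii t s in auto)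
  have le: "ennreal (c\<^sup>2) \<le> ennreal (K\<^sup>2) * (2 * mean_square M (\<lambda>\<omega>. S j t \<omega> - I t \<omega>) + 2 * mean_square M (\<lambda>\<omega>. S j s \<omega> - I s \<omega>))" for j
  proof -
    have Xe: "(\<lambda>\<omega>. \<eta> \<omega> * X j \<omega>) = (\<lambda>\<omega>. \<eta> \<omega> * (I t \<omega> - I s \<omega>) - \<eta> \<omega> * (S j t \<omega> - S j s \<omega>))"
      by (simp add: X_def algebra_simps)
    have Xi: "integrable M (\<lambda>\<omega>. \<eta> \<omega> * X j \<omega>)" unfolding Xe using Ie mart by auto
    have cX: "c = expectation (\<lambda>\<omega>. \<eta> \<omega> * X j \<omega>)" unfolding Xe c_def using Ie mart[of j] by simp
    have "ennreal (c\<^sup>2) \<le> mean_square M (\<lambda>\<omega>. \<eta> \<omega> * X j \<omega>)"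
    proof (cases "integrable M (\<lambda>\<omega>. (\<eta> \<omega> * X j \<omega>)\<^sup>2)")
      case True
      have "c\<^sup>2 \<le> expectation (\<lambda>\<omega>. (\<eta> \<omega> * X j \<omega>)\<^sup>2)"
        using variance_positive[of "\<lambda>\<omega>. \<eta> \<omega> * X j \<omega>"] variance_eq[OF Xi True] cX by simp
      then show ?thesis using nn_integral_eq_integral[OF True] by (simp add: ennreal_leI)
    next
      case False
      then have "mean_square M (\<lambda>\<omega>. \<eta> \<omega> * X j \<omega>) = \<infinity>"
        by (subst (asm) integrable_iff_bounded) (auto simp: top.not_eq_extremum[symmetric])
      then show ?thesis by simp
    qed
    also have "\<dots> \<le> (\<integral>\<^sup>+\<omega>. ennreal (K\<^sup>2) * ennreal ((X j \<omega>)\<^sup>2) \<partial>M)"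
    proof (rule nn_integral_mono)
      fix \<omega> assume "\<omega> \<in> space M"
      then have "(\<eta> \<omega>)\<^sup>2 \<le> K\<^sup>2" using power_mono[OF \<eta>(2), of \<omega> 2] by simp
      then show "ennreal ((\<eta> \<omega> * X j \<omega>)\<^sup>2) \<le> ennreal (K\<^sup>2) * ennreal ((X j \<omega>)\<^sup>2)"
        by (simp add: power_mult_distrib mult_right_mono ennreal_leI flip: ennreal_mult)
    qed
    also have "\<dots> = ennreal (K\<^sup>2) * mean_square M (\<lambda>\<omega>. X j \<omega>)" by (rule nn_integral_cmult) simp
    also have "mean_square M (\<lambda>\<omega>. X j \<omega>)
      \<le> 2 * mean_square M (\<lambda>\<omega>. I t \<omega> - S j t \<omega>) + 2 * mean_square M (\<lambda>\<omega>. S j s \<omega> - I s \<omega>)"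
      unfolding X_def by (rule nn_integral_square_add) auto
    finally show ?thesis by (simp add: power2_commute[of "I t _"] mult_left_mono)
  qed
  have "(\<lambda>j. ennreal (K\<^sup>2) * (2 * mean_square M (\<lambda>\<omega>. S j t \<omega> - I t \<omega>) + 2 * mean_square M (\<lambda>\<omega>. S j s \<omega> - I s \<omega>)))
    \<longlonglongrightarrow> ennreal (K\<^sup>2) * (2 * 0 + 2 * 0)"
    using limI[OF t] limI[OF s] unfolding S_def by (intro tendsto_add ennreal_tendsto_cmult) auto
  then have "ennreal (c\<^sup>2) \<le> ennreal (K\<^sup>2) * (2 * 0 + 2 * 0)"
    by (rule LIMSEQ_le_const) (use le in auto)
  then show ?thesis by (simp add: c_def ennreal_eq_0_iff)
qed

end

section \<open>Two independent Brownian motions and their joint filtration\<close>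

lemma joint_generated_filtration_sets:
  "sets (generated_filtration M (\<lambda>t \<omega>. (X t \<omega> :: real, Y t \<omega> :: real)) s) \<subseteq>
    sigma_sets (space M) {a \<inter> b |a b. a \<in> sets (generated_filtration M X s) \<and> b \<in> sets (generated_filtration M Y s)}"
    (is "_ \<subseteq> sigma_sets _ ?E")
proof -
  let ?S = "sigma (space M) ?E"
  have E: "?E \<subseteq> Pow (space M)"
    using sets.sets_into_space[of _ "generated_filtration M X s"] by auto
  have S: "sets ?S = sigma_sets (space M) ?E" "space ?S = space M" using E by auto
  have "subalgebra ?S (generated_filtration M X s)" "subalgebra ?S (generated_filtration M Y s)"
  proof -
    have "a \<in> ?E" if "a \<in> sets (generated_filtration M X s)" for a
    proof -
      have "a = a \<inter> space M" using sets.sets_into_space[OF that] by auto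
      moreover have "space M \<in> sets (generated_filtration M Y s)" using sets.top[of "generated_filtration M Y s"] by simp
      ultimately show ?thesis using that by blast
    qed
    then show "subalgebra ?S (generated_filtration M X s)" using S by (auto simp: subalgebra_def)
    have "b \<in> ?E" if "b \<in> sets (generated_filtration M Y s)" for b
    proof -
      have "b = space M \<inter> b" using sets.sets_into_space[OF that] by auto
      moreover have "space M \<in> sets (generated_filtration M X s)" using sets.top[of "generated_filtration M X s"] by simp
      ultimately show ?thesis using that by blast
    qed
    then show "subalgebra ?S (generated_filtration M Y s)" using S by (auto simp: subalgebra_def)
  qed
  then have "X r \<in> borel_measurable ?S" "Y r \<in> borel_measurable ?S" if "r \<in> {0..s}" for r
    using measurable_generated_filtration[OF that, of X M] measurable_generated_filtration[OF that, of Y M]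
    by (auto intro: measurable_mono_subalgebra)
  then have "subalgebra ?S (generated_filtration M (\<lambda>t \<omega>. (X t \<omega>, Y t \<omega>)) s)"
    using S(2) by (intro generated_filtration_least borel_measurable_Pair) auto
  then show ?thesis using S by (simp add: subalgebra_def)
qed

text \<open>
  For \<open>v \<in> V\<close> and pasts \<open>a\<close> of \<open>X\<close> and \<open>b\<close> of \<open>Y\<close>, first \<open>b\<close> splits off, because
  \<open>a \<inter> v\<close> is an event of \<open>X\<close>, and then \<open>v\<close> splits off from \<open>a\<close>. The intersections \<open>a \<inter> b\<close>
  are stable under intersection, and null sets do not matter.
\<close>

lemma (in prob_space) indep_augmented_joint:
  assumes XY: "indep_set (sets (generated_filtration M X T)) (sets (generated_filtration M Y T))"
    and V: "subalgebra (generated_filtration M X T) V" "indep_set (sets (generated_filtration M X s)) (sets V)"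
    and s: "s \<le> T"
    and G: "space (G s) = space M" "sets (G s) \<subseteq> sigma_sets (space M)
      {a \<inter> b |a b. a \<in> sets (generated_filtration M X s) \<and> b \<in> sets (generated_filtration M Y s)}"
  shows "indep_set (sets (augmented M G s)) (sets V)"
proof -
  let ?X = "\<lambda>s. sets (generated_filtration M X s)" and ?Y = "\<lambda>s. sets (generated_filtration M Y s)"
  let ?E = "{a \<inter> b |a b. a \<in> ?X s \<and> b \<in> ?Y s}"
  have mono: "?X s \<subseteq> ?X T" "?Y s \<subseteq> ?Y T"
    using generated_filtration_mono[OF s, of M X] generated_filtration_mono[OF s, of M Y] by (auto simp: subalgebra_def)
  have ev: "?X T \<subseteq> events" "?Y T \<subseteq> events" and ind: "\<And>a b. a \<in> ?X T \<Longrightarrow> b \<in> ?Y T \<Longrightarrow> prob (a \<inter> b) = prob a * prob b"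
    using XY unfolding indep_sets2_eq by auto
  have VX: "sets V \<subseteq> ?X T" "space V = space M" using V(1) by (auto simp: subalgebra_def)
  have indV: "\<And>a v. a \<in> ?X s \<Longrightarrow> v \<in> sets V \<Longrightarrow> prob (a \<inter> v) = prob a * prob v"
    using V(2) unfolding indep_sets2_eq by auto
  have "indep_set (sigma_sets (space M) ?E) (sigma_sets (space M) (sets V))"
  proof (rule indep_set_sigma_sets)
    show "indep_set ?E (sets V)"
      unfolding indep_sets2_eq
    proof (intro conjI ballI)
      show "?E \<subseteq> events" using mono ev by (auto intro!: sets.Int)
      show "sets V \<subseteq> events" using VX ev by auto
      fix e v assume "e \<in> ?E" and v: "v \<in> sets V"
      then obtain a b where ab: "e = a \<inter> b" "a \<in> ?X s" "b \<in> ?Y s" by auto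
      have aT: "a \<in> ?X T" "b \<in> ?Y T" "v \<in> ?X T" using ab mono v VX by auto
      have "prob (e \<inter> v) = prob ((a \<inter> v) \<inter> b)" using ab(1) by (simp add: ac_simps)
      also have "\<dots> = prob (a \<inter> v) * prob b" using aT by (intro ind) auto
      also have "\<dots> = prob (a \<inter> b) * prob v" using indV[OF ab(2) v] ind[OF aT(1,2)] by simp
      finally show "prob (e \<inter> v) = prob e * prob v" using ab(1) by simp
    qed
    show "Int_stable ?E"
    proof (rule Int_stableI)
      fix e e' assume "e \<in> ?E" "e' \<in> ?E"
      then obtain a b a' b' where "e = a \<inter> b" "a \<in> ?X s" "b \<in> ?Y s" "e' = a' \<inter> b'" "a' \<in> ?X s" "b' \<in> ?Y s" by auto
      then have "e \<inter> e' = (a \<inter> a') \<inter> (b \<inter> b')" "a \<inter> a' \<in> ?X s" "b \<inter> b' \<in> ?Y s" by auto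
      then show "e \<inter> e' \<in> ?E" by blast
    qed
    show "Int_stable (sets V)" by (rule sets.Int_stable)
  qed
  then have E: "sigma_sets (space M) ?E \<subseteq> events" "sets V \<subseteq> events"
    "\<And>e v. e \<in> sigma_sets (space M) ?E \<Longrightarrow> v \<in> sets V \<Longrightarrow> prob (e \<inter> v) = prob e * prob v"
    unfolding indep_sets2_eq by (auto simp flip: VX(2) simp: sets.sigma_sets_eq)
  have GM: "subalgebra M (augmented M G s)"
    by (rule augmented_least) (use G E(1) in \<open>auto simp: subalgebra_def null_sets_def\<close>)
  show ?thesis
    unfolding indep_sets2_eq
  proof (intro conjI ballI)
    show "sets (augmented M G s) \<subseteq> events" using GM by (simp add: subalgebra_def)
    show "sets V \<subseteq> events" by fact
    fix c v assume c: "c \<in> sets (augmented M G s)" and v: "v \<in> sets V"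
    obtain c' where c': "c' \<in> sets (G s)" "AE \<omega> in M. \<omega> \<in> c \<longleftrightarrow> \<omega> \<in> c'" using augmented_sets_AE[of G s M, OF G(1) c] by blast
    have cE: "c' \<in> sigma_sets (space M) ?E" using c'(1) G by auto
    have m: "c \<in> events" "c' \<in> events" "v \<in> events" using c GM cE v E by (auto simp: subalgebra_def)
    have "prob (c \<inter> v) = prob (c' \<inter> v)" using c'(2) m by (intro finite_measure_eq_AE) auto
    also have "\<dots> = prob c' * prob v" by (rule E(3)[OF cE v])
    also have "prob c' = prob c" using c'(2) m by (intro finite_measure_eq_AE) auto
    finally show "prob (c \<inter> v) = prob c * prob v" .
  qed
qed

lemma (in prob_space) brownian_motions_in_joint_filtration:
  assumes W: "brownian_motion M T W" and Wb: "brownian_motion M T Wb" and ind: "independent_processes M T W Wb"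
  shows "brownian_in_filtration M T (brownian_filtration M W Wb) W"
    "brownian_in_filtration M T (brownian_filtration M W Wb) Wb"
proof -
  let ?G = "generated_filtration M (\<lambda>t \<omega>. (W t \<omega>, Wb t \<omega>))"
  let ?F = "brownian_filtration M W Wb"
  have F: "?F t = augmented M ?G t" for t by (simp add: brownian_filtration_def)
  have m: "W t \<in> borel_measurable M" "Wb t \<in> borel_measurable M" if "t \<in> {0..T}" for t
    using W Wb that by (auto simp: brownian_motion_def)
  have sub: "subalgebra M (?F t)" if "t \<in> {0..T}" for t
    unfolding F using m that
    by (intro augmented_least generated_filtration_least borel_measurable_Pair) (auto simp: null_sets_def)
  have mono: "subalgebra (?F t) (?F s)" if "s \<le> t" for s t
  proof -
    have "subalgebra (?F t) (?G t)" "null_sets M \<subseteq> sets (?F t)" unfolding F using augmented_contains[of ?G t M] by simp_all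
    then show ?thesis unfolding F[of s] using generated_filtration_mono[OF that, of M "\<lambda>t \<omega>. (W t \<omega>, Wb t \<omega>)"]
      by (intro augmented_least) (auto simp: subalgebra_def)
  qed
  have ad: "W t \<in> borel_measurable (?F t)" "Wb t \<in> borel_measurable (?F t)" if "t \<in> {0..T}" for t
  proof -
    have "t \<in> {0..t}" using that by simp
    from measurable_generated_filtration[OF this, of "\<lambda>t \<omega>. (W t \<omega>, Wb t \<omega>)" M]
    have p: "(\<lambda>\<omega>. (W t \<omega>, Wb t \<omega>)) \<in> borel_measurable (?G t)" .
    have "W t \<in> borel_measurable (?G t)" "Wb t \<in> borel_measurable (?G t)"
      using measurable_compose[OF p, of fst borel] measurable_compose[OF p, of snd borel] by (simp_all add: borel_prod[symmetric])
    then show "W t \<in> borel_measurable (?F t)" "Wb t \<in> borel_measurable (?F t)"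
      unfolding F using augmented_contains(1)[of ?G t M] by (auto intro: measurable_mono_subalgebra)
  qed
  have indep: "indep_set (sets (?F s)) (sets (vimage_algebra (space M) (\<lambda>\<omega>. X t \<omega> - X s \<omega>) borel))"
    if st: "0 \<le> s" "s < t" "t \<le> T" and X: "brownian_motion M T X"
      and XY: "indep_set (sets (generated_filtration M X T)) (sets (generated_filtration M Y T))"
      and G: "sets (?G s) \<subseteq> sigma_sets (space M)
        {a \<inter> b |a b. a \<in> sets (generated_filtration M X s) \<and> b \<in> sets (generated_filtration M Y s)}"
    for X Y :: "real \<Rightarrow> 'a \<Rightarrow> real" and s t
    unfolding F
  proof (rule indep_augmented_joint[OF XY])
    let ?V = "vimage_algebra (space M) (\<lambda>\<omega>. X t \<omega> - X s \<omega>) borel"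
    have "(\<lambda>\<omega>. X t \<omega> - X s \<omega>) \<in> borel_measurable (generated_filtration M X T)"
      using st by (intro borel_measurable_diff measurable_generated_filtration) auto
    then show "subalgebra (generated_filtration M X T) ?V"
      by (auto simp: subalgebra_def sets_vimage_algebra2 dest: measurable_sets)
    show "indep_set (sets (generated_filtration M X s)) (sets ?V)"
      using X st by (auto simp: brownian_motion_def)
  qed (use st G in auto)
  note i1 = ind[unfolded independent_processes_def]
  have i2: "indep_set (sets (generated_filtration M Wb T)) (sets (generated_filtration M W T))"
    using i1 unfolding indep_sets2_eq by (metis Int_commute mult.commute)
  have comm: "{a \<inter> b |a b. a \<in> A \<and> b \<in> B} = {b \<inter> a |b a. b \<in> B \<and> a \<in> A}" for A B :: "'a set set" by blast
  show "brownian_in_filtration M T ?F W"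
  proof unfold_locales
    show "distributed M lborel (\<lambda>\<omega>. W t \<omega> - W s \<omega>) (\<lambda>y. ennreal (normal_density 0 (sqrt (t - s)) y))"
      if "0 \<le> s" "s < t" "t \<le> T" for s t using W that by (auto simp: brownian_motion_def)
    show "indep_set (sets (?F s)) (sets (vimage_algebra (space M) (\<lambda>\<omega>. W t \<omega> - W s \<omega>) borel))"
      if "0 \<le> s" "s < t" "t \<le> T" for s t
      by (rule indep[OF that W i1 joint_generated_filtration_sets])
  qed (use sub mono ad in auto)
  show "brownian_in_filtration M T ?F Wb"
  proof unfold_locales
    show "distributed M lborel (\<lambda>\<omega>. Wb t \<omega> - Wb s \<omega>) (\<lambda>y. ennreal (normal_density 0 (sqrt (t - s)) y))"
      if "0 \<le> s" "s < t" "t \<le> T" for s t using Wb that by (auto simp: brownian_motion_def)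
    show "indep_set (sets (?F s)) (sets (vimage_algebra (space M) (\<lambda>\<omega>. Wb t \<omega> - Wb s \<omega>) borel))"
      if "0 \<le> s" "s < t" "t \<le> T" for s t
      by (rule indep[OF that Wb i2, unfolded comm[of "sets (generated_filtration M Wb _)"], OF joint_generated_filtration_sets])
  qed (use sub mono ad in auto)
qed

section \<open>Linear stochastic differential equations\<close>

context prob_space begin

text \<open>
  A bound on second moments that is uniform in time is preserved by all operations below, and it makes
  processes such as \<open>E[1\<^bsub>C\<^esub> p(t)]\<close> bounded functions of time.
\<close>

definition L2_bounded :: "real \<Rightarrow> (real \<Rightarrow> 'a \<Rightarrow> real) \<Rightarrow> bool"
  where "L2_bounded T X \<longleftrightarrow> measurable_process M T X \<and>
    (\<exists>C. \<forall>t\<in>{0..T}. mean_square M (X t) \<le> ennreal C)"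

lemma L2_bounded_measurable: "L2_bounded T X \<Longrightarrow> measurable_process M T X"
  by (simp add: L2_bounded_def)

lemma L2_boundedE:
  assumes "L2_bounded T X"
  obtains C where "\<And>t. t \<in> {0..T} \<Longrightarrow> mean_square M (X t) \<le> ennreal C"
  using assms unfolding L2_bounded_def by blast

lemma L2_bounded_square_integrable:
  assumes "L2_bounded T X" "t \<in> {0..T}"
  shows "integrable M (\<lambda>\<omega>. (X t \<omega>)\<^sup>2)" "integrable M (X t)" "X t \<in> borel_measurable M"
proof -
  obtain C where "mean_square M (X t) \<le> ennreal C"
    using L2_boundedE[OF assms(1)] assms(2) by blast
  moreover show m: "X t \<in> borel_measurable M" using measurable_process_at[OF L2_bounded_measurable[OF assms(1)] assms(2)] .
  ultimately show i: "integrable M (\<lambda>\<omega>. (X t \<omega>)\<^sup>2)"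
    by (intro integrableI_bounded) (auto intro: le_less_trans)
  show "integrable M (X t)" by (rule square_integrable_imp_integrable[OF m i])
qed

lemma L2_bounded_integrable_process:
  assumes "L2_bounded T X"
  shows "integrable_process M T (\<lambda>t \<omega>. (X t \<omega>)\<^sup>2)" "integrable_process M T X"
proof -
  obtain C where C: "\<And>t. t \<in> {0..T} \<Longrightarrow> mean_square M (X t) \<le> ennreal C" using assms(1) by (rule L2_boundedE) blast
  show i: "integrable_process M T (\<lambda>t \<omega>. (X t \<omega>)\<^sup>2)"
    by (rule integrable_processI_time[where C=C]) (use C in \<open>auto intro: measurable_process_power2 L2_bounded_measurable assms\<close>)
  show "integrable_process M T X" by (rule integrable_process_if_square[OF L2_bounded_measurable[OF assms] i])
qed

lemma L2_bounded_add:
  assumes "L2_bounded T X" "L2_bounded T Y"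
  shows "L2_bounded T (\<lambda>t \<omega>. X t \<omega> + Y t \<omega>)"
proof -
  obtain C where C: "\<And>t. t \<in> {0..T} \<Longrightarrow> mean_square M (X t) \<le> ennreal C" using assms(1) by (rule L2_boundedE) blast
  obtain D where D: "\<And>t. t \<in> {0..T} \<Longrightarrow> mean_square M (\<lambda>\<omega>. Y t \<omega>) \<le> ennreal D" using assms(2) by (rule L2_boundedE) blast
  have "mean_square M (\<lambda>\<omega>. X t \<omega> + Y t \<omega>) \<le> ennreal (2 * \<bar>C\<bar> + 2 * \<bar>D\<bar>)" if t: "t \<in> {0..T}" for t
  proof -
    have "mean_square M (\<lambda>\<omega>. X t \<omega> + Y t \<omega>) \<le> 2 * mean_square M (X t) + 2 * mean_square M (\<lambda>\<omega>. Y t \<omega>)"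
      using L2_bounded_square_integrable(3)[OF assms(1) t] L2_bounded_square_integrable(3)[OF assms(2) t] by (rule nn_integral_square_add)
    also have "\<dots> \<le> 2 * ennreal \<bar>C\<bar> + 2 * ennreal \<bar>D\<bar>"
      by (intro add_mono mult_left_mono order_trans[OF C[OF t]] order_trans[OF D[OF t]] ennreal_leI abs_ge_self) auto
    also have "\<dots> = ennreal (2 * \<bar>C\<bar> + 2 * \<bar>D\<bar>)" by (simp add: ennreal_mult ennreal_plus)
    finally show ?thesis .
  qed
  then show ?thesis
    using assms unfolding L2_bounded_def by (blast intro: measurable_process_add)
qed

lemma L2_bounded_bound:
  assumes "L2_bounded T X" "measurable_process M T Y"
    "\<And>t. t \<in> {0..T} \<Longrightarrow> AE \<omega> in M. \<bar>Y t \<omega>\<bar> \<le> K * \<bar>X t \<omega>\<bar>"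
  shows "L2_bounded T Y"
proof -
  obtain C where C: "\<And>t. t \<in> {0..T} \<Longrightarrow> mean_square M (X t) \<le> ennreal C" using assms(1) by (rule L2_boundedE) blast
  have "mean_square M (\<lambda>\<omega>. Y t \<omega>) \<le> ennreal (K\<^sup>2 * \<bar>C\<bar>)" if t: "t \<in> {0..T}" for t
  proof -
    note [measurable] = L2_bounded_square_integrable(3)[OF assms(1) t]
    have "mean_square M (\<lambda>\<omega>. Y t \<omega>) \<le> (\<integral>\<^sup>+\<omega>. ennreal (K\<^sup>2) * ennreal ((X t \<omega>)\<^sup>2) \<partial>M)"
    proof (rule nn_integral_mono_AE, use assms(3)[OF t] in eventually_elim)
      case (elim \<omega>)
      then have "\<bar>Y t \<omega>\<bar>\<^sup>2 \<le> (K * \<bar>X t \<omega>\<bar>)\<^sup>2" by (intro power_mono) auto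
      then show ?case by (simp add: power_mult_distrib ennreal_leI flip: ennreal_mult)
    qed
    also have "\<dots> = ennreal (K\<^sup>2) * mean_square M (X t)" by (rule nn_integral_cmult) simp
    also have "\<dots> \<le> ennreal (K\<^sup>2) * ennreal \<bar>C\<bar>"
      by (intro mult_left_mono order_trans[OF C[OF t]] ennreal_leI abs_ge_self) auto
    also have "\<dots> = ennreal (K\<^sup>2 * \<bar>C\<bar>)" by (simp add: ennreal_mult)
    finally show ?thesis .
  qed
  then show ?thesis using assms(2) unfolding L2_bounded_def by blast
qed

lemma L2_bounded_coeff:
  assumes "L2_bounded T X" "bounded_measurable_on 0 T f"
  shows "L2_bounded T (\<lambda>t \<omega>. f t * X t \<omega>)"
proof -
  obtain K where K: "K > 0" "\<And>t. t \<in> {0..T} \<Longrightarrow> \<bar>f t\<bar> \<le> K" using assms(2) by (rule bounded_measurable_onE) blast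
  show ?thesis
  proof (rule L2_bounded_bound[OF assms(1), of _ K])
    show "measurable_process M T (\<lambda>t \<omega>. f t * X t \<omega>)"
      using assms(2) by (intro measurable_process_mult measurable_process_time L2_bounded_measurable[OF assms(1)])
        (simp add: bounded_measurable_on_def)
    show "AE \<omega> in M. \<bar>f t * X t \<omega>\<bar> \<le> K * \<bar>X t \<omega>\<bar>" if "t \<in> {0..T}" for t
      unfolding abs_mult by (intro AE_I2 mult_right_mono K(2) that abs_ge_zero)
  qed
qed

lemma L2_bounded_time:
  assumes "bounded_measurable_on 0 T f"
  shows "L2_bounded T (\<lambda>t \<omega>. f t)"
proof -
  have "L2_bounded T (\<lambda>t \<omega>. 1)"
    unfolding L2_bounded_def using measurable_process_omega[of "\<lambda>_. 1" M T] emeasure_space_1 by (auto intro!: exI[of _ 1])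
  from L2_bounded_coeff[OF this assms] show ?thesis by simp
qed

lemma L2_bounded_if_sup_square_integrable:
  assumes "measurable_process M T X" "sup_square_integrable M T X"
  shows "L2_bounded T X"
proof -
  let ?S = "\<integral>\<^sup>+\<omega>. (SUP t\<in>{0..T}. ennreal ((X t \<omega>)\<^sup>2)) \<partial>M"
  have "mean_square M (X t) \<le> ennreal (enn2real ?S)" if "t \<in> {0..T}" for t
  proof -
    have "mean_square M (X t) \<le> ?S" using that by (intro nn_integral_mono SUP_upper)
    also have "?S = ennreal (enn2real ?S)" using assms(2) by (simp add: sup_square_integrable_def)
    finally show ?thesis .
  qed
  then show ?thesis using assms(1) unfolding L2_bounded_def by blast
qed

text \<open>
  The variance of \<open>f\<close> under the uniform distribution on \<open>[0,T]\<close> is nonnegative.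
\<close>

lemma set_integral_square_le:
  fixes f :: "real \<Rightarrow> real"
  assumes "set_integrable lborel {0..T} f" "set_integrable lborel {0..T} (\<lambda>s. (f s)\<^sup>2)" "T > 0"
  shows "(LBINT s:{0..T}. f s)\<^sup>2 \<le> T * (LBINT s:{0..T}. (f s)\<^sup>2)"
proof -
  define m where "m = (LBINT s:{0..T}. f s)"
  have c: "set_integrable lborel {0..T} (\<lambda>s. c)" for c :: real
    by (rule bounded_measurable_on_integrable[OF bounded_measurable_on_const])
  have "0 \<le> (LBINT s:{0..T}. (f s - m / T)\<^sup>2)"
    unfolding set_lebesgue_integral_def by (rule integral_nonneg_AE) simp
  also have "\<dots> = (LBINT s:{0..T}. (f s)\<^sup>2 - (2 * m / T) * f s + (m / T)\<^sup>2)"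
  proof -
    have "(f s - m / T)\<^sup>2 = (f s)\<^sup>2 - (2 * m / T) * f s + (m / T)\<^sup>2" for s
      by (simp add: power2_diff)
    then show ?thesis by simp
  qed
  also have "\<dots> = (LBINT s:{0..T}. (f s)\<^sup>2) - (2 * m / T) * m + (LBINT s:{0..T}. (m / T)\<^sup>2)"
  proof -
    have i: "set_integrable lborel {0..T} (\<lambda>s. (2 * m / T) * f s)" using assms(1) by (rule set_integrable_mult_right)
    have "(LBINT s:{0..T}. (f s)\<^sup>2 - (2 * m / T) * f s + (m / T)\<^sup>2)
      = (LBINT s:{0..T}. (f s)\<^sup>2 - (2 * m / T) * f s) + (LBINT s:{0..T}. (m / T)\<^sup>2)"
      by (rule set_integral_add(2)[OF set_integral_diff(1)[OF assms(2) i] c])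
    then show ?thesis unfolding set_integral_diff(2)[OF assms(2) i] set_integral_mult_right by (simp add: m_def)
  qed
  also have "(LBINT s:{0..T}. (m / T)\<^sup>2) = T * (m / T)\<^sup>2"
    using assms(3) by (simp add: set_lebesgue_integral_def)
  finally have "0 \<le> (LBINT s:{0..T}. (f s)\<^sup>2) - m\<^sup>2 / T"
    using assms(3) by (simp add: power2_eq_square)
  then have "m\<^sup>2 / T \<le> (LBINT s:{0..T}. (f s)\<^sup>2)" by simp
  then have "m\<^sup>2 \<le> T * (LBINT s:{0..T}. (f s)\<^sup>2)" using assms(3) by (simp add: pos_divide_le_eq mult.commute)
  then show ?thesis by (simp add: m_def)
qed

text \<open>
  The square of the integral is at most \<open>T\<close> times the integral of the square, whose expectation is finite by
  Fubini's theorem.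
\<close>

lemma L2_bounded_integral_operator:
  assumes X: "L2_bounded T X" and Y: "measurable_process M T Y" and "T > 0"
    and le: "AE \<omega> in M. \<forall>t\<in>{0..T}. \<bar>Y t \<omega>\<bar> \<le> K * (LBINT s:{0..T}. \<bar>X s \<omega>\<bar>)"
  shows "L2_bounded T Y"
proof -
  note iX = L2_bounded_integrable_process[OF X]
  define C where "C = K\<^sup>2 * (T * expectation (\<lambda>\<omega>. LBINT s:{0..T}. (X s \<omega>)\<^sup>2))"
  have "mean_square M (\<lambda>\<omega>. Y t \<omega>) \<le> ennreal C" if t: "t \<in> {0..T}" for t
  proof -
    let ?Z = "\<lambda>\<omega>. K\<^sup>2 * (T * (LBINT s:{0..T}. (X s \<omega>)\<^sup>2))"
    have Z: "integrable M ?Z" using integrable_process_paths(2)[OF iX(1)] by simp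
    have "AE \<omega> in M. (Y t \<omega>)\<^sup>2 \<le> ?Z \<omega>"
      using le integrable_process_paths(1)[OF iX(1)] integrable_process_paths(1)[OF iX(2)]
    proof eventually_elim
      case (elim \<omega>)
      have "\<bar>Y t \<omega>\<bar>\<^sup>2 \<le> (K * (LBINT s:{0..T}. \<bar>X s \<omega>\<bar>))\<^sup>2" using elim(1) t by (intro power_mono) auto
      also have "\<dots> = K\<^sup>2 * (LBINT s:{0..T}. \<bar>X s \<omega>\<bar>)\<^sup>2" by (simp add: power_mult_distrib)
      also have "\<dots> \<le> ?Z \<omega>"
        using set_integral_square_le[of T "\<lambda>s. \<bar>X s \<omega>\<bar>"] elim(2) set_integrable_abs[OF elim(3)] \<open>T > 0\<close>
        by (intro mult_left_mono) auto
      finally show ?case by simp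
    qed
    then have "mean_square M (\<lambda>\<omega>. Y t \<omega>) \<le> (\<integral>\<^sup>+\<omega>. ennreal (?Z \<omega>) \<partial>M)"
      by (intro nn_integral_mono_AE, eventually_elim) (rule ennreal_leI)
    also have "\<dots> = ennreal C"
    proof (subst nn_integral_eq_integral[OF Z])
      have "0 \<le> (LBINT s:{0..T}. (X s \<omega>)\<^sup>2)" for \<omega>
        unfolding set_lebesgue_integral_def by (rule integral_nonneg_AE) simp
      then show "AE \<omega> in M. 0 \<le> ?Z \<omega>" using \<open>T > 0\<close> by simp
    qed (simp add: C_def)
    finally show ?thesis .
  qed
  then show ?thesis using Y unfolding L2_bounded_def by blast
qed

lemma L2_bounded_indefinite_integral:
  assumes X: "L2_bounded T X" and "T > 0"
  shows "L2_bounded T (\<lambda>t \<omega>. LBINT s:{0..t}. X s \<omega>)"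
proof (rule L2_bounded_integral_operator[OF X _ \<open>T > 0\<close>, of _ 1])
  show "measurable_process M T (\<lambda>t \<omega>. LBINT s:{0..t}. X s \<omega>)"
    by (rule measurable_process_integral[OF L2_bounded_measurable[OF X]])
  show "AE \<omega> in M. \<forall>t\<in>{0..T}. \<bar>LBINT s:{0..t}. X s \<omega>\<bar> \<le> 1 * (LBINT s:{0..T}. \<bar>X s \<omega>\<bar>)"
    using integrable_process_paths(1)[OF L2_bounded_integrable_process(2)[OF X]]
  proof eventually_elim
    case (elim \<omega>)
    have "\<bar>LBINT s:{0..t}. X s \<omega>\<bar> \<le> (LBINT s:{0..T}. \<bar>X s \<omega>\<bar>)" if "t \<in> {0..T}" for t
    proof -
      have "set_integrable lborel {0..t} (\<lambda>s. X s \<omega>)" by (rule set_integrable_subset[OF elim]) (use that in auto)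
      then have "\<bar>LBINT s:{0..t}. X s \<omega>\<bar> \<le> (LBINT s:{0..t}. \<bar>X s \<omega>\<bar>)" using set_integral_norm_bound by fastforce
      also have "\<dots> \<le> (LBINT s:{0..T}. \<bar>X s \<omega>\<bar>)"
        unfolding set_lebesgue_integral_def
        using set_integrable_abs[OF elim] set_integrable_abs[OF \<open>set_integrable lborel {0..t} (\<lambda>s. X s \<omega>)\<close>] that
        by (intro integral_mono) (auto simp: set_integrable_def indicator_def)
      finally show ?thesis .
    qed
    then show ?case by simp
  qed
qed

text \<open>
  Measurability in time is part of Fubini's theorem, and \<open>\<bar>X\<bar> \<le> 1 + X\<^sup>2\<close> gives the bound.
\<close>

lemma L2_bounded_expectation:
  assumes X: "L2_bounded T X" and Z: "Z \<in> borel_measurable M" "\<And>\<omega>. \<bar>Z \<omega>\<bar> \<le> K"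
  shows "bounded_measurable_on 0 T (\<lambda>t. expectation (\<lambda>\<omega>. Z \<omega> * X t \<omega>))"
proof -
  obtain C where C: "\<And>t. t \<in> {0..T} \<Longrightarrow> mean_square M (X t) \<le> ennreal C" using X by (rule L2_boundedE) blast
  have "set_integrable lborel {0..T} (\<lambda>t. expectation (\<lambda>\<omega>. Z \<omega> * X t \<omega>))"
    by (rule integrable_process_paths(4)[OF integrable_process_omega_bounded[OF L2_bounded_integrable_process(2)[OF X] Z]])
  then have "set_borel_measurable borel {0..T} (\<lambda>t. expectation (\<lambda>\<omega>. Z \<omega> * X t \<omega>))"
    by (auto simp: set_integrable_def set_borel_measurable_def)
  moreover have "\<bar>expectation (\<lambda>\<omega>. Z \<omega> * X t \<omega>)\<bar> \<le> K * (1 + \<bar>C\<bar>)" if t: "t \<in> {0..T}" for t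
  proof -
    note i = L2_bounded_square_integrable[OF X t]
    have K: "0 \<le> K" using Z(2)[of undefined] by linarith
    have "ennreal (expectation (\<lambda>\<omega>. (X t \<omega>)\<^sup>2)) \<le> ennreal \<bar>C\<bar>"
      using nn_integral_eq_integral[OF i(1)] order_trans[OF C[OF t] ennreal_leI[OF abs_ge_self]] by simp
    then have sq: "expectation (\<lambda>\<omega>. (X t \<omega>)\<^sup>2) \<le> \<bar>C\<bar>" by simp
    have "\<bar>expectation (\<lambda>\<omega>. Z \<omega> * X t \<omega>)\<bar> \<le> expectation (\<lambda>\<omega>. \<bar>Z \<omega> * X t \<omega>\<bar>)" by (rule integral_abs_bound)
    also have "\<dots> \<le> expectation (\<lambda>\<omega>. K * (1 + (X t \<omega>)\<^sup>2))"
    proof (rule integral_mono)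
      show "integrable M (\<lambda>\<omega>. \<bar>Z \<omega> * X t \<omega>\<bar>)" using integrable_bounded_mult[OF i(2) Z(1)] Z(2) by (intro integrable_abs) auto
      show "integrable M (\<lambda>\<omega>. K * (1 + (X t \<omega>)\<^sup>2))" using i(1) by simp
      fix \<omega>
      have "2 * \<bar>X t \<omega>\<bar> \<le> 1 + (X t \<omega>)\<^sup>2" using sum_squares_bound[of 1 "\<bar>X t \<omega>\<bar>"] by simp
      then have "\<bar>X t \<omega>\<bar> \<le> 1 + (X t \<omega>)\<^sup>2" by linarith
      then show "\<bar>Z \<omega> * X t \<omega>\<bar> \<le> K * (1 + (X t \<omega>)\<^sup>2)" unfolding abs_mult using Z(2) K by (intro mult_mono) auto
    qed
    also have "\<dots> = K * (1 + expectation (\<lambda>\<omega>. (X t \<omega>)\<^sup>2))" using i(1) by (simp add: prob_space)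
    also have "\<dots> \<le> K * (1 + \<bar>C\<bar>)" using sq K by (intro mult_left_mono) auto
    finally show ?thesis .
  qed
  ultimately show ?thesis unfolding bounded_measurable_on_def by blast
qed

end

locale two_brownian_motions = prob_space M + complete_measure M for M :: "'a measure" +
  fixes T :: real and W Wb :: "real \<Rightarrow> 'a \<Rightarrow> real"
  assumes T: "T > 0"
    and W: "brownian_motion M T W" and Wb: "brownian_motion M T Wb"
    and independent: "independent_processes M T W Wb"
begin

abbreviation noise_filtration :: "real \<Rightarrow> 'a measure"
  where "noise_filtration \<equiv> brownian_filtration M W Wb"

sublocale W: brownian_in_filtration M T noise_filtration W
  by (rule brownian_motions_in_joint_filtration(1)[OF W Wb independent])

sublocale Wb: brownian_in_filtration M T noise_filtration Wb
  by (rule brownian_motions_in_joint_filtration(2)[OF W Wb independent])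

lemma complete: "complete_measure M" by (rule complete_measure_axioms)

lemma null_sets_noise_filtration: "null_sets M \<subseteq> sets (noise_filtration t)"
  unfolding brownian_filtration_def
  using augmented_contains(2)[of "generated_filtration M (\<lambda>t \<omega>. (W t \<omega>, Wb t \<omega>))" t M] by simp

lemma ito_integral_L2_bounded:
  assumes "ito_integral M noise_filtration W T k I \<or> ito_integral M noise_filtration Wb T k I"
  shows "L2_bounded T I"
proof -
  have "measurable_process M T I" using assms unfolding ito_integral_def by auto
  moreover have "\<exists>C. \<forall>t\<in>{0..T}. (\<integral>\<^sup>+\<omega>. ennreal ((I t \<omega>)\<^sup>2) \<partial>M) \<le> ennreal C"
    using assms
  proof
    assume "ito_integral M noise_filtration W T k I"
    then show ?thesis by (rule W.ito_integral_second_moment) blast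
  next
    assume "ito_integral M noise_filtration Wb T k I"
    then show ?thesis by (rule Wb.ito_integral_second_moment) blast
  qed
  ultimately show ?thesis unfolding L2_bounded_def by blast
qed

text \<open>
  The Volterra formula expresses \<open>x\<close> by \<open>Y = x\<^sub>0 + \<integral> b dt + I + I\<^sub>b\<close>, the part of the equation
  that does not contain the state, and the moments of \<open>Y\<close> are known. This replaces Gronwall's lemma
  and any estimate of the supremum of the stochastic integrals.
\<close>

lemma sde_L2_bounded:
  assumes x: "solves_linear_sde M W Wb T a b c cb x0 x" and a: "bounded_measurable_on 0 T a" and b: "L2_bounded T b"
  shows "L2_bounded T x"
proof -
  from x obtain I Ib where I: "ito_integral M noise_filtration W T (\<lambda>t \<omega>. c t) I"
    and Ib: "ito_integral M noise_filtration Wb T (\<lambda>t \<omega>. cb t) Ib"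
    and eq: "AE \<omega> in M. \<forall>t\<in>{0..T}. x t \<omega> = x0 + (LBINT s:{0..t}. a s * x s \<omega> + b s \<omega>) + I t \<omega> + Ib t \<omega>"
    unfolding solves_linear_sde_def by blast
  have mx: "measurable_process M T x" and cx: "continuous_process M T x" using x unfolding solves_linear_sde_def by auto
  have cI: "continuous_process M T I" "continuous_process M T Ib" using I Ib unfolding ito_integral_def by auto
  define Y where "Y = (\<lambda>t \<omega>. x0 + (LBINT s:{0..t}. b s \<omega>) + I t \<omega> + Ib t \<omega>)"
  have Y: "L2_bounded T Y"
    unfolding Y_def by (intro L2_bounded_add L2_bounded_time bounded_measurable_on_const L2_bounded_indefinite_integral b T ito_integral_L2_bounded)
      (use I Ib in auto)
  define E where "E = (\<lambda>t. LBINT r:{0..t}. a r)"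
  have bE: "continuous_on {0..T} E"
    unfolding E_def by (rule continuous_on_set_integral_Icc[OF bounded_measurable_on_integrable[OF a]])
  have ex: "bounded_measurable_on 0 T (\<lambda>t. exp (E t))" "bounded_measurable_on 0 T (\<lambda>t. exp (- E t) * a t)"
    by (intro bounded_measurable_on_mult a bounded_measurable_on_continuous continuous_intros bE)+
  obtain K1 where K1: "K1 > 0" "\<And>t. t \<in> {0..T} \<Longrightarrow> \<bar>exp (E t)\<bar> \<le> K1" using ex(1) by (rule bounded_measurable_onE) blast
  obtain K2 where K2: "K2 > 0" "\<And>t. t \<in> {0..T} \<Longrightarrow> \<bar>exp (- E t) * a t\<bar> \<le> K2" using ex(2) by (rule bounded_measurable_onE) blast
  have res: "\<bar>resolvent a t s\<bar> \<le> K1 * K2" if "t \<in> {0..T}" "s \<in> {0..T}" for s t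
  proof -
    have "resolvent a t s = exp (E t) * (exp (- E s) * a s)" by (simp add: resolvent_def E_def)
    then show ?thesis using K1(2)[OF that(1)] K2(2)[OF that(2)] K1(1) by (simp add: abs_mult[of "exp (E t)"] mult_mono)
  qed
  have "AE \<omega> in M. \<forall>t\<in>{0..T}. \<bar>x t \<omega> - Y t \<omega>\<bar> \<le> (K1 * K2) * (LBINT s:{0..T}. \<bar>Y s \<omega>\<bar>)"
    using eq cx[unfolded continuous_process_def] cI[unfolded continuous_process_def]
      integrable_process_paths(1)[OF L2_bounded_integrable_process(2)[OF b]]
  proof eventually_elim
    case (elim \<omega>)
    have cY: "continuous_on {0..T} (\<lambda>t. Y t \<omega>)"
      unfolding Y_def using elim(3,4) continuous_on_set_integral_Icc[OF elim(5)] by (intro continuous_intros)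
    have ax: "set_integrable lborel {0..T} (\<lambda>s. a s * x s \<omega>)"
      by (intro bounded_measurable_on_integrable bounded_measurable_on_mult a bounded_measurable_on_continuous elim)
    have aY: "set_integrable lborel {0..T} (\<lambda>s. Y s \<omega>)"
      by (intro bounded_measurable_on_integrable bounded_measurable_on_continuous cY)
    have "x t \<omega> = Y t \<omega> + (LBINT s:{0..t}. a s * x s \<omega>)" if "t \<in> {0..T}" for t
    proof -
      have "(LBINT s:{0..t}. a s * x s \<omega> + b s \<omega>) = (LBINT s:{0..t}. a s * x s \<omega>) + (LBINT s:{0..t}. b s \<omega>)"
        by (rule set_integral_add(2)[OF set_integrable_subset[OF ax] set_integrable_subset[OF elim(5)]]) (use that in auto)
      then show ?thesis using elim(1) that by (simp add: Y_def)
    qed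
    from volterra_solution[OF a bounded_measurable_on_continuous[OF elim(2)] bounded_measurable_on_continuous[OF cY] this]
    have sol: "x t \<omega> - Y t \<omega> = (LBINT s:{0..t}. resolvent a t s * Y s \<omega>)" if "t \<in> {0..T}" for t using that by simp
    have "\<bar>LBINT s:{0..t}. resolvent a t s * Y s \<omega>\<bar> \<le> (K1 * K2) * (LBINT s:{0..T}. \<bar>Y s \<omega>\<bar>)" if t: "t \<in> {0..T}" for t
    proof -
      have "bounded_measurable_on 0 T (\<lambda>s. resolvent a t s * Y s \<omega>)"
        using bounded_measurable_on_mult[OF bounded_measurable_on_mult[OF bounded_measurable_on_const[of _ _ "exp (E t)"] ex(2)]
            bounded_measurable_on_continuous[OF cY]]
        by (simp add: resolvent_def E_def mult.assoc)
      then have i: "set_integrable lborel {0..t} (\<lambda>s. resolvent a t s * Y s \<omega>)"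
        using t by (intro set_integrable_subset[OF bounded_measurable_on_integrable]) auto
      have i2: "set_integrable lborel {0..T} (\<lambda>s. (K1 * K2) * \<bar>Y s \<omega>\<bar>)" using set_integrable_abs[OF aY] by simp
      have "\<bar>LBINT s:{0..t}. resolvent a t s * Y s \<omega>\<bar> \<le> (LBINT s:{0..t}. \<bar>resolvent a t s * Y s \<omega>\<bar>)"
        using set_integral_norm_bound[OF i] by simp
      also have "\<dots> \<le> (LBINT s:{0..T}. (K1 * K2) * \<bar>Y s \<omega>\<bar>)"
        unfolding set_lebesgue_integral_def
      proof (rule integral_mono)
        show "integrable lborel (\<lambda>s. indicator {0..t} s *\<^sub>R \<bar>resolvent a t s * Y s \<omega>\<bar>)"
          using set_integrable_abs[OF i] by (simp add: set_integrable_def)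
        show "integrable lborel (\<lambda>s. indicator {0..T} s *\<^sub>R ((K1 * K2) * \<bar>Y s \<omega>\<bar>))"
          using i2 by (simp only: set_integrable_def)
        fix s
        show "indicator {0..t} s *\<^sub>R \<bar>resolvent a t s * Y s \<omega>\<bar> \<le> indicator {0..T} s *\<^sub>R ((K1 * K2) * \<bar>Y s \<omega>\<bar>)"
          using t res[OF t, of s] K1(1) K2(1) by (auto simp: indicator_def abs_mult mult_right_mono)
      qed
      also have "\<dots> = (K1 * K2) * (LBINT s:{0..T}. \<bar>Y s \<omega>\<bar>)" by (rule set_integral_mult_right)
      finally show ?thesis .
    qed
    then show ?case using sol by simp
  qed
  then have "L2_bounded T (\<lambda>t \<omega>. x t \<omega> - Y t \<omega>)"
    by (rule L2_bounded_integral_operator[OF Y measurable_process_diff[OF mx L2_bounded_measurable[OF Y]] T])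
  from L2_bounded_add[OF this Y] show ?thesis by simp
qed

text \<open>
  The stochastic integrals cancel by uniqueness, and the difference solves a linear equation path by path.
\<close>

lemma sde_difference:
  assumes x: "solves_linear_sde M W Wb T a b c cb x0 x" and x': "solves_linear_sde M W Wb T a b' c cb x0 x'"
    and a: "bounded_measurable_on 0 T a" and b: "integrable_process M T b" and b': "integrable_process M T b'"
  shows "AE \<omega> in M. \<forall>t\<in>{0..T}. x t \<omega> - x' t \<omega> = (LBINT s:{0..t}. b s \<omega> - b' s \<omega>)
    + (LBINT s:{0..t}. resolvent a t s * (LBINT r:{0..s}. b r \<omega> - b' r \<omega>))"
proof -
  from x obtain I Ib where I: "ito_integral M noise_filtration W T (\<lambda>t \<omega>. c t) I"
    and Ib: "ito_integral M noise_filtration Wb T (\<lambda>t \<omega>. cb t) Ib"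
    and eq: "AE \<omega> in M. \<forall>t\<in>{0..T}. x t \<omega> = x0 + (LBINT s:{0..t}. a s * x s \<omega> + b s \<omega>) + I t \<omega> + Ib t \<omega>"
    unfolding solves_linear_sde_def by blast
  from x' obtain I' Ib' where I': "ito_integral M noise_filtration W T (\<lambda>t \<omega>. c t) I'"
    and Ib': "ito_integral M noise_filtration Wb T (\<lambda>t \<omega>. cb t) Ib'"
    and eq': "AE \<omega> in M. \<forall>t\<in>{0..T}. x' t \<omega> = x0 + (LBINT s:{0..t}. a s * x' s \<omega> + b' s \<omega>) + I' t \<omega> + Ib' t \<omega>"
    unfolding solves_linear_sde_def by blast
  have cx: "continuous_process M T x" "continuous_process M T x'" using x x' unfolding solves_linear_sde_def by auto
  show ?thesis
    using eq eq' cx[unfolded continuous_process_def] integrable_process_paths(1)[OF b] integrable_process_paths(1)[OF b']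
      W.ito_integral_unique[OF I I' T] Wb.ito_integral_unique[OF Ib Ib' T]
  proof eventually_elim
    case (elim \<omega>)
    have ib: "set_integrable lborel {0..T} (\<lambda>s. b s \<omega> - b' s \<omega>)" by (rule set_integral_diff(1)[OF elim(5,6)])
    have cq: "continuous_on {0..T} (\<lambda>t. LBINT s:{0..t}. b s \<omega> - b' s \<omega>)" by (rule continuous_on_set_integral_Icc[OF ib])
    have ax: "set_integrable lborel {0..T} (\<lambda>s. a s * x s \<omega>)" "set_integrable lborel {0..T} (\<lambda>s. a s * x' s \<omega>)"
      by (intro bounded_measurable_on_integrable bounded_measurable_on_mult a bounded_measurable_on_continuous elim)+
    have eqz: "x t \<omega> - x' t \<omega> = (LBINT s:{0..t}. b s \<omega> - b' s \<omega>) + (LBINT s:{0..t}. a s * (x s \<omega> - x' s \<omega>))" if t: "t \<in> {0..T}" for t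
    proof -
      have sub: "set_integrable lborel {0..t} f" if "set_integrable lborel {0..T} f" for f :: "real \<Rightarrow> real"
        using that t by (rule_tac set_integrable_subset) auto
      have "(LBINT s:{0..t}. a s * (x s \<omega> - x' s \<omega>)) = (LBINT s:{0..t}. a s * x s \<omega>) - (LBINT s:{0..t}. a s * x' s \<omega>)"
        unfolding right_diff_distrib by (rule set_integral_diff(2)[OF sub[OF ax(1)] sub[OF ax(2)]])
      moreover have "(LBINT s:{0..t}. b s \<omega> - b' s \<omega>) = (LBINT s:{0..t}. b s \<omega>) - (LBINT s:{0..t}. b' s \<omega>)"
        by (rule set_integral_diff(2)[OF sub[OF elim(5)] sub[OF elim(6)]])
      moreover have "(LBINT s:{0..t}. a s * x s \<omega> + b s \<omega>) = (LBINT s:{0..t}. a s * x s \<omega>) + (LBINT s:{0..t}. b s \<omega>)"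
        by (rule set_integral_add(2)[OF sub[OF ax(1)] sub[OF elim(5)]])
      moreover have "(LBINT s:{0..t}. a s * x' s \<omega> + b' s \<omega>) = (LBINT s:{0..t}. a s * x' s \<omega>) + (LBINT s:{0..t}. b' s \<omega>)"
        by (rule set_integral_add(2)[OF sub[OF ax(2)] sub[OF elim(6)]])
      moreover have "I t \<omega> = I' t \<omega>" "Ib t \<omega> = Ib' t \<omega>" using elim(7,8) t by auto
      moreover have "x t \<omega> = x0 + (LBINT s:{0..t}. a s * x s \<omega> + b s \<omega>) + I t \<omega> + Ib t \<omega>"
        "x' t \<omega> = x0 + (LBINT s:{0..t}. a s * x' s \<omega> + b' s \<omega>) + I' t \<omega> + Ib' t \<omega>" using elim(1,2) t by auto
      ultimately show ?thesis by linarith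
    qed
    show ?case
    proof
      fix t assume t: "t \<in> {0..T}"
      have "continuous_on {0..T} (\<lambda>t. x t \<omega> - x' t \<omega>)" using elim(3,4) by (intro continuous_intros)
      from volterra_solution[OF a bounded_measurable_on_continuous[OF this] bounded_measurable_on_continuous[OF cq] eqz t]
      show "x t \<omega> - x' t \<omega> = (LBINT s:{0..t}. b s \<omega> - b' s \<omega>)
        + (LBINT s:{0..t}. resolvent a t s * (LBINT r:{0..s}. b r \<omega> - b' r \<omega>))" by simp
    qed
  qed
qed

lemma bounded_measurable_on_resolvent:
  assumes a: "bounded_measurable_on 0 T a"
  shows "bounded_measurable_on 0 T (resolvent a t)"
proof -
  have "continuous_on {0..T} (\<lambda>s. LBINT r:{0..s}. a r)"
    by (rule continuous_on_set_integral_Icc[OF bounded_measurable_on_integrable[OF a]])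
  then show ?thesis
    unfolding resolvent_def[abs_def]
    by (intro bounded_measurable_on_mult a bounded_measurable_on_const bounded_measurable_on_continuous continuous_intros)
qed

text \<open>
  By \<open>sde_difference\<close> the difference is obtained from the drifts by two integrations in time, and each of them
  preserves adaptedness. Thus the noise, which is not observed, drops out.
\<close>

lemma sde_difference_adapted:
  assumes x: "solves_linear_sde M W Wb T a b c cb x0 x" and x': "solves_linear_sde M W Wb T a b' c cb x0 x'"
    and a: "bounded_measurable_on 0 T a" and b: "L2_bounded T b" and b': "L2_bounded T b'"
    and G: "subalgebra M G" "null_sets M \<subseteq> sets G" and t: "t \<in> {0..T}"
    and ad: "\<And>s. s \<in> {0..t} \<Longrightarrow> (\<lambda>\<omega>. b s \<omega> - b' s \<omega>) \<in> borel_measurable G"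
  shows "(\<lambda>\<omega>. x t \<omega> - x' t \<omega>) \<in> borel_measurable G"
proof -
  note ib = L2_bounded_integrable_process(2)[OF b] L2_bounded_integrable_process(2)[OF b']
  define d where "d = (\<lambda>s \<omega>. b s \<omega> - b' s \<omega>)"
  define q where "q = (\<lambda>s \<omega>. LBINT r:{0..s}. d r \<omega>)"
  have dL: "L2_bounded T d"
    unfolding d_def using L2_bounded_add[OF b L2_bounded_coeff[OF b' bounded_measurable_on_const[of _ _ "-1"]]] by simp
  have q: "q s \<in> borel_measurable G" if "s \<in> {0..t}" for s
    unfolding q_def by (rule adapted_integral[OF complete G L2_bounded_integrable_process(2)[OF dL]])
      (use that t ad in \<open>auto simp: d_def\<close>)
  have "integrable_process M T q"
    unfolding q_def by (rule L2_bounded_integrable_process(2)[OF L2_bounded_indefinite_integral[OF dL T]])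
  then have "integrable_process M T (\<lambda>s \<omega>. resolvent a t s * q s \<omega>)"
    by (rule integrable_process_coeff[OF _ bounded_measurable_on_resolvent[OF a]])
  then have "(\<lambda>\<omega>. LBINT s:{0..t}. resolvent a t s * q s \<omega>) \<in> borel_measurable G"
    by (rule adapted_integral[OF complete G _ t]) (use q in auto)
  then have "(\<lambda>\<omega>. q t \<omega> + (LBINT s:{0..t}. resolvent a t s * q s \<omega>)) \<in> borel_measurable G"
    using q[of t] t by (intro borel_measurable_add) auto
  then show ?thesis
  proof (rule measurable_AE_eq_complete[OF complete G])
    show "AE \<omega> in M. q t \<omega> + (LBINT s:{0..t}. resolvent a t s * q s \<omega>) = x t \<omega> - x' t \<omega>"
      using sde_difference[OF x x' a ib] by eventually_elim (use t in \<open>auto simp: q_def d_def\<close>)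
  qed
qed

end

section \<open>Admissibility of needle variations\<close>

lemma augmented_generated_mono:
  assumes "s \<le> t"
  shows "subalgebra (augmented M (generated_filtration M Y) t) (augmented M (generated_filtration M Y) s)"
  using generated_filtration_mono[OF assms, of M Y] augmented_contains[of "generated_filtration M Y" t M]
  by (intro augmented_least) (auto simp: subalgebra_def)

lemma augmented_generated_subalgebra:
  assumes "\<And>r. r \<in> {0..t} \<Longrightarrow> Y r \<in> borel_measurable M"
  shows "subalgebra M (augmented M (generated_filtration M Y) t)"
  using generated_filtration_least[of t Y M M] assms by (intro augmented_least) (auto simp: null_sets_def)

text \<open>
  If a process differs from another one by something known from the history of the latter, then so is
  its own history.
\<close>

lemma augmented_generated_transfer:
  assumes compl: "complete_measure M" and Y: "\<And>r. r \<in> {0..t} \<Longrightarrow> Y r \<in> borel_measurable M"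
    and D: "\<And>r. r \<in> {0..t} \<Longrightarrow> D r \<in> borel_measurable (augmented M (generated_filtration M Y) t)"
    and eq: "\<And>r. r \<in> {0..t} \<Longrightarrow> AE \<omega> in M. Y r \<omega> + D r \<omega> = (Y' r \<omega> :: real)"
  shows "subalgebra (augmented M (generated_filtration M Y) t) (augmented M (generated_filtration M Y') t)"
proof -
  let ?G = "augmented M (generated_filtration M Y) t"
  have G: "subalgebra M ?G" "null_sets M \<subseteq> sets ?G" "subalgebra ?G (generated_filtration M Y t)"
    using augmented_generated_subalgebra[of t Y M] Y augmented_contains[of "generated_filtration M Y" t M] by auto
  have "Y' r \<in> borel_measurable ?G" if r: "r \<in> {0..t}" for r
  proof (rule measurable_AE_eq_complete[OF compl G(1,2) _ eq[OF r]])
    show "(\<lambda>\<omega>. Y r \<omega> + D r \<omega>) \<in> borel_measurable ?G"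
      by (intro borel_measurable_add D[OF r] measurable_mono_subalgebra[OF G(3) measurable_generated_filtration[OF r]])
  qed
  then show ?thesis
    by (intro augmented_least generated_filtration_least G) auto
qed

text \<open>
  The situation of the follower for a fixed strategy of the leader. The cost is not fixed here, since it
  does not affect admissibility. The information assumption is recorded for \<open>v1bar\<close>, where
  it makes the leader's control known from the uncontrolled observation.
\<close>

locale follower_problem = two_brownian_motions M T W Wb
  for M :: "'a measure" and T :: real and W Wb :: "real \<Rightarrow> 'a \<Rightarrow> real" +
  fixes x0 :: real and xunc v1bar v2 :: "real \<Rightarrow> 'a \<Rightarrow> real"
    and A B1 B2 \<alpha> c cb f1 f2 g :: "real \<Rightarrow> real"
    and x :: "(real \<Rightarrow> 'a \<Rightarrow> real) \<Rightarrow> (real \<Rightarrow> 'a \<Rightarrow> real) \<Rightarrow> real \<Rightarrow> 'a \<Rightarrow> real"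
  assumes A: "bounded_measurable_on 0 T A" and B1: "bounded_measurable_on 0 T B1"
    and B2: "bounded_measurable_on 0 T B2" and \<alpha>: "bounded_measurable_on 0 T \<alpha>"
    and f1: "bounded_measurable_on 0 T f1" and g: "bounded_measurable_on 0 T g"
    and uncontrolled: "solves_linear_sde M W Wb T A (\<lambda>t \<omega>. 0) c cb x0 xunc"
    and state: "v1 \<in> follower_controls0 M W T f1 xunc \<Longrightarrow>
      solves_linear_sde M W Wb T A (\<lambda>t \<omega>. B1 t * v1 t \<omega> + B2 t * v2 t \<omega> + \<alpha> t) c cb x0 (x v1 v2)"
    and leader: "v2 \<in> leader_controls M W Wb T f2"
    and follower: "v1bar \<in> follower_controls M W T f1 g xunc x v2"
    and information: "t \<in> {0..T} \<Longrightarrow> sets (augmented M (generated_filtration M (Y2 W f2 v2)) t) \<subseteq>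
      sets (augmented M (generated_filtration M (Y1_uncontrolled W f1 xunc)) t)"
begin

abbreviation "xbar \<equiv> x v1bar v2"
abbreviation "Ybar \<equiv> Y1 W f1 g (x v1bar v2)"
abbreviation "Yunc \<equiv> Y1_uncontrolled W f1 xunc"
abbreviation "history Y t \<equiv> augmented M (generated_filtration M Y) t"

lemma follower0: "v1bar \<in> follower_controls0 M W T f1 xunc"
  using follower by (simp add: follower_controls_def)

lemma L2_controls: "L2_bounded T v2" "v1 \<in> follower_controls0 M W T f1 xunc \<Longrightarrow> L2_bounded T v1"
  using leader by (auto simp: leader_controls_def follower_controls0_def intro: L2_bounded_if_sup_square_integrable)

lemma L2_drift:
  "v1 \<in> follower_controls0 M W T f1 xunc \<Longrightarrow> L2_bounded T (\<lambda>t \<omega>. B1 t * v1 t \<omega> + B2 t * v2 t \<omega> + \<alpha> t)"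
  by (intro L2_bounded_add L2_bounded_coeff L2_bounded_time L2_controls B1 B2 \<alpha>)

lemma L2_state: "v1 \<in> follower_controls0 M W T f1 xunc \<Longrightarrow> L2_bounded T (x v1 v2)"
  by (rule sde_L2_bounded[OF state A L2_drift])

lemma L2_uncontrolled: "L2_bounded T xunc"
  by (rule sde_L2_bounded[OF uncontrolled A L2_bounded_time[OF bounded_measurable_on_const]])

lemma measurable_observation:
  assumes "L2_bounded T h" "t \<in> {0..T}"
  shows "observation W h t \<in> borel_measurable M"
  unfolding observation_def[abs_def]
  using measurable_process_at[OF measurable_process_integral[OF L2_bounded_measurable[OF assms(1)]] assms(2)]
    W.B_measurable_M[OF assms(2)] by simp

lemma L2_observation_drift:
  "v1 \<in> follower_controls0 M W T f1 xunc \<Longrightarrow> L2_bounded T (\<lambda>t \<omega>. f1 t * x v1 v2 t \<omega> + g t)"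
  "L2_bounded T (\<lambda>t \<omega>. f1 t * xunc t \<omega>)"
  by (intro L2_bounded_add L2_bounded_coeff L2_bounded_time L2_state L2_uncontrolled f1 g; assumption)+

lemma measurable_Y:
  "v1 \<in> follower_controls0 M W T f1 xunc \<Longrightarrow> t \<in> {0..T} \<Longrightarrow> Y1 W f1 g (x v1 v2) t \<in> borel_measurable M"
  "t \<in> {0..T} \<Longrightarrow> Yunc t \<in> borel_measurable M"
  unfolding Y1_def Y1_uncontrolled_def by (auto intro: measurable_observation L2_observation_drift)

lemma history_subalgebra:
  "v1 \<in> follower_controls0 M W T f1 xunc \<Longrightarrow> t \<in> {0..T} \<Longrightarrow> subalgebra M (history (Y1 W f1 g (x v1 v2)) t)"
  "t \<in> {0..T} \<Longrightarrow> subalgebra M (history Yunc t)"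
  by (auto intro!: augmented_generated_subalgebra measurable_Y)

lemma history_null_sets: "null_sets M \<subseteq> sets (history Y t)"
  using augmented_contains(2)[of "generated_filtration M Y" t M] by simp

text \<open>
  The drift of the observation is adapted to the noise; so events seen by the follower are independent of
  later increments of the noise.
\<close>

lemma Ybar_adapted_to_noise: "subalgebra (noise_filtration t) (generated_filtration M Ybar t)" if t: "t \<in> {0..T}"
proof (rule generated_filtration_least)
  fix r assume r: "r \<in> {0..t}"
  have x: "solves_linear_sde M W Wb T A (\<lambda>t \<omega>. B1 t * v1bar t \<omega> + B2 t * v2 t \<omega> + \<alpha> t) c cb x0 xbar"
    by (rule state[OF follower0])
  have ad: "xbar s \<in> borel_measurable (noise_filtration t)" if "s \<in> {0..r}" for s
    using x that r t W.measurable_F_mono[of "xbar s" s t] by (auto simp: solves_linear_sde_def adapted_def)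
  have "(\<lambda>\<omega>. LBINT s:{0..r}. f1 s * xbar s \<omega> + g s) \<in> borel_measurable (noise_filtration t)"
    by (rule adapted_integral[OF complete W.sub_F null_sets_noise_filtration L2_bounded_integrable_process(2)[OF L2_observation_drift(1)[OF follower0]]])
      (use ad r t in auto)
  moreover have "W r \<in> borel_measurable (noise_filtration t)"
    using W.measurable_F_mono[OF W.adapted_B, of r t] r t by auto
  ultimately show "Ybar r \<in> borel_measurable (noise_filtration t)"
    by (simp add: Y1_def observation_def[abs_def])
qed (simp add: brownian_filtration_def)

text \<open>
  The controlled and the uncontrolled state differ by a functional of the two controls, both of which are known
  from the uncontrolled observation.
\<close>

lemma Ybar_history_subset: "subalgebra (history Yunc t) (history Ybar t)" if t: "t \<in> {0..T}"
proof (rule augmented_generated_transfer[OF complete])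
  let ?G = "history Yunc t"
  let ?d = "\<lambda>s \<omega>. f1 s * (xbar s \<omega> - xunc s \<omega>) + g s"
  note xs = state[OF follower0] uncontrolled
  have zero: "L2_bounded T (\<lambda>t \<omega>. 0)" by (rule L2_bounded_time[OF bounded_measurable_on_const])
  have dL: "L2_bounded T ?d"
    using L2_bounded_add[OF L2_observation_drift(1)[OF follower0] L2_bounded_coeff[OF L2_observation_drift(2) bounded_measurable_on_const[of _ _ "-1"]]]
    by (simp add: algebra_simps)
  show "Yunc r \<in> borel_measurable M" if "r \<in> {0..t}" for r using measurable_Y(2) that t by auto
  have control: "v1bar s \<in> borel_measurable ?G" "v2 s \<in> borel_measurable ?G" if s: "s \<in> {0..t}" for s
  proof -
    have sub: "subalgebra ?G (history Yunc s)" by (rule augmented_generated_mono) (use s in auto)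
    have "v1bar s \<in> borel_measurable (history Yunc s)"
      using follower0 s t by (auto simp: follower_controls0_def adapted_def)
    then show "v1bar s \<in> borel_measurable ?G" by (rule measurable_mono_subalgebra[OF sub])
    have "v2 s \<in> borel_measurable (history (Y2 W f2 v2) s)"
      using leader s t by (auto simp: leader_controls_def adapted_def)
    moreover have "subalgebra (history Yunc s) (history (Y2 W f2 v2) s)"
      using information[of s] s t by (auto simp: subalgebra_def)
    ultimately have "v2 s \<in> borel_measurable (history Yunc s)" by (rule measurable_mono_subalgebra[rotated])
    then show "v2 s \<in> borel_measurable ?G" by (rule measurable_mono_subalgebra[OF sub])
  qed
  have diff: "(\<lambda>\<omega>. xbar s \<omega> - xunc s \<omega>) \<in> borel_measurable ?G" if s: "s \<in> {0..t}" for s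
  proof (rule sde_difference_adapted[OF xs A L2_drift[OF follower0] zero history_subalgebra(2)[OF t] history_null_sets])
    show "s \<in> {0..T}" using s t by auto
    show "(\<lambda>\<omega>. B1 u * v1bar u \<omega> + B2 u * v2 u \<omega> + \<alpha> u - 0) \<in> borel_measurable ?G" if "u \<in> {0..s}" for u
      using control[of u] that s by (intro borel_measurable_diff borel_measurable_add borel_measurable_times borel_measurable_const) auto
  qed
  show "(\<lambda>\<omega>. LBINT s:{0..r}. ?d s \<omega>) \<in> borel_measurable ?G" if r: "r \<in> {0..t}" for r
  proof (rule adapted_integral[OF complete history_subalgebra(2)[OF t] history_null_sets L2_bounded_integrable_process(2)[OF dL]])
    show "r \<in> {0..T}" using r t by auto
    show "?d s \<in> borel_measurable ?G" if "s \<in> {0..r}" for s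
      using diff[of s] that r by (intro borel_measurable_add borel_measurable_times borel_measurable_const) auto
  qed
  show "AE \<omega> in M. Yunc r \<omega> + (LBINT s:{0..r}. ?d s \<omega>) = Ybar r \<omega>" if r: "r \<in> {0..t}" for r
    using integrable_process_paths(1)[OF L2_bounded_integrable_process(2)[OF L2_observation_drift(2)]]
      integrable_process_paths(1)[OF L2_bounded_integrable_process(2)[OF dL]]
  proof eventually_elim
    case (elim \<omega>)
    have sub: "{0..r} \<subseteq> {0..T}" "{0..r} \<in> sets lborel" using r t by auto
    have "(LBINT s:{0..r}. f1 s * xunc s \<omega>) + (LBINT s:{0..r}. ?d s \<omega>) = (LBINT s:{0..r}. f1 s * xunc s \<omega> + ?d s \<omega>)"
      by (rule set_integral_add(2)[symmetric]; rule set_integrable_subset[OF _ sub(2,1)]; rule elim)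
    also have "\<dots> = (LBINT s:{0..r}. f1 s * xbar s \<omega> + g s)" by (simp add: algebra_simps)
    finally show ?case by (simp add: Y1_def Y1_uncontrolled_def observation_def)
  qed
qed

definition needle :: "'a set \<Rightarrow> real \<Rightarrow> real \<Rightarrow> real \<Rightarrow> real \<Rightarrow> 'a \<Rightarrow> real"
  where "needle C a b \<epsilon> t \<omega> = v1bar t \<omega> + \<epsilon> * indicator C \<omega> * indicator {a<..b} t"

text \<open>
  The effect of the needle, for \<open>\<epsilon> = 1\<close> and on the event \<open>C\<close>: what it adds to the drift, integrated
  over time, and what it adds to the state.
\<close>

definition needle_source :: "real \<Rightarrow> real \<Rightarrow> real \<Rightarrow> real"
  where "needle_source a b t = (LBINT s:{0..t}. B1 s * indicator {a<..b} s)"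

definition needle_response :: "real \<Rightarrow> real \<Rightarrow> real \<Rightarrow> real"
  where "needle_response a b t = needle_source a b t + (LBINT s:{0..t}. resolvent A t s * needle_source a b s)"

lemma bounded_measurable_on_needle: "bounded_measurable_on u v (indicat_real {a<..b})"
  by (intro bounded_measurable_on_indicator) auto

lemma needle_source_continuous: "continuous_on {0..T} (needle_source a b)"
  unfolding needle_source_def[abs_def]
  by (intro continuous_on_set_integral_Icc bounded_measurable_on_integrable bounded_measurable_on_mult B1 bounded_measurable_on_needle)

lemma needle_response_bounded: "bounded_measurable_on 0 T (needle_response a b)"
  using volterra_solution_exists(1)[OF A bounded_measurable_on_continuous[OF needle_source_continuous]]
  by (simp add: needle_response_def[abs_def])

lemma needle_response_eq:
  assumes t: "t \<in> {0..T}"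
  shows "needle_response a b t = (LBINT s:{0..t}. A s * needle_response a b s + B1 s * indicator {a<..b} s)"
proof -
  have "needle_response a b t = needle_source a b t + (LBINT s:{0..t}. A s * needle_response a b s)"
    using volterra_solution_exists(2)[OF A bounded_measurable_on_continuous[OF needle_source_continuous] t]
    by (simp add: needle_response_def[abs_def])
  also have "\<dots> = (LBINT s:{0..t}. A s * needle_response a b s) + (LBINT s:{0..t}. B1 s * indicator {a<..b} s)"
    by (simp add: needle_source_def)
  also have "\<dots> = (LBINT s:{0..t}. A s * needle_response a b s + B1 s * indicator {a<..b} s)"
  proof -
    have sub: "{0..t} \<subseteq> {0..T}" using t by auto
    show ?thesis
      by (rule set_integral_add(2)[symmetric]; rule bounded_measurable_on_integrable;
          intro bounded_measurable_on_mult bounded_measurable_on_needle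
            bounded_measurable_on_subset[OF A sub] bounded_measurable_on_subset[OF B1 sub]
            bounded_measurable_on_subset[OF needle_response_bounded sub])
  qed
  finally show ?thesis .
qed

lemma needle_response_before:
  assumes "t \<le> a" shows "needle_response a b t = 0"
proof -
  have "needle_source a b s = 0" if "s \<le> a" for s
  proof -
    have "(LBINT r:{0..s}. B1 r * indicator {a<..b} r) = (LBINT r:{0..s}. 0)"
      by (rule set_lebesgue_integral_cong) (use that in \<open>auto simp: indicator_def\<close>)
    then show ?thesis by (simp add: needle_source_def)
  qed
  moreover have "(LBINT s:{0..t}. resolvent A t s * needle_source a b s) = (LBINT s:{0..t}. 0)"
    by (rule set_lebesgue_integral_cong) (use calculation assms in auto)
  ultimately show ?thesis using assms by (simp add: needle_response_def)
qed

context
  fixes C :: "'a set" and a b :: real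
  assumes C: "C \<in> sets (generated_filtration M Ybar a)" and ab: "0 \<le> a" "a < b" "b \<le> T"
begin

lemma C_history: "a \<le> t \<Longrightarrow> indicat_real C \<in> borel_measurable (history Ybar t)"
proof -
  assume "a \<le> t"
  have "C \<in> sets (history Ybar a)"
    using augmented_contains(1)[of "generated_filtration M Ybar" a M] C by (auto simp: subalgebra_def)
  then show ?thesis
    using augmented_generated_mono[OF \<open>a \<le> t\<close>, of M Ybar] by (intro borel_measurable_indicator) (auto simp: subalgebra_def)
qed

lemma C_events: "C \<in> sets M"
  using Ybar_adapted_to_noise[of a] W.sub_F[of a] C ab by (auto simp: subalgebra_def)

lemma needle_admissible0: "needle C a b \<epsilon> \<in> follower_controls0 M W T f1 xunc"
proof -
  have m: "measurable_process M T v1bar" and s: "sup_square_integrable M T v1bar"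
    and ad: "adapted (history Yunc) T v1bar"
    using follower0 by (auto simp: follower_controls0_def)
  have "measurable_process M T (needle C a b \<epsilon>)"
    unfolding needle_def[abs_def]
    by (intro measurable_process_add m measurable_process_mult measurable_process_omega measurable_process_time)
      (use C_events bounded_measurable_on_needle[of 0 T a b] in \<open>auto simp: bounded_measurable_on_def\<close>)
  moreover have "sup_square_integrable M T (needle C a b \<epsilon>)"
  proof -
    let ?S = "\<lambda>\<omega>. SUP t\<in>{0..T}. ennreal ((v1bar t \<omega>)\<^sup>2)"
    have "(SUP t\<in>{0..T}. ennreal ((needle C a b \<epsilon> t \<omega>)\<^sup>2)) \<le> 2 * ?S \<omega> + ennreal (2 * \<epsilon>\<^sup>2)" for \<omega>
    proof (rule SUP_least)
      fix t assume t: "t \<in> {0..T}"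
      let ?u = "\<epsilon> * indicator C \<omega> * indicator {a<..b} t :: real"
      have "?u\<^sup>2 \<le> \<epsilon>\<^sup>2" by (auto simp: indicator_def)
      moreover have "(v1bar t \<omega> + ?u)\<^sup>2 \<le> 2 * (v1bar t \<omega>)\<^sup>2 + 2 * ?u\<^sup>2"
        using zero_le_power2[of "v1bar t \<omega> - ?u"] by (simp add: power2_sum power2_diff)
      ultimately have "(needle C a b \<epsilon> t \<omega>)\<^sup>2 \<le> 2 * (v1bar t \<omega>)\<^sup>2 + 2 * \<epsilon>\<^sup>2" by (simp add: needle_def)
      then have "ennreal ((needle C a b \<epsilon> t \<omega>)\<^sup>2) \<le> ennreal (2 * (v1bar t \<omega>)\<^sup>2 + 2 * \<epsilon>\<^sup>2)" by (rule ennreal_leI)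
      also have "\<dots> = 2 * ennreal ((v1bar t \<omega>)\<^sup>2) + ennreal (2 * \<epsilon>\<^sup>2)" by (simp add: ennreal_plus ennreal_mult)
      also have "\<dots> \<le> 2 * ?S \<omega> + ennreal (2 * \<epsilon>\<^sup>2)"
        by (intro add_right_mono mult_left_mono SUP_upper t) simp
      finally show "ennreal ((needle C a b \<epsilon> t \<omega>)\<^sup>2) \<le> 2 * ?S \<omega> + ennreal (2 * \<epsilon>\<^sup>2)" .
    qed
    then have "(\<integral>\<^sup>+\<omega>. (SUP t\<in>{0..T}. ennreal ((needle C a b \<epsilon> t \<omega>)\<^sup>2)) \<partial>M) \<le> (\<integral>\<^sup>+\<omega>. 2 * ?S \<omega> + ennreal (2 * \<epsilon>\<^sup>2) \<partial>M)"
      by (intro nn_integral_mono)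
    also have "\<dots> < \<infinity>" by (rule nn_integral_affine_finite) (use s in \<open>simp add: sup_square_integrable_def\<close>)
    finally show ?thesis by (simp add: sup_square_integrable_def)
  qed
  moreover have "adapted (history Yunc) T (needle C a b \<epsilon>)"
    unfolding adapted_def
  proof
    fix t assume t: "t \<in> {0..T}"
    have v: "v1bar t \<in> borel_measurable (history Yunc t)" using ad t by (auto simp: adapted_def)
    show "needle C a b \<epsilon> t \<in> borel_measurable (history Yunc t)"
    proof (cases "a \<le> t")
      case True
      have "indicat_real C \<in> borel_measurable (history Yunc t)"
        by (rule measurable_mono_subalgebra[OF Ybar_history_subset[OF t] C_history[OF True]])
      then show ?thesis unfolding needle_def[abs_def]
        by (intro borel_measurable_add v borel_measurable_times borel_measurable_const)
    next
      case False
      then have "needle C a b \<epsilon> t = v1bar t" by (auto simp: needle_def fun_eq_iff)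
      then show ?thesis using v by simp
    qed
  qed
  ultimately show ?thesis by (simp add: follower_controls0_def)
qed

text \<open>
  In the difference of the two drifts everything but \<open>\<epsilon> 1\<^bsub>C\<^esub> B\<^sub>1 1\<^bsub>(a,b]\<^esub>\<close> cancels, and
  the factor \<open>\<epsilon> 1\<^bsub>C\<^esub>\<close> does not depend on time.
\<close>

lemma needle_state:
  "AE \<omega> in M. \<forall>t\<in>{0..T}. x (needle C a b \<epsilon>) v2 t \<omega> = xbar t \<omega> + \<epsilon> * indicator C \<omega> * needle_response a b t"
  using sde_difference[OF state[OF needle_admissible0[of \<epsilon>]] state[OF follower0] A
      L2_bounded_integrable_process(2)[OF L2_drift[OF needle_admissible0]] L2_bounded_integrable_process(2)[OF L2_drift[OF follower0]]]
proof eventually_elim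
  case (elim \<omega>)
  let ?e = "\<epsilon> * indicator C \<omega> :: real"
  have src: "(LBINT s:{0..t}. (B1 s * needle C a b \<epsilon> s \<omega> + B2 s * v2 s \<omega> + \<alpha> s) - (B1 s * v1bar s \<omega> + B2 s * v2 s \<omega> + \<alpha> s))
    = ?e * needle_source a b t" for t
  proof -
    have "(LBINT s:{0..t}. (B1 s * needle C a b \<epsilon> s \<omega> + B2 s * v2 s \<omega> + \<alpha> s) - (B1 s * v1bar s \<omega> + B2 s * v2 s \<omega> + \<alpha> s))
      = (LBINT s:{0..t}. ?e * (B1 s * indicator {a<..b} s))"
      by (simp add: needle_def distrib_left ac_simps)
    then show ?thesis unfolding set_integral_mult_right needle_source_def .
  qed
  have "(LBINT s:{0..t}. resolvent A t s * (?e * needle_source a b s)) = ?e * (LBINT s:{0..t}. resolvent A t s * needle_source a b s)" for t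
    unfolding set_integral_mult_right[symmetric] by (simp add: ac_simps)
  then show ?case using elim unfolding src by (auto simp: needle_response_def algebra_simps)
qed

lemma needle_observation:
  "AE \<omega> in M. \<forall>t\<in>{0..T}. Y1 W f1 g (x (needle C a b \<epsilon>) v2) t \<omega>
    = Ybar t \<omega> + \<epsilon> * indicator C \<omega> * (LBINT s:{0..t}. f1 s * needle_response a b s)"
  using needle_state[of \<epsilon>]
    integrable_process_paths(1)[OF L2_bounded_integrable_process(2)[OF L2_observation_drift(1)[OF follower0]]]
proof eventually_elim
  case (elim \<omega>)
  let ?e = "\<epsilon> * indicator C \<omega> :: real"
  show ?case
  proof
    fix t assume t: "t \<in> {0..T}"
    have sub: "{0..t} \<subseteq> {0..T}" "{0..t} \<in> sets lborel" using t by auto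
    have "(LBINT s:{0..t}. f1 s * x (needle C a b \<epsilon>) v2 s \<omega> + g s)
      = (LBINT s:{0..t}. (f1 s * xbar s \<omega> + g s) + ?e * (f1 s * needle_response a b s))"
      by (rule set_lebesgue_integral_cong) (use elim(1) t in \<open>auto simp: algebra_simps\<close>)
    also have "\<dots> = (LBINT s:{0..t}. f1 s * xbar s \<omega> + g s) + (LBINT s:{0..t}. ?e * (f1 s * needle_response a b s))"
    proof (rule set_integral_add(2))
      show "set_integrable lborel {0..t} (\<lambda>s. f1 s * xbar s \<omega> + g s)" by (rule set_integrable_subset[OF elim(2) sub(2,1)])
      show "set_integrable lborel {0..t} (\<lambda>s. ?e * (f1 s * needle_response a b s))"
        by (intro bounded_measurable_on_integrable bounded_measurable_on_mult bounded_measurable_on_const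
            bounded_measurable_on_subset[OF f1 sub(1)] bounded_measurable_on_subset[OF needle_response_bounded sub(1)])
    qed
    finally show "Y1 W f1 g (x (needle C a b \<epsilon>) v2) t \<omega>
      = Ybar t \<omega> + ?e * (LBINT s:{0..t}. f1 s * needle_response a b s)"
      by (simp add: Y1_def observation_def)
  qed
qed

text \<open>
  The shift of the observation is a deterministic function of time multiplied by \<open>\<epsilon> 1\<^bsub>C\<^esub>\<close>, and it
  starts at time \<open>a\<close>, when \<open>C\<close> is already known from the unchanged observation. Subtracting the shift recovers
  the original observation from the new one.
\<close>

lemma needle_admissible: "needle C a b \<epsilon> \<in> follower_controls M W T f1 g xunc x v2"
proof -
  let ?Y = "Y1 W f1 g (x (needle C a b \<epsilon>) v2)"
  define H where "H = (\<lambda>t. LBINT s:{0..t}. f1 s * needle_response a b s)"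
  have H0: "H t = 0" if "t \<le> a" for t
  proof -
    have "H t = (LBINT s:{0..t}. 0)"
      unfolding H_def by (rule set_lebesgue_integral_cong) (use that needle_response_before in auto)
    then show ?thesis by simp
  qed
  have Ym: "?Y r \<in> borel_measurable M" if "r \<in> {0..T}" for r using measurable_Y(1)[OF needle_admissible0 that] .
  have obs: "AE \<omega> in M. ?Y r \<omega> + - \<epsilon> * indicator C \<omega> * H r = Ybar r \<omega>" if "r \<in> {0..T}" for r
    using needle_observation[of \<epsilon>] by eventually_elim (use that in \<open>auto simp: H_def\<close>)
  \<comment> \<open>the shift starts at time \<open>a\<close>, before which the two observations agree\<close>
  have early: "subalgebra (history ?Y t) (history Ybar t)" if t: "t \<in> {0..a}" for t
  proof (rule augmented_generated_transfer[OF complete])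
    show "?Y r \<in> borel_measurable M" if "r \<in> {0..t}" for r using Ym that t ab by auto
    show "(\<lambda>\<omega>. 0 :: real) \<in> borel_measurable (history ?Y t)" by simp
    show "AE \<omega> in M. ?Y r \<omega> + 0 = Ybar r \<omega>" if "r \<in> {0..t}" for r
      using obs[of r] H0[of r] that t ab by auto
  qed
  have late: "subalgebra (history ?Y t) (history Ybar t)" if t: "a \<le> t" "t \<le> T" for t
  proof (rule augmented_generated_transfer[OF complete])
    show "?Y r \<in> borel_measurable M" if "r \<in> {0..t}" for r using Ym that t ab by auto
    have "indicat_real C \<in> borel_measurable (history ?Y a)"
      by (rule measurable_mono_subalgebra[OF early C_history]) (use ab in auto)
    then have "indicat_real C \<in> borel_measurable (history ?Y t)"
      by (rule measurable_mono_subalgebra[OF augmented_generated_mono[OF t(1)]])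
    then show "(\<lambda>\<omega>. - \<epsilon> * indicator C \<omega> * H r) \<in> borel_measurable (history ?Y t)" for r
      by (intro borel_measurable_times borel_measurable_const)
    show "AE \<omega> in M. ?Y r \<omega> + - \<epsilon> * indicator C \<omega> * H r = Ybar r \<omega>" if "r \<in> {0..t}" for r
      using obs[of r] that t by auto
  qed
  have "needle C a b \<epsilon> t \<in> borel_measurable (history ?Y t)" if t: "t \<in> {0..T}" for t
  proof -
    have "v1bar t \<in> borel_measurable (history Ybar t)"
      using follower t by (auto simp: follower_controls_def adapted_def)
    moreover have sub: "subalgebra (history ?Y t) (history Ybar t)" using early[of t] late[of t] t by (cases "t \<le> a") auto
    ultimately have v: "v1bar t \<in> borel_measurable (history ?Y t)" by (rule measurable_mono_subalgebra[rotated])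
    show ?thesis
    proof (cases "a \<le> t")
      case True
      have "indicat_real C \<in> borel_measurable (history ?Y t)"
        by (rule measurable_mono_subalgebra[OF sub C_history[OF True]])
      then have "(\<lambda>\<omega>. v1bar t \<omega> + \<epsilon> * indicator C \<omega> * indicator {a<..b} t) \<in> borel_measurable (history ?Y t)"
        by (intro borel_measurable_add v borel_measurable_times borel_measurable_const)
      moreover have "needle C a b \<epsilon> t = (\<lambda>\<omega>. v1bar t \<omega> + \<epsilon> * indicator C \<omega> * indicator {a<..b} t)"
        by (simp add: needle_def fun_eq_iff)
      ultimately show ?thesis by simp
    next
      case False
      then have "needle C a b \<epsilon> t = v1bar t" by (auto simp: needle_def fun_eq_iff)
      then show ?thesis using v by simp
    qed
  qed
  then show ?thesis using needle_admissible0 by (simp add: follower_controls_def adapted_def)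
qed

end

end

section \<open>The first-order condition and the adjoint equation\<close>

lemma linear_coefficient_zero:
  fixes p q :: real
  assumes "\<And>\<epsilon>. 0 \<le> \<epsilon> * p + \<epsilon>\<^sup>2 * q"
  shows "p = 0"
proof (rule ccontr)
  assume p: "p \<noteq> 0"
  define k where "k = \<bar>q\<bar> + 1"
  have k: "k > 0" "q < k" by (auto simp: k_def)
  have "0 \<le> (- p / k) * p + (- p / k)\<^sup>2 * q" by (rule assms)
  also have "\<dots> = (p / k)\<^sup>2 * (q - k)" using k by (simp add: power2_eq_square field_simps)
  also have "\<dots> < 0" using p k by (intro mult_pos_neg) auto
  finally show False by simp
qed

context follower_problem begin

text \<open>
  The event \<open>C\<close> belongs to the noise filtration at time \<open>a\<close>, so the increments of the stochastic integrals from
  \<open>t \<ge> a\<close> to \<open>T\<close> have mean zero on \<open>C\<close>.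
\<close>

lemma adjoint_expectation:
  assumes p: "solves_linear_bsde M W Wb T A d \<zeta> p k kb" and d: "L2_bounded T d"
    and a: "0 \<le> a" and C: "C \<in> sets (generated_filtration M Ybar a)" and t: "t \<in> {a..T}"
  shows "expectation (\<lambda>\<omega>. indicator C \<omega> * p t \<omega>) = expectation (\<lambda>\<omega>. indicator C \<omega> * p T \<omega>)
    + (LBINT s:{t..T}. A s * expectation (\<lambda>\<omega>. indicator C \<omega> * p s \<omega>) + expectation (\<lambda>\<omega>. indicator C \<omega> * d s \<omega>))"
    and "AE \<omega> in M. p T \<omega> = \<zeta> \<omega>"
proof -
  from p obtain I Ib where I: "ito_integral M noise_filtration W T k I" and Ib: "ito_integral M noise_filtration Wb T kb Ib"
    and eq: "AE \<omega> in M. \<forall>t\<in>{0..T}. p t \<omega> = \<zeta> \<omega> + (LBINT s:{t..T}. A s * p s \<omega> + d s \<omega>) - (I T \<omega> - I t \<omega>) - (Ib T \<omega> - Ib t \<omega>)"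
    unfolding solves_linear_bsde_def by blast
  have pL: "L2_bounded T p" using p unfolding solves_linear_bsde_def by (intro L2_bounded_if_sup_square_integrable) auto
  have tT: "t \<in> {0..T}" "T \<in> {0..T}" using t a by auto
  have CF: "C \<in> sets (noise_filtration a)" using Ybar_adapted_to_noise[of a] C a t by (auto simp: subalgebra_def)
  then have CM: "C \<in> sets M" using W.sub_F[of a] a t by (auto simp: subalgebra_def)
  have Cm: "indicat_real C \<in> borel_measurable M" "\<And>\<omega>. \<bar>indicat_real C \<omega>\<bar> \<le> 1" using CM by (auto simp: indicator_def)
  have CFm: "indicat_real C \<in> borel_measurable (noise_filtration t)"
    by (rule W.measurable_F_mono[of _ a]) (use CF a t in auto)
  show pT: "AE \<omega> in M. p T \<omega> = \<zeta> \<omega>"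
    using eq
  proof eventually_elim
    case (elim \<omega>)
    have "(LBINT s:{T..T}. A s * p s \<omega> + d s \<omega>) = 0"
      using set_integral_singleton_lborel[of T "\<lambda>s. A s * p s \<omega> + d s \<omega>"] by simp
    then show ?case using elim tT(2) by auto
  qed
  define D where "D = (\<lambda>s \<omega>. indicator C \<omega> * (A s * p s \<omega> + d s \<omega>))"
  have DL: "L2_bounded T (\<lambda>s \<omega>. A s * p s \<omega> + d s \<omega>)" by (intro L2_bounded_add L2_bounded_coeff pL A d)
  have Di: "integrable_process M T (\<lambda>s \<omega>. indicator {t..T} s * D s \<omega>)"
    unfolding D_def by (intro integrable_process_coeff integrable_process_omega_bounded[OF _ Cm] L2_bounded_integrable_process DL
        bounded_measurable_on_indicator) auto
  have LI: "(LBINT s:{t..T}. f s) = (LBINT s:{0..T}. indicator {t..T} s * f s)" for f :: "real \<Rightarrow> real"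
    unfolding set_lebesgue_integral_def using tT by (intro Bochner_Integration.integral_cong) (auto simp: indicator_def)
  note IL = ito_integral_L2_bounded[OF disjI1, OF I] ito_integral_L2_bounded[OF disjI2, OF Ib]
  have Ci: "integrable M (\<lambda>\<omega>. indicator C \<omega> * X \<omega>)" if "integrable M X" for X :: "'a \<Rightarrow> real"
    by (rule integrable_bounded_mult[OF that Cm(1)]) (use Cm in auto)
  have ints: "integrable M (\<lambda>\<omega>. indicator C \<omega> * p T \<omega>)" "integrable M (\<lambda>\<omega>. indicator C \<omega> * (I T \<omega> - I t \<omega>))"
    "integrable M (\<lambda>\<omega>. indicator C \<omega> * (Ib T \<omega> - Ib t \<omega>))"
    using L2_bounded_square_integrable(2)[OF pL tT(2)] L2_bounded_square_integrable(2)[OF IL(1)] L2_bounded_square_integrable(2)[OF IL(2)] tT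
    by (auto intro!: Ci Bochner_Integration.integrable_diff)
  have mart: "expectation (\<lambda>\<omega>. indicator C \<omega> * (I T \<omega> - I t \<omega>)) = 0" "expectation (\<lambda>\<omega>. indicator C \<omega> * (Ib T \<omega> - Ib t \<omega>)) = 0"
    using W.ito_integral_martingale[OF I _ _ _ CFm, of T 1] Wb.ito_integral_martingale[OF Ib _ _ _ CFm, of T 1] tT Cm(2) by auto
  have "expectation (\<lambda>\<omega>. indicator C \<omega> * p t \<omega>)
    = expectation (\<lambda>\<omega>. indicator C \<omega> * p T \<omega> + (LBINT s:{0..T}. indicator {t..T} s * D s \<omega>)
        - indicator C \<omega> * (I T \<omega> - I t \<omega>) - indicator C \<omega> * (Ib T \<omega> - Ib t \<omega>))"
  proof (rule integral_cong_AE)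
    show "AE \<omega> in M. indicator C \<omega> * p t \<omega> = indicator C \<omega> * p T \<omega> + (LBINT s:{0..T}. indicator {t..T} s * D s \<omega>)
        - indicator C \<omega> * (I T \<omega> - I t \<omega>) - indicator C \<omega> * (Ib T \<omega> - Ib t \<omega>)"
      using eq pT
    proof eventually_elim
      case (elim \<omega>)
      have "p t \<omega> = p T \<omega> + (LBINT s:{t..T}. A s * p s \<omega> + d s \<omega>) - (I T \<omega> - I t \<omega>) - (Ib T \<omega> - Ib t \<omega>)"
        using elim tT by auto
      moreover have "indicator C \<omega> * (LBINT s:{t..T}. A s * p s \<omega> + d s \<omega>) = (LBINT s:{0..T}. indicator {t..T} s * D s \<omega>)"
        unfolding LI[symmetric] D_def set_integral_mult_right ..
      ultimately show ?case by (simp add: right_diff_distrib distrib_left)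
    qed
    show "(\<lambda>\<omega>. indicator C \<omega> * p t \<omega>) \<in> borel_measurable M"
      using Cm(1) L2_bounded_square_integrable(3)[OF pL tT(1)] by simp
    show "(\<lambda>\<omega>. indicator C \<omega> * p T \<omega> + (LBINT s:{0..T}. indicator {t..T} s * D s \<omega>)
        - indicator C \<omega> * (I T \<omega> - I t \<omega>) - indicator C \<omega> * (Ib T \<omega> - Ib t \<omega>)) \<in> borel_measurable M"
      using ints integrable_process_paths(2)[OF Di] by (intro borel_measurable_diff borel_measurable_add) auto
  qed
  also have "\<dots> = expectation (\<lambda>\<omega>. indicator C \<omega> * p T \<omega>) + expectation (\<lambda>\<omega>. LBINT s:{0..T}. indicator {t..T} s * D s \<omega>)"
    using ints integrable_process_paths(2)[OF Di] mart by simp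
  also have "expectation (\<lambda>\<omega>. LBINT s:{0..T}. indicator {t..T} s * D s \<omega>) = (LBINT s:{0..T}. expectation (\<lambda>\<omega>. indicator {t..T} s * D s \<omega>))"
    by (rule integrable_process_paths(5)[OF Di])
  also have "\<dots> = (LBINT s:{t..T}. expectation (D s))" by (simp add: LI)
  also have "\<dots> = (LBINT s:{t..T}. A s * expectation (\<lambda>\<omega>. indicator C \<omega> * p s \<omega>) + expectation (\<lambda>\<omega>. indicator C \<omega> * d s \<omega>))"
  proof (rule set_lebesgue_integral_cong)
    show "\<forall>s. s \<in> {t..T} \<longrightarrow> expectation (D s) = A s * expectation (\<lambda>\<omega>. indicator C \<omega> * p s \<omega>) + expectation (\<lambda>\<omega>. indicator C \<omega> * d s \<omega>)"
    proof (intro allI impI)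
      fix s assume "s \<in> {t..T}"
      then have s: "s \<in> {0..T}" using tT by auto
      have "expectation (D s) = expectation (\<lambda>\<omega>. A s * (indicator C \<omega> * p s \<omega>) + indicator C \<omega> * d s \<omega>)"
        by (simp add: D_def distrib_left mult.left_commute)
      also have "\<dots> = A s * expectation (\<lambda>\<omega>. indicator C \<omega> * p s \<omega>) + expectation (\<lambda>\<omega>. indicator C \<omega> * d s \<omega>)"
        using Ci[OF L2_bounded_square_integrable(2)[OF pL s]] Ci[OF L2_bounded_square_integrable(2)[OF d s]] by simp
      finally show "expectation (D s) = A s * expectation (\<lambda>\<omega>. indicator C \<omega> * p s \<omega>) + expectation (\<lambda>\<omega>. indicator C \<omega> * d s \<omega>)" .
    qed
  qed simp
  finally show "expectation (\<lambda>\<omega>. indicator C \<omega> * p t \<omega>) = expectation (\<lambda>\<omega>. indicator C \<omega> * p T \<omega>)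
    + (LBINT s:{t..T}. A s * expectation (\<lambda>\<omega>. indicator C \<omega> * p s \<omega>) + expectation (\<lambda>\<omega>. indicator C \<omega> * d s \<omega>))" .
qed

end

text \<open>
  The optimality of \<open>v1bar\<close> and the adjoint equation, with terminal weights \<open>K\<close> and \<open>\<kappa>\<close>.
\<close>

locale optimal_follower = follower_problem +
  fixes L R l r :: "real \<Rightarrow> real" and K \<kappa> :: real and p k kb :: "real \<Rightarrow> 'a \<Rightarrow> real"
  assumes L: "bounded_measurable_on 0 T L"
    and R: "bounded_measurable_on 0 T R"
    and l: "bounded_measurable_on 0 T l" and r: "bounded_measurable_on 0 T r"
    and optimal: "\<And>v1. v1 \<in> follower_controls M W T f1 g xunc x v2 \<Longrightarrow>
      follower_cost M T L R l r K \<kappa> x v1bar v2 \<le> follower_cost M T L R l r K \<kappa> x v1 v2"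
    and p: "solves_linear_bsde M W Wb T A (\<lambda>t \<omega>. L t * xbar t \<omega> + l t) (\<lambda>\<omega>. K * xbar T \<omega> + \<kappa>) p k kb"
begin

text \<open>
  Here \<open>t0 + 2 \<epsilon> 1\<^bsub>C\<^esub> t1 + \<epsilon>\<^sup>2 1\<^bsub>C\<^esub> t2\<close> is twice the pathwise cost of the needle, where \<open>t2\<close> is
  deterministic. By optimality the expectation of \<open>1\<^bsub>C\<^esub> t1\<close> vanishes, and Fubini's theorem turns it into
  the expression below.
\<close>

lemma first_order_condition:
  assumes C: "C \<in> sets (generated_filtration M Ybar a)" and ab: "0 \<le> a" "a < b" "b \<le> T"
  defines "h \<equiv> needle_response a b"
    and "\<beta> \<equiv> \<lambda>t. expectation (\<lambda>\<omega>. indicator C \<omega> * (L t * xbar t \<omega> + l t))"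
    and "\<rho> \<equiv> \<lambda>t. expectation (\<lambda>\<omega>. indicator C \<omega> * (R t * v1bar t \<omega> + r t))"
  shows "(LBINT t:{0..T}. h t * \<beta> t + indicator {a<..b} t * \<rho> t)
    + h T * expectation (\<lambda>\<omega>. indicator C \<omega> * (K * xbar T \<omega> + \<kappa>)) = 0"
proof -
  let ?\<iota> = "indicat_real {a<..b}"
  define \<Phi>0 where "\<Phi>0 = (\<lambda>t \<omega>. L t * (xbar t \<omega>)\<^sup>2 + R t * (v1bar t \<omega>)\<^sup>2 + 2 * l t * xbar t \<omega> + 2 * r t * v1bar t \<omega>)"
  define \<Phi>1 where "\<Phi>1 = (\<lambda>t \<omega>. h t * (L t * xbar t \<omega> + l t) + ?\<iota> t * (R t * v1bar t \<omega> + r t))"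
  define \<Phi>2 where "\<Phi>2 = (\<lambda>t. L t * (h t * h t) + R t * (?\<iota> t * ?\<iota> t))"
  define t0 where "t0 = (\<lambda>\<omega>. (LBINT t:{0..T}. \<Phi>0 t \<omega>) + (K * (xbar T \<omega>)\<^sup>2 + 2 * \<kappa> * xbar T \<omega>))"
  define t1 where "t1 = (\<lambda>\<omega>. (LBINT t:{0..T}. \<Phi>1 t \<omega>) + h T * (K * xbar T \<omega> + \<kappa>))"
  define t2 where "t2 = (LBINT t:{0..T}. \<Phi>2 t) + K * (h T)\<^sup>2"
  note xL = L2_state[OF follower0] and vL = L2_controls(2)[OF follower0]
  have TT: "T \<in> {0..T}" using T by simp
  have hb: "bounded_measurable_on 0 T h" unfolding h_def by (rule needle_response_bounded)
  have C0: "C \<in> sets M" by (rule C_events[OF C ab])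
  have Cm: "indicat_real C \<in> borel_measurable M" "\<And>\<omega>. \<bar>indicat_real C \<omega>\<bar> \<le> 1" using C0 by (auto simp: indicator_def)
  have i0: "integrable_process M T \<Phi>0"
  proof -
    have "integrable_process M T (\<lambda>t \<omega>. L t * (xbar t \<omega>)\<^sup>2 + R t * (v1bar t \<omega>)\<^sup>2 + (2 * l t) * xbar t \<omega> + (2 * r t) * v1bar t \<omega>)"
      by (intro integrable_process_add integrable_process_coeff L2_bounded_integrable_process xL vL L R
          bounded_measurable_on_mult bounded_measurable_on_const l r)
    then show ?thesis by (simp add: \<Phi>0_def)
  qed
  have lin: "L2_bounded T (\<lambda>t \<omega>. L t * xbar t \<omega> + l t)" "L2_bounded T (\<lambda>t \<omega>. R t * v1bar t \<omega> + r t)"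
    by (intro L2_bounded_add L2_bounded_coeff L2_bounded_time xL vL L R l r)+
  have i1: "integrable_process M T \<Phi>1"
    unfolding \<Phi>1_def by (intro integrable_process_add integrable_process_coeff L2_bounded_integrable_process lin hb bounded_measurable_on_needle)
  have i2: "set_integrable lborel {0..T} \<Phi>2"
    unfolding \<Phi>2_def by (intro bounded_measurable_on_integrable bounded_measurable_on_add bounded_measurable_on_mult L R hb bounded_measurable_on_needle)
  have xT: "integrable M (\<lambda>\<omega>. (xbar T \<omega>)\<^sup>2)" "integrable M (xbar T)" using L2_bounded_square_integrable[OF xL TT] by auto
  have t0i: "integrable M t0" unfolding t0_def using integrable_process_paths(2)[OF i0] xT by simp
  have t1i: "integrable M t1" unfolding t1_def using integrable_process_paths(2)[OF i1] xT by simp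
  have Ct1i: "integrable M (\<lambda>\<omega>. indicator C \<omega> * t1 \<omega>)" by (rule integrable_bounded_mult[OF t1i Cm(1)]) (use Cm in auto)
  have total: "AE \<omega> in M. (LBINT t:{0..T}. L t * (x (needle C a b \<epsilon>) v2 t \<omega>)\<^sup>2 + R t * (needle C a b \<epsilon> t \<omega>)\<^sup>2
        + 2 * l t * x (needle C a b \<epsilon>) v2 t \<omega> + 2 * r t * needle C a b \<epsilon> t \<omega>)
      + K * (x (needle C a b \<epsilon>) v2 T \<omega>)\<^sup>2 + 2 * \<kappa> * x (needle C a b \<epsilon>) v2 T \<omega>
    = t0 \<omega> + (2 * \<epsilon>) * (indicator C \<omega> * t1 \<omega>) + (\<epsilon>\<^sup>2 * t2) * indicator C \<omega>" for \<epsilon>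
    using needle_state[OF C ab, of \<epsilon>] integrable_process_paths(1)[OF i0] integrable_process_paths(1)[OF i1]
  proof eventually_elim
    case (elim \<omega>)
    define e where "e = \<epsilon> * indicat_real C \<omega>"
    have xe: "x (needle C a b \<epsilon>) v2 t \<omega> = xbar t \<omega> + e * h t" if "t \<in> {0..T}" for t
      using elim(1) that by (simp add: e_def h_def)
    have ve: "needle C a b \<epsilon> t \<omega> = v1bar t \<omega> + e * ?\<iota> t" for t by (simp add: needle_def e_def)
    have "(LBINT t:{0..T}. L t * (x (needle C a b \<epsilon>) v2 t \<omega>)\<^sup>2 + R t * (needle C a b \<epsilon> t \<omega>)\<^sup>2
        + 2 * l t * x (needle C a b \<epsilon>) v2 t \<omega> + 2 * r t * needle C a b \<epsilon> t \<omega>)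
      = (LBINT t:{0..T}. \<Phi>0 t \<omega> + (2 * e) * \<Phi>1 t \<omega> + (e\<^sup>2) * \<Phi>2 t)"
      by (rule set_lebesgue_integral_cong)
         (auto simp: xe ve \<Phi>0_def \<Phi>1_def \<Phi>2_def power2_eq_square algebra_simps)
    also have "\<dots> = (LBINT t:{0..T}. \<Phi>0 t \<omega>) + (2 * e) * (LBINT t:{0..T}. \<Phi>1 t \<omega>) + e\<^sup>2 * (LBINT t:{0..T}. \<Phi>2 t)"
    proof -
      note j1 = set_integrable_mult_right[of "2 * e", OF elim(3)] and j2 = set_integrable_mult_right[of "e\<^sup>2", OF i2]
      show ?thesis
        unfolding set_integral_add(2)[OF set_integral_add(1)[OF elim(2) j1] j2] set_integral_add(2)[OF elim(2) j1]
          set_integral_mult_right ..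
    qed
    also have "\<dots> + K * (x (needle C a b \<epsilon>) v2 T \<omega>)\<^sup>2 + 2 * \<kappa> * x (needle C a b \<epsilon>) v2 T \<omega> = t0 \<omega> + 2 * e * t1 \<omega> + e\<^sup>2 * t2"
      unfolding xe[OF TT] by (simp add: t0_def t1_def t2_def power2_eq_square algebra_simps)
    also have "\<dots> = t0 \<omega> + (2 * \<epsilon>) * (indicator C \<omega> * t1 \<omega>) + (\<epsilon>\<^sup>2 * t2) * indicator C \<omega>"
      by (auto simp: e_def indicator_def)
    finally show ?case .
  qed
  have meas_cost: "(\<lambda>\<omega>. (LBINT t:{0..T}. L t * (x v1 v2 t \<omega>)\<^sup>2 + R t * (v1 t \<omega>)\<^sup>2 + 2 * l t * x v1 v2 t \<omega> + 2 * r t * v1 t \<omega>)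
      + K * (x v1 v2 T \<omega>)\<^sup>2 + 2 * \<kappa> * x v1 v2 T \<omega>) \<in> borel_measurable M"
    if v1: "v1 \<in> follower_controls0 M W T f1 xunc" for v1
  proof -
    note XL = L2_state[OF v1] and VL = L2_controls(2)[OF v1]
    have "integrable_process M T (\<lambda>t \<omega>. L t * (x v1 v2 t \<omega>)\<^sup>2 + R t * (v1 t \<omega>)\<^sup>2 + (2 * l t) * x v1 v2 t \<omega> + (2 * r t) * v1 t \<omega>)"
      by (intro integrable_process_add integrable_process_coeff L2_bounded_integrable_process XL VL L R
          bounded_measurable_on_mult bounded_measurable_on_const l r)
    from integrable_process_paths(2)[OF this] show ?thesis
      using L2_bounded_square_integrable(3)[OF XL TT] by (intro borel_measurable_add borel_measurable_times borel_measurable_power borel_measurable_const) auto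
  qed
  have cost: "follower_cost M T L R l r K \<kappa> x (needle C a b \<epsilon>) v2
    = 1/2 * expectation t0 + \<epsilon> * expectation (\<lambda>\<omega>. indicator C \<omega> * t1 \<omega>) + \<epsilon>\<^sup>2 * (t2 * prob C / 2)" for \<epsilon>
  proof -
    have Ci: "integrable M (indicat_real C)" using integrable_bounded_mult[of M "\<lambda>_. 1", OF _ Cm(1)] Cm(2) by auto
    have "follower_cost M T L R l r K \<kappa> x (needle C a b \<epsilon>) v2
      = 1/2 * expectation (\<lambda>\<omega>. t0 \<omega> + (2 * \<epsilon>) * (indicator C \<omega> * t1 \<omega>) + (\<epsilon>\<^sup>2 * t2) * indicator C \<omega>)"
      unfolding follower_cost_def
      by (intro arg_cong2[where f="(*)"] refl integral_cong_AE total meas_cost[OF needle_admissible0[OF C ab]])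
        (use t0i Ct1i Cm(1) in auto)
    also have "expectation (\<lambda>\<omega>. t0 \<omega> + (2 * \<epsilon>) * (indicator C \<omega> * t1 \<omega>) + (\<epsilon>\<^sup>2 * t2) * indicator C \<omega>)
      = expectation t0 + 2 * \<epsilon> * expectation (\<lambda>\<omega>. indicator C \<omega> * t1 \<omega>) + (\<epsilon>\<^sup>2 * t2) * prob C"
      using t0i Ct1i Ci C0 by simp
    finally show ?thesis by (simp add: algebra_simps)
  qed
  have cost0: "follower_cost M T L R l r K \<kappa> x v1bar v2 = 1/2 * expectation t0"
    unfolding follower_cost_def t0_def \<Phi>0_def by (simp add: add.assoc)
  have stat: "expectation (\<lambda>\<omega>. indicator C \<omega> * t1 \<omega>) = 0"
  proof (rule linear_coefficient_zero)
    fix \<epsilon>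
    show "0 \<le> \<epsilon> * expectation (\<lambda>\<omega>. indicator C \<omega> * t1 \<omega>) + \<epsilon>\<^sup>2 * (t2 * prob C / 2)"
      using optimal[OF needle_admissible[OF C ab, of \<epsilon>]] unfolding cost cost0 by simp
  qed
  have split: "expectation (\<lambda>\<omega>. indicator C \<omega> * \<Phi>1 t \<omega>) = h t * \<beta> t + ?\<iota> t * \<rho> t" if t: "t \<in> {0..T}" for t
  proof -
    have i: "integrable M (\<lambda>\<omega>. indicator C \<omega> * (L t * xbar t \<omega> + l t))" "integrable M (\<lambda>\<omega>. indicator C \<omega> * (R t * v1bar t \<omega> + r t))"
      using L2_bounded_square_integrable(2)[OF lin(1) t] L2_bounded_square_integrable(2)[OF lin(2) t] Cm
      by (auto intro!: integrable_bounded_mult[where L=1])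
    have "expectation (\<lambda>\<omega>. indicator C \<omega> * \<Phi>1 t \<omega>)
      = expectation (\<lambda>\<omega>. h t * (indicator C \<omega> * (L t * xbar t \<omega> + l t)) + ?\<iota> t * (indicator C \<omega> * (R t * v1bar t \<omega> + r t)))"
      by (simp add: \<Phi>1_def distrib_left mult.left_commute)
    also have "\<dots> = h t * \<beta> t + ?\<iota> t * \<rho> t"
      unfolding \<beta>_def \<rho>_def
      by (subst Bochner_Integration.integral_add, (intro integrable_mult_right i)+) simp
    finally show ?thesis .
  qed
  have C1i: "integrable_process M T (\<lambda>t \<omega>. indicator C \<omega> * \<Phi>1 t \<omega>)" by (rule integrable_process_omega_bounded[OF i1 Cm])
  have terminal: "integrable M (\<lambda>\<omega>. indicator C \<omega> * (K * xbar T \<omega> + \<kappa>))"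
    using xT Cm by (intro integrable_bounded_mult[where L=1]) auto
  have "expectation (\<lambda>\<omega>. indicator C \<omega> * t1 \<omega>)
    = expectation (\<lambda>\<omega>. (LBINT t:{0..T}. indicator C \<omega> * \<Phi>1 t \<omega>) + h T * (indicator C \<omega> * (K * xbar T \<omega> + \<kappa>)))"
    unfolding t1_def set_integral_mult_right by (simp add: distrib_left mult.left_commute)
  also have "\<dots> = expectation (\<lambda>\<omega>. LBINT t:{0..T}. indicator C \<omega> * \<Phi>1 t \<omega>)
      + h T * expectation (\<lambda>\<omega>. indicator C \<omega> * (K * xbar T \<omega> + \<kappa>))"
    using integrable_process_paths(2)[OF C1i] terminal
    by (subst Bochner_Integration.integral_add) (auto intro!: integrable_mult_right)
  also have "expectation (\<lambda>\<omega>. LBINT t:{0..T}. indicator C \<omega> * \<Phi>1 t \<omega>) = (LBINT t:{0..T}. expectation (\<lambda>\<omega>. indicator C \<omega> * \<Phi>1 t \<omega>))"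
    by (rule integrable_process_paths(5)[OF C1i])
  also have "\<dots> = (LBINT t:{0..T}. h t * \<beta> t + ?\<iota> t * \<rho> t)"
    by (rule set_lebesgue_integral_cong) (use split in auto)
  finally show ?thesis using stat by simp
qed

text \<open>
  The first-order condition is stated in terms of the response \<open>h\<close>. By \<open>linear_ode_duality\<close> on \<open>[a,T]\<close>,
  applied to \<open>\<phi>(t) = E[1\<^bsub>C\<^esub> p(t)]\<close>, the terms containing \<open>h\<close> equal the integral of \<open>\<phi> B\<^sub>1\<close> over
  \<open>(a, b]\<close>; before \<open>a\<close> both \<open>h\<close> and the source of the needle vanish.
\<close>

lemma averaged_stationarity:
  assumes C: "C \<in> sets (generated_filtration M Ybar a)" and ab: "0 \<le> a" "a < b" "b \<le> T"
  shows "(LBINT t:{0..T}. indicator {a<..b} t * expectation (\<lambda>\<omega>. indicator C \<omega> * (R t * v1bar t \<omega> + r t + B1 t * p t \<omega>))) = 0"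
proof -
  let ?\<iota> = "indicat_real {a<..b}"
  define h where "h = needle_response a b"
  define \<beta> where "\<beta> = (\<lambda>t. expectation (\<lambda>\<omega>. indicator C \<omega> * (L t * xbar t \<omega> + l t)))"
  define \<rho> where "\<rho> = (\<lambda>t. expectation (\<lambda>\<omega>. indicator C \<omega> * (R t * v1bar t \<omega> + r t)))"
  define \<phi> where "\<phi> = (\<lambda>t. expectation (\<lambda>\<omega>. indicator C \<omega> * p t \<omega>))"
  note xL = L2_state[OF follower0] and vL = L2_controls(2)[OF follower0]
  have lin: "L2_bounded T (\<lambda>t \<omega>. L t * xbar t \<omega> + l t)" "L2_bounded T (\<lambda>t \<omega>. R t * v1bar t \<omega> + r t)"
    by (intro L2_bounded_add L2_bounded_coeff L2_bounded_time xL vL L R l r)+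
  have pL: "L2_bounded T p" using p unfolding solves_linear_bsde_def by (intro L2_bounded_if_sup_square_integrable) auto
  have TT: "T \<in> {0..T}" using T by simp
  have C0: "C \<in> sets M" by (rule C_events[OF C ab])
  have Cm: "indicat_real C \<in> borel_measurable M" "\<And>\<omega>. \<bar>indicat_real C \<omega>\<bar> \<le> 1" using C0 by (auto simp: indicator_def)
  have bb: "bounded_measurable_on 0 T \<beta>" "bounded_measurable_on 0 T \<rho>" "bounded_measurable_on 0 T \<phi>" "bounded_measurable_on 0 T h"
    unfolding \<beta>_def \<rho>_def \<phi>_def h_def
    by (intro L2_bounded_expectation[OF _ Cm] lin pL needle_response_bounded)+
  have sub: "{a..T} \<subseteq> {0..T}" using ab by auto
  note b = bounded_measurable_on_subset[OF _ sub]
  note adj = adjoint_expectation[OF p lin(1) ab(1) C]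
  have dual: "\<phi> T * h T = (LBINT s:{a..T}. \<phi> s * (B1 s * ?\<iota> s) - \<beta> s * h s)"
  proof (rule linear_ode_duality)
    show "\<phi> t = \<phi> T + (LBINT s:{t..T}. A s * \<phi> s + \<beta> s)" if "t \<in> {a..T}" for t
      using adj(1)[OF that] by (simp add: \<phi>_def \<beta>_def)
    show "h t = (LBINT s:{a..t}. A s * h s + B1 s * ?\<iota> s)" if t: "t \<in> {a..T}" for t
    proof -
      have "h t = (LBINT s:{0..t}. A s * h s + B1 s * ?\<iota> s)"
        unfolding h_def by (rule needle_response_eq) (use t ab in auto)
      also have "\<dots> = (LBINT s:{0..a}. A s * h s + B1 s * ?\<iota> s) + (LBINT s:{a..t}. A s * h s + B1 s * ?\<iota> s)"
        by (rule set_integral_Icc_combine[OF bounded_measurable_on_integrable[of 0 T]])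
          (use t ab in \<open>auto intro!: bounded_measurable_on_add bounded_measurable_on_mult A B1 bb bounded_measurable_on_needle\<close>)
      also have "(LBINT s:{0..a}. A s * h s + B1 s * ?\<iota> s) = (LBINT s:{0..a}. 0)"
        by (rule set_lebesgue_integral_cong) (auto simp: h_def needle_response_before)
      finally show ?thesis by simp
    qed
  qed (use ab in \<open>auto intro!: b bb A B1 bounded_measurable_on_mult bounded_measurable_on_needle\<close>)
  have "\<phi> T = expectation (\<lambda>\<omega>. indicator C \<omega> * (K * xbar T \<omega> + \<kappa>))"
    unfolding \<phi>_def
  proof (rule integral_cong_AE)
    show "AE \<omega> in M. indicator C \<omega> * p T \<omega> = indicator C \<omega> * (K * xbar T \<omega> + \<kappa>)"
      using adj(2)[of a] ab by auto
  qed (use Cm(1) L2_bounded_square_integrable(3)[OF pL TT] L2_bounded_square_integrable(3)[OF xL TT] in auto)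
  then have "(LBINT t:{0..T}. h t * \<beta> t + ?\<iota> t * \<rho> t) + h T * \<phi> T = 0"
    using first_order_condition[OF C ab] by (simp add: h_def \<beta>_def \<rho>_def)
  moreover have "\<phi> T * h T = (LBINT s:{0..T}. \<phi> s * (B1 s * ?\<iota> s) - \<beta> s * h s)"
  proof -
    have "(LBINT s:{0..T}. \<phi> s * (B1 s * ?\<iota> s) - \<beta> s * h s)
      = (LBINT s:{0..a}. \<phi> s * (B1 s * ?\<iota> s) - \<beta> s * h s) + (LBINT s:{a..T}. \<phi> s * (B1 s * ?\<iota> s) - \<beta> s * h s)"
      by (rule set_integral_Icc_combine[OF bounded_measurable_on_integrable[of 0 T]])
        (use ab in \<open>auto intro!: bounded_measurable_on_diff bounded_measurable_on_mult B1 bb bounded_measurable_on_needle\<close>)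
    also have "(LBINT s:{0..a}. \<phi> s * (B1 s * ?\<iota> s) - \<beta> s * h s) = (LBINT s:{0..a}. 0)"
      by (rule set_lebesgue_integral_cong) (auto simp: h_def needle_response_before)
    finally show ?thesis using dual by simp
  qed
  ultimately have "0 = (LBINT t:{0..T}. h t * \<beta> t + ?\<iota> t * \<rho> t) + (LBINT s:{0..T}. \<phi> s * (B1 s * ?\<iota> s) - \<beta> s * h s)"
    by (simp add: mult.commute)
  also have "\<dots> = (LBINT t:{0..T}. (h t * \<beta> t + ?\<iota> t * \<rho> t) + (\<phi> t * (B1 t * ?\<iota> t) - \<beta> t * h t))"
    by (rule set_integral_add(2)[symmetric]; intro bounded_measurable_on_integrable bounded_measurable_on_add bounded_measurable_on_diff
        bounded_measurable_on_mult B1 bb bounded_measurable_on_needle)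
  also have "\<dots> = (LBINT t:{0..T}. ?\<iota> t * expectation (\<lambda>\<omega>. indicator C \<omega> * (R t * v1bar t \<omega> + r t + B1 t * p t \<omega>)))"
  proof (rule set_lebesgue_integral_cong)
    show "\<forall>t. t \<in> {0..T} \<longrightarrow> (h t * \<beta> t + ?\<iota> t * \<rho> t) + (\<phi> t * (B1 t * ?\<iota> t) - \<beta> t * h t)
      = ?\<iota> t * expectation (\<lambda>\<omega>. indicator C \<omega> * (R t * v1bar t \<omega> + r t + B1 t * p t \<omega>))"
    proof (intro allI impI)
      fix t assume t: "t \<in> {0..T}"
      have i: "integrable M (\<lambda>\<omega>. indicator C \<omega> * (R t * v1bar t \<omega> + r t))" "integrable M (\<lambda>\<omega>. indicator C \<omega> * p t \<omega>)"
        using L2_bounded_square_integrable(2)[OF lin(2) t] L2_bounded_square_integrable(2)[OF pL t] Cm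
        by (auto intro!: integrable_bounded_mult[where L=1])
      have "expectation (\<lambda>\<omega>. indicator C \<omega> * (R t * v1bar t \<omega> + r t + B1 t * p t \<omega>))
        = expectation (\<lambda>\<omega>. indicator C \<omega> * (R t * v1bar t \<omega> + r t) + B1 t * (indicator C \<omega> * p t \<omega>))"
        by (simp add: distrib_left mult.left_commute add.assoc)
      also have "\<dots> = \<rho> t + B1 t * \<phi> t"
        unfolding \<rho>_def \<phi>_def by (subst Bochner_Integration.integral_add, rule i(1), intro integrable_mult_right i(2)) simp
      finally show "(h t * \<beta> t + ?\<iota> t * \<rho> t) + (\<phi> t * (B1 t * ?\<iota> t) - \<beta> t * h t)
        = ?\<iota> t * expectation (\<lambda>\<omega>. indicator C \<omega> * (R t * v1bar t \<omega> + r t + B1 t * p t \<omega>))"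
        by (simp add: algebra_simps)
    qed
  qed simp
  finally show ?thesis ..
qed

end

section \<open>From time averages to almost every time\<close>

text \<open>
  Intervals \<open>(a, b]\<close> are stable under intersection and generate the Borel sets.
\<close>

lemma AE_zero_if_interval_integrals_zero:
  fixes \<gamma> :: "real \<Rightarrow> real"
  assumes \<gamma>: "set_integrable lborel {0..T} \<gamma>" and s: "0 \<le> s"
    and zero: "\<And>a b. s \<le> a \<Longrightarrow> a < b \<Longrightarrow> b \<le> T \<Longrightarrow> (LBINT t:{0..T}. indicator {a<..b} t * \<gamma> t) = 0"
  shows "AE t in lborel. t \<in> {0..T} \<longrightarrow> s < t \<longrightarrow> \<gamma> t = 0"
proof -
  define f where "f = (\<lambda>t. indicator {s<..T} t * \<gamma> t)"
  have f: "integrable lborel f"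
  proof -
    have "set_integrable lborel {s<..T} \<gamma>" by (rule set_integrable_subset[OF \<gamma>]) (use s in auto)
    then show ?thesis by (simp add: set_integrable_def f_def)
  qed
  have Ioc: "(LINT t|lborel. indicator {a<..b} t * f t) = 0" for a b
  proof (cases "max a s < min b T")
    case True
    have "(LINT t|lborel. indicator {a<..b} t * f t) = (LBINT t:{0..T}. indicator {max a s<..min b T} t * \<gamma> t)"
      unfolding set_lebesgue_integral_def f_def using s
      by (intro Bochner_Integration.integral_cong) (auto simp: indicator_def)
    then show ?thesis using zero[of "max a s" "min b T"] True by simp
  next
    case False
    then have "(\<lambda>t. indicator {a<..b} t * f t) = (\<lambda>t. 0)" by (auto simp: f_def indicator_def fun_eq_iff)
    then show ?thesis by simp
  qed
  have total: "(LINT t|lborel. f t) = 0"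
  proof -
    have "(\<lambda>t. indicator {s<..T} t * f t) = f" by (auto simp: f_def indicator_def fun_eq_iff)
    then show ?thesis using Ioc[of s T] by simp
  qed
  let ?E = "range (\<lambda>(i, j). {i<..j :: real})"
  have sets: "sets (lborel :: real measure) = sigma_sets (space lborel) ?E"
    by (simp add: borel_sigma_sets_Ioc sets_measure_of)
  have stable: "Int_stable ?E"
  proof (rule Int_stableI)
    fix a b :: "real set" assume "a \<in> ?E" "b \<in> ?E"
    then obtain i j k l where "a = {i<..j}" "b = {k<..l}" by auto
    then have "a \<inter> b = (\<lambda>(i, j). {i<..j}) (max i k, min j l)" by auto
    then show "a \<inter> b \<in> ?E" by (rule range_eqI)
  qed
  have all: "(LINT t|lborel. indicator C t * f t) = 0" if "C \<in> sets lborel" for C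
  proof (rule set_integral_zero_on_sigma_sets[OF f _ stable _ total])
    show "?E \<subseteq> sets lborel" by auto
    show "(LINT t|lborel. indicator D t * f t) = 0" if "D \<in> ?E" for D using that Ioc by auto
    show "C \<in> sigma_sets (space lborel) ?E" using that sets by simp
  qed
  have "AE t in lborel. f t = 0"
    by (rule AE_zero_if_set_integrals_zero[OF _ borel_measurable_integrable[OF f] f all]) (simp_all add: subalgebra_def)
  then show ?thesis by eventually_elim (auto simp: f_def)
qed

context follower_problem begin

lemma Ybar_continuous: "AE \<omega> in M. continuous_on {0..T} (\<lambda>t. Ybar t \<omega>)"
proof -
  have "AE \<omega> in M. continuous_on {0..T} (\<lambda>t. W t \<omega>)" using W by (simp add: brownian_motion_def continuous_process_def)
  then show ?thesis
    using integrable_process_paths(1)[OF L2_bounded_integrable_process(2)[OF L2_observation_drift(1)[OF follower0]]]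
  proof eventually_elim
    case (elim \<omega>)
    then show ?case unfolding Y1_def observation_def
      by (intro continuous_intros continuous_on_set_integral_Icc)
  qed
qed

definition cylinder :: "(real \<times> real) set \<Rightarrow> 'a set"
  where "cylinder S = {\<omega> \<in> space M. \<forall>(q, y)\<in>S. Ybar q \<omega> \<le> y}"

definition rational_cylinder_indices :: "(real \<times> real) set set"
  where "rational_cylinder_indices = {S. finite S \<and> S \<subseteq> (\<rat> \<inter> {0..T}) \<times> \<rat>}"

lemma countable_rational_cylinder_indices: "countable rational_cylinder_indices"
proof -
  have "countable ((\<rat> \<inter> {0..T}) \<times> (\<rat> :: real set))"
    using countable_rat by (intro countable_SIGMA countable_Int1)
  from countable_Collect_finite_subset[OF this] show ?thesis
    by (simp add: rational_cylinder_indices_def conj_commute)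
qed

lemma cylinder_sets:
  assumes "finite S" "\<And>q y. (q, y) \<in> S \<Longrightarrow> 0 \<le> q \<and> q \<le> s"
  shows "cylinder S \<in> sets (generated_filtration M Ybar s)"
  using assms
proof (induction S)
  case empty
  show ?case using sets.top[of "generated_filtration M Ybar s"] by (simp add: cylinder_def)
next
  case (insert z S)
  obtain q y where z: "z = (q, y)" by (cases z)
  have "q \<in> {0..s}" using insert.prems[of q y] z by auto
  note [measurable] = measurable_generated_filtration[OF this, of Ybar M]
  have "{\<omega> \<in> space (generated_filtration M Ybar s). Ybar q \<omega> \<le> y} \<in> sets (generated_filtration M Ybar s)" by measurable
  moreover have "cylinder S \<in> sets (generated_filtration M Ybar s)" using insert by auto
  moreover have "cylinder (insert z S) = {\<omega> \<in> space (generated_filtration M Ybar s). Ybar q \<omega> \<le> y} \<inter> cylinder S"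
    by (auto simp: cylinder_def z)
  ultimately show ?case by auto
qed

text \<open>
  Every \<open>r \<le> t\<close> is a limit of rationals strictly below \<open>t\<close>, and the observation is continuous almost
  surely. The strict inequality matters, since for an event seen at time \<open>q\<close> the stationarity is
  available after \<open>q\<close> only.
\<close>

lemma history_generated_by_rational_cylinders:
  assumes t: "0 < t" "t \<le> T"
  defines "E \<equiv> {cylinder S |S. S \<in> rational_cylinder_indices \<and> (\<forall>(q, y)\<in>S. q < t)}"
  assumes C: "C \<in> sets (generated_filtration M Ybar t)"
  shows "\<exists>C'\<in>sigma_sets (space M) E. AE \<omega> in M. \<omega> \<in> C \<longleftrightarrow> \<omega> \<in> C'"
proof -
  define H where "H = sigma (space M) E"
  have EP: "E \<subseteq> Pow (space M)" by (auto simp: E_def cylinder_def)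
  have H: "space H = space M" "sets H = sigma_sets (space M) E" using EP by (auto simp: H_def)
  have "E \<subseteq> sets M"
  proof
    fix e assume "e \<in> E"
    then obtain S where S: "e = cylinder S" "S \<in> rational_cylinder_indices" by (auto simp: E_def)
    then have "cylinder S \<in> sets (generated_filtration M Ybar T)"
      by (intro cylinder_sets) (auto simp: rational_cylinder_indices_def)
    moreover have "subalgebra M (generated_filtration M Ybar T)"
      by (rule generated_filtration_least) (auto intro: measurable_Y(1)[OF follower0])
    ultimately show "e \<in> sets M" using S by (auto simp: subalgebra_def)
  qed
  then have HM: "subalgebra M H" using H by (simp add: subalgebra_def sets.sigma_sets_subset)
  have Yq: "Ybar q \<in> borel_measurable H" if q: "q \<in> \<rat>" "0 \<le> q" "q < t" for q
  proof (rule borel_measurableI_less)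
    fix y :: real
    have "{\<omega> \<in> space H. Ybar q \<omega> < y} = (\<Union>u\<in>{u\<in>\<rat>. u < y}. cylinder {(q, u)})"
    proof (intro equalityI subsetI)
      fix \<omega> assume "\<omega> \<in> {\<omega> \<in> space H. Ybar q \<omega> < y}"
      moreover then obtain u where "u \<in> \<rat>" "Ybar q \<omega> < u" "u < y" using Rats_dense_in_real[of "Ybar q \<omega>" y] by auto
      ultimately show "\<omega> \<in> (\<Union>u\<in>{u\<in>\<rat>. u < y}. cylinder {(q, u)})" using H by (auto simp: cylinder_def intro!: bexI[of _ u])
    qed (use H in \<open>auto simp: cylinder_def\<close>)
    also have "\<dots> \<in> sets H"
    proof (rule sets.countable_UN'')
      show "countable {u \<in> \<rat>. u < y}" using countable_rat by (rule countable_subset[rotated]) auto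
      fix u assume "u \<in> {u \<in> \<rat>. u < y}"
      then have "{(q, u)} \<in> rational_cylinder_indices" "\<forall>(q, y)\<in>{(q, u)}. q < t"
        using q t by (auto simp: rational_cylinder_indices_def)
      then have "cylinder {(q, u)} \<in> E" unfolding E_def by blast
      then show "cylinder {(q, u)} \<in> sets H" unfolding H(2) by (rule sigma_sets.Basic)
    qed
    finally show "{\<omega> \<in> space H. Ybar q \<omega> < y} \<in> sets H" .
  qed
  let ?G = "augmented M (\<lambda>_. H) t"
  have G: "subalgebra ?G H" "null_sets M \<subseteq> sets ?G" using augmented_contains[of "\<lambda>_. H" t M] H by auto
  have GM: "subalgebra M ?G" using HM H by (intro augmented_least) (auto simp: null_sets_def)
  have "subalgebra ?G (generated_filtration M Ybar t)"
  proof (rule generated_filtration_least)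
    fix r assume r: "r \<in> {0..t}"
    then obtain q where q: "\<And>n. q n \<in> \<rat>" "\<And>n. 0 \<le> q n" "\<And>n. q n < t" "q \<longlonglongrightarrow> r"
      using rational_sequence_below[of r t] t by auto
    have "(\<lambda>\<omega>. lim (\<lambda>n. Ybar (q n) \<omega>)) \<in> borel_measurable ?G"
      by (intro borel_measurable_lim_metric measurable_mono_subalgebra[OF G(1)] Yq q)
    then show "Ybar r \<in> borel_measurable ?G"
    proof (rule measurable_AE_eq_complete[OF complete GM G(2)])
      show "AE \<omega> in M. lim (\<lambda>n. Ybar (q n) \<omega>) = Ybar r \<omega>"
        using Ybar_continuous
      proof eventually_elim
        case (elim \<omega>)
        have "q n \<in> {0..T}" for n using q(2)[of n] q(3)[of n] t by simp
        then have "(\<lambda>n. Ybar (q n) \<omega>) \<longlonglongrightarrow> Ybar r \<omega>"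
          using continuous_on_tendsto_compose[OF elim q(4)] r t by auto
        then show ?case by (rule limI)
      qed
    qed
  qed simp
  then have "C \<in> sets ?G" using C by (auto simp: subalgebra_def)
  from augmented_sets_AE[of "\<lambda>_. H" t M, OF H(1) this] show ?thesis by (simp add: H)
qed

end

context optimal_follower begin

text \<open>
  For each of the countably many cylinders the expectation vanishes at almost every time after the last of its
  observation times \<open>s\<close>. Off the union of the exceptional null sets it vanishes for all of them, hence on the
  sigma-algebra that they generate.
\<close>

lemma conditional_stationarity:
  shows "AE t in lborel. t \<in> {0..T} \<longrightarrow>
    (\<forall>C\<in>sets (generated_filtration M Ybar t).
      expectation (\<lambda>\<omega>. indicator C \<omega> * (R t * v1bar t \<omega> + r t + B1 t * p t \<omega>)) = 0)"
proof -
  define \<Gamma> where "\<Gamma> = (\<lambda>t \<omega>. R t * v1bar t \<omega> + r t + B1 t * p t \<omega>)"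
  have pL: "L2_bounded T p" using p unfolding solves_linear_bsde_def by (intro L2_bounded_if_sup_square_integrable) auto
  have \<Gamma>L: "L2_bounded T \<Gamma>"
    unfolding \<Gamma>_def by (intro L2_bounded_add L2_bounded_coeff L2_bounded_time pL L2_controls(2) follower0 R r B1)
  have *: "AE t in lborel. t \<in> {0..T} \<longrightarrow> (\<forall>(q, y)\<in>S. q < t) \<longrightarrow> 0 < t \<longrightarrow> expectation (\<lambda>\<omega>. indicator (cylinder S) \<omega> * \<Gamma> t \<omega>) = 0"
    if S: "S \<in> rational_cylinder_indices" for S
  proof -
    define s where "s = Max (insert 0 (fst ` S))"
    have fin: "finite S" using S by (simp add: rational_cylinder_indices_def)
    have s: "0 \<le> s" "\<And>q y. (q, y) \<in> S \<Longrightarrow> 0 \<le> q \<and> q \<le> s"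
    proof -
      show "0 \<le> s" unfolding s_def using fin by (intro Max_ge) auto
      fix q y assume qy: "(q, y) \<in> S"
      then have "q \<in> insert 0 (fst ` S)" by force
      then have "q \<le> s" unfolding s_def using fin by (intro Max_ge) auto
      then show "0 \<le> q \<and> q \<le> s" using S qy by (auto simp: rational_cylinder_indices_def)
    qed
    have st: "s < t" if "\<forall>(q, y)\<in>S. q < t" "0 < t" for t
      unfolding s_def using that fin by (subst Max_less_iff) auto
    have cyl: "cylinder S \<in> sets (generated_filtration M Ybar a)" if "s \<le> a" for a
      using cylinder_sets[OF fin, of a] s(2) that by fastforce
    have ev: "cylinder S \<in> sets M"
    proof (cases "s < T")
      case True
      then show ?thesis using C_events[OF cyl s(1) True] by simp
    next
      case False
      then have "s \<le> T" using S fin T unfolding s_def by (auto simp: rational_cylinder_indices_def)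
      then have "cylinder S \<in> sets (generated_filtration M Ybar T)" by (rule cyl)
      then show ?thesis using Ybar_adapted_to_noise[of T] W.sub_F[of T] T by (auto simp: subalgebra_def)
    qed
    have "AE t in lborel. t \<in> {0..T} \<longrightarrow> s < t \<longrightarrow> expectation (\<lambda>\<omega>. indicator (cylinder S) \<omega> * \<Gamma> t \<omega>) = 0"
    proof (rule AE_zero_if_interval_integrals_zero[OF _ s(1)])
      show "set_integrable lborel {0..T} (\<lambda>t. expectation (\<lambda>\<omega>. indicator (cylinder S) \<omega> * \<Gamma> t \<omega>))"
        by (rule bounded_measurable_on_integrable[OF L2_bounded_expectation[OF \<Gamma>L, of _ 1]]) (use ev in \<open>auto simp: indicator_def\<close>)
      show "(LBINT t:{0..T}. indicator {a<..b} t * expectation (\<lambda>\<omega>. indicator (cylinder S) \<omega> * \<Gamma> t \<omega>)) = 0"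
        if "s \<le> a" "a < b" "b \<le> T" for a b
        using averaged_stationarity[OF cyl[OF that(1)] _ that(2,3)] s(1) that by (simp add: \<Gamma>_def)
    qed
    then show ?thesis by eventually_elim (use st in auto)
  qed
  have "AE t in lborel. \<forall>S\<in>rational_cylinder_indices. t \<in> {0..T} \<longrightarrow> (\<forall>(q, y)\<in>S. q < t) \<longrightarrow> 0 < t \<longrightarrow>
    expectation (\<lambda>\<omega>. indicator (cylinder S) \<omega> * \<Gamma> t \<omega>) = 0"
    using * by (subst AE_ball_countable[OF countable_rational_cylinder_indices]) auto
  moreover have "AE t in lborel. t \<noteq> (0::real)" by (rule AE_lborel_singleton)
  ultimately show ?thesis
  proof eventually_elim
    case (elim t)
    show ?case
    proof (intro impI ballI)
      fix C assume t: "t \<in> {0..T}" and C: "C \<in> sets (generated_filtration M Ybar t)"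
      then have t0: "0 < t" "t \<le> T" using elim(2) by auto
      let ?E = "{cylinder S |S. S \<in> rational_cylinder_indices \<and> (\<forall>(q, y)\<in>S. q < t)}"
      obtain C' where C': "C' \<in> sigma_sets (space M) ?E" "AE \<omega> in M. \<omega> \<in> C \<longleftrightarrow> \<omega> \<in> C'"
        using history_generated_by_rational_cylinders[OF t0 C] by blast
      have CM: "C \<in> sets M" using C Ybar_adapted_to_noise[OF t] W.sub_F[OF t] by (auto simp: subalgebra_def)
      have E: "?E \<subseteq> sets M"
      proof
        fix e assume "e \<in> ?E"
        then obtain S where S: "e = cylinder S" "S \<in> rational_cylinder_indices" by auto
        then have "e \<in> sets (generated_filtration M Ybar T)"
          by (auto intro!: cylinder_sets simp: rational_cylinder_indices_def)
        then show "e \<in> sets M" using Ybar_adapted_to_noise[of T] W.sub_F[of T] T by (auto simp: subalgebra_def)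
      qed
      have "expectation (\<lambda>\<omega>. indicator C' \<omega> * \<Gamma> t \<omega>) = 0"
      proof (rule set_integral_zero_on_sigma_sets[OF L2_bounded_square_integrable(2)[OF \<Gamma>L t] E _ _ _ C'(1)])
        show "Int_stable ?E"
        proof (rule Int_stableI)
          fix a b assume "a \<in> ?E" "b \<in> ?E"
          then obtain S S' where S: "a = cylinder S" "b = cylinder S'" "S \<in> rational_cylinder_indices" "S' \<in> rational_cylinder_indices"
            "\<forall>(q, y)\<in>S. q < t" "\<forall>(q, y)\<in>S'. q < t" by auto
          then have "a \<inter> b = cylinder (S \<union> S')" "S \<union> S' \<in> rational_cylinder_indices" "\<forall>(q, y)\<in>S \<union> S'. q < t"
            by (auto simp: cylinder_def rational_cylinder_indices_def)
          then show "a \<inter> b \<in> ?E" by blast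
        qed
        show zero: "expectation (\<lambda>\<omega>. indicator e \<omega> * \<Gamma> t \<omega>) = 0" if "e \<in> ?E" for e
          using that elim(1) t t0 by auto
        have "cylinder {} \<in> ?E" by (auto simp: rational_cylinder_indices_def intro!: exI[of _ "{}"])
        from zero[OF this] have "expectation (\<lambda>\<omega>. indicator (space M) \<omega> * \<Gamma> t \<omega>) = 0" by (simp add: cylinder_def)
        moreover have "expectation (\<lambda>\<omega>. indicator (space M) \<omega> * \<Gamma> t \<omega>) = expectation (\<Gamma> t)"
          by (rule Bochner_Integration.integral_cong) auto
        ultimately show "expectation (\<Gamma> t) = 0" by simp
      qed
      moreover have "expectation (\<lambda>\<omega>. indicator C \<omega> * \<Gamma> t \<omega>) = expectation (\<lambda>\<omega>. indicator C' \<omega> * \<Gamma> t \<omega>)"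
      proof (rule integral_cong_AE)
        have "C' \<in> sets M" using C'(1) sets.sigma_sets_subset[OF E] by auto
        then show "(\<lambda>\<omega>. indicator C \<omega> * \<Gamma> t \<omega>) \<in> borel_measurable M" "(\<lambda>\<omega>. indicator C' \<omega> * \<Gamma> t \<omega>) \<in> borel_measurable M"
          using CM L2_bounded_square_integrable(3)[OF \<Gamma>L t] by auto
        show "AE \<omega> in M. indicator C \<omega> * \<Gamma> t \<omega> = indicator C' \<omega> * \<Gamma> t \<omega>"
          using C'(2) by eventually_elim (auto simp: indicator_def)
      qed
      ultimately show "expectation (\<lambda>\<omega>. indicator C \<omega> * (R t * v1bar t \<omega> + r t + B1 t * p t \<omega>)) = 0"
        by (simp add: \<Gamma>_def)
    qed
  qed
qed

text \<open>
  The control is adapted to the augmented history only, whereas the conditional expectation refers to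
  the history itself. Therefore \<open>Z\<close> is tested with the sets of the augmented history, and these
  agree with sets of the history up to null sets.
\<close>

lemma follower_maximum_principle:
  shows "AE t in lborel. t \<in> {0..T} \<longrightarrow> (AE \<omega> in M. R t * v1bar t \<omega> + r t
    + B1 t * real_cond_exp M (generated_filtration M Ybar t) (p t) \<omega> = 0)"
  using conditional_stationarity
proof eventually_elim
  case (elim t)
  show ?case
  proof
    assume t: "t \<in> {0..T}"
    let ?F = "generated_filtration M Ybar t"
    have FM: "subalgebra M ?F"
      using t by (intro generated_filtration_least measurable_Y(1)[OF follower0]) auto
    interpret F: sigma_finite_subalgebra M ?F
      by (rule finite_measure_subalgebra_is_sigma_finite) (use FM in unfold_locales)
    have pL: "L2_bounded T p" using p unfolding solves_linear_bsde_def by (intro L2_bounded_if_sup_square_integrable) auto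
    note pi = L2_bounded_square_integrable(2)[OF pL t] and vi = L2_bounded_square_integrable(2)[OF L2_controls(2)[OF follower0] t]
    define e where "e = real_cond_exp M ?F (p t)"
    have ei: "integrable M e" "e \<in> borel_measurable ?F" unfolding e_def using F.real_cond_exp_int(1)[OF pi] by auto
    define Z where "Z = (\<lambda>\<omega>. R t * v1bar t \<omega> + r t + B1 t * e \<omega>)"
    have Zi: "integrable M Z" unfolding Z_def using vi ei by simp
    have hist: "subalgebra (history Ybar t) ?F" using augmented_contains(1)[of "generated_filtration M Ybar" t M] by simp
    have "v1bar t \<in> borel_measurable (history Ybar t)"
      using follower t by (auto simp: follower_controls_def adapted_def)
    then have Zm: "Z \<in> borel_measurable (history Ybar t)"
      unfolding Z_def using measurable_mono_subalgebra[OF hist ei(2)]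
      by (intro borel_measurable_add borel_measurable_times borel_measurable_const)
    have ZF: "expectation (\<lambda>\<omega>. indicator C \<omega> * Z \<omega>) = 0" if C: "C \<in> sets ?F" for C
    proof -
      have CM: "indicat_real C \<in> borel_measurable M" using C FM by (auto simp: subalgebra_def)
      have Ci: "integrable M (\<lambda>\<omega>. indicator C \<omega> * X \<omega>)" if "integrable M X" for X :: "'a \<Rightarrow> real"
        by (rule integrable_bounded_mult[OF that CM, of 1]) (auto simp: indicator_def)
      have "expectation (\<lambda>\<omega>. indicator C \<omega> * e \<omega>) = expectation (\<lambda>\<omega>. indicator C \<omega> * p t \<omega>)"
        unfolding e_def by (rule F.real_cond_exp_intg(2)) (use Ci[OF pi] C pi in auto)
      moreover have lin: "expectation (\<lambda>\<omega>. indicator C \<omega> * (R t * v1bar t \<omega> + r t + B1 t * X \<omega>))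
        = expectation (\<lambda>\<omega>. indicator C \<omega> * (R t * v1bar t \<omega> + r t)) + B1 t * expectation (\<lambda>\<omega>. indicator C \<omega> * X \<omega>)"
        if "integrable M X" for X
      proof -
        have "expectation (\<lambda>\<omega>. indicator C \<omega> * (R t * v1bar t \<omega> + r t + B1 t * X \<omega>))
          = expectation (\<lambda>\<omega>. indicator C \<omega> * (R t * v1bar t \<omega> + r t) + B1 t * (indicator C \<omega> * X \<omega>))"
          by (simp add: distrib_left mult.left_commute add.assoc)
        also have "\<dots> = expectation (\<lambda>\<omega>. indicator C \<omega> * (R t * v1bar t \<omega> + r t)) + B1 t * expectation (\<lambda>\<omega>. indicator C \<omega> * X \<omega>)"
          by (subst Bochner_Integration.integral_add) (use vi Ci[OF that] in \<open>auto intro!: Ci integrable_mult_right\<close>)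
        finally show ?thesis .
      qed
      moreover have "expectation (\<lambda>\<omega>. indicator C \<omega> * (R t * v1bar t \<omega> + r t + B1 t * p t \<omega>)) = 0"
        using elim t C by blast
      ultimately show ?thesis unfolding Z_def using lin[OF pi] lin[OF ei(1)] by simp
    qed
    have "AE \<omega> in M. Z \<omega> = 0"
    proof (rule AE_zero_if_set_integrals_zero[OF history_subalgebra(1)[OF follower0 t] Zm Zi])
      fix C assume C: "C \<in> sets (history Ybar t)"
      obtain C' where C': "C' \<in> sets ?F" "AE \<omega> in M. \<omega> \<in> C \<longleftrightarrow> \<omega> \<in> C'"
        using augmented_sets_AE[of "generated_filtration M Ybar" t M, OF _ C] by auto
      have "expectation (\<lambda>\<omega>. indicator C \<omega> * Z \<omega>) = expectation (\<lambda>\<omega>. indicator C' \<omega> * Z \<omega>)"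
      proof (rule integral_cong_AE)
        have "C \<in> sets M" "C' \<in> sets M" using C C'(1) FM history_subalgebra(1)[OF follower0 t] by (auto simp: subalgebra_def)
        then show "(\<lambda>\<omega>. indicator C \<omega> * Z \<omega>) \<in> borel_measurable M" "(\<lambda>\<omega>. indicator C' \<omega> * Z \<omega>) \<in> borel_measurable M"
          using Zi by auto
        show "AE \<omega> in M. indicator C \<omega> * Z \<omega> = indicator C' \<omega> * Z \<omega>"
          using C'(2) by eventually_elim (auto simp: indicator_def)
      qed
      then show "expectation (\<lambda>\<omega>. indicator C \<omega> * Z \<omega>) = 0" using ZF[OF C'(1)] by simp
    qed
    then show "AE \<omega> in M. R t * v1bar t \<omega> + r t + B1 t * real_cond_exp M ?F (p t) \<omega> = 0"
      by (simp add: Z_def e_def)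
  qed
qed

end

theorem theorem3p1:
  fixes P :: "'a measure"
    and T x0 M m :: real
    and W Wb xunc v1bar v2 p k kb :: "real \<Rightarrow> 'a \<Rightarrow> real"
    and A B1 B2 \<alpha> c cb f1 f2 g L R l r :: "real \<Rightarrow> real"
    and x :: "(real \<Rightarrow> 'a \<Rightarrow> real) \<Rightarrow> (real \<Rightarrow> 'a \<Rightarrow> real) \<Rightarrow> real \<Rightarrow> 'a \<Rightarrow> real"
  assumes "T > 0"
    and "prob_space P" and "complete_measure P"
    and "brownian_motion P T W" and "brownian_motion P T Wb"
    and "independent_processes P T W Wb"
    and A1: "\<forall>h\<in>{A, B1, B2, \<alpha>, c, cb, f1, f2, g}. bounded_coeff T h"
    and A2: "\<forall>h\<in>{L, R, l, r}. bounded_coeff T h"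
      "\<forall>t\<in>{0..T}. L t \<ge> 0 \<and> R t \<ge> 0" "M \<ge> 0"
    and uncontrolled_state: "solves_linear_sde P W Wb T A (\<lambda>t \<omega>. 0) c cb x0 xunc"
    and state:
      "\<forall>v2 \<in> leader_controls P W Wb T f2. \<forall>v1 \<in> follower_controls0 P W T f1 xunc.
        solves_linear_sde P W Wb T A (\<lambda>t \<omega>. B1 t * v1 t \<omega> + B2 t * v2 t \<omega> + \<alpha> t)
          c cb x0 (x v1 v2)"
    and information: "information_assumption P W Wb T f1 f2 g xunc x"
    and leader: "v2 \<in> leader_controls P W Wb T f2"
    and follower: "v1bar \<in> follower_controls P W T f1 g xunc x v2"
    and optimal: "\<forall>v1 \<in> follower_controls P W T f1 g xunc x v2.
      follower_cost P T L R l r M m x v1bar v2 \<le> follower_cost P T L R l r M m x v1 v2"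
    and adjoint: "solves_linear_bsde P W Wb T A (\<lambda>t \<omega>. L t * x v1bar v2 t \<omega> + l t)
      (\<lambda>\<omega>. M * x v1bar v2 T \<omega> + m) p k kb"
  shows "AE t in lborel. t \<in> {0..T} \<longrightarrow>
    (AE \<omega> in P. R t * v1bar t \<omega> + r t
      + B1 t * real_cond_exp P (generated_filtration P (Y1 W f1 g (x v1bar v2)) t) (p t) \<omega> = 0)"
proof -
  interpret prob_space P by fact
  interpret complete_measure P by fact
  interpret optimal_follower P T W Wb x0 xunc v1bar v2 A B1 B2 \<alpha> c cb f1 f2 g x L R l r M m p k kb
  proof unfold_locales
    show "sets (augmented P (generated_filtration P (Y2 W f2 v2)) t) \<subseteq>
      sets (augmented P (generated_filtration P (Y1_uncontrolled W f1 xunc)) t)" if "t \<in> {0..T}" for t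
      using information leader follower that unfolding information_assumption_def by blast
  qed (use assms in \<open>simp_all add: bounded_coeff_iff\<close>)
  show ?thesis by (rule follower_maximum_principle)
qed

end
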